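(* Let $\beta$ be a partition shape that is a rectangle with its lower right corner box removed. Let $\gamma$ be a $W\rightarrow O\rightarrow W$ shape or a $W\uparrow O\uparrow W$ shape which has no loose end ribbons. Then $\beta\circ\gamma \sim \beta^*\circ\gamma$, i.e. the skew Schur functions of $\beta\circ\gamma$ and $\beta^*\circ\gamma$ are equal.
   Context: Shapes are drawn in English notation: a partition $\lambda=(\lambda_1\ge\cdots\ge\lambda_i)$ is drawn as left-justified rows of boxes with $\lambda_1$ boxes in the top row, $\lambda_2$ in the next, etc. For partitions $\mu\le\lambda$ (containment of diagrams) the skew shape $\lambda/\mu$ consists of the boxes of $\lambda$ not in $\mu$ when the top-left corners are aligned. "Shape" means any skew shape (partition shapes included), possibly disconnected, considered up to translation. A ribbon is a shape containing no $2\times 2$ square of boxes. For a shape $\alpha$, $s_\alpha$ is its skew Schur function (sum over fillings with positive integers, weakly increasing along rows and strictly increasing down columns, of $\prod_i x_i^{\#\,i\text{'s}}$); write $\alpha\sim\beta$ if $s_\alpha=s_\beta$. $\alpha^*$ denotes the $180^\circ$ rotation of $\alpha$. A diagonal of a shape is the set of its boxes with a fixed value of (row index $-$ column index). WOW shapes. For shapes $W,\alpha$, $W$ lies in the top (resp. bottom) of $\alpha$ if $W$ occurs as a connected subdiagram of $\alpha$ containing the northeasternmost (resp. southwesternmost) box of $\alpha$. If $W$ lies in the top of $\alpha_1$ and the bottom of $\alpha_2$, the amalgamation $\alpha_1\amalg_W\alpha_2$ is the union of $\alpha_1$ and a translate of $\alpha_2$ in which the copy of $W$ in the bottom of $\alpha_2$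 coincides with the copy of $W$ in the top of $\alpha_1$. A shape $\alpha$ is a $W\rightarrow O\rightarrow W$ shape if: (1) $W$ lies both in the top and in the bottom of $\alpha$; (2) removing either copy of $W$ leaves a connected shape; (3) removing both copies leaves the shape $O$; (4) at least one diagonal lies strictly between the two copies of $W$; (5) the southwesternmost box of $O$ has a box of the lower copy of $W$ immediately to its west and the northeasternmost box of $O$ has a box of the upper copy of $W$ immediately to its east. It is a $W\uparrow O\uparrow W$ shape if it satisfies (1)–(4) and instead the southwesternmost box of $O$ has a box of the lower $W$ immediately to its south and the northeasternmost box of $O$ has a box of the upper $W$ immediately to its north. $W$ is assumed maximal: no other shape containing $W$ satisfies (1),(2) and occupies the same diagonals as $W$. For copies $\gamma_1,\gamma_2$ of such a $\gamma$: if $\gamma$ is $W\rightarrow O\rightarrow W$, $\gamma_1\cdot_W\gamma_2$ is the union of $\gamma_1$ and a translate of $\gamma_2$ whose lower copy of $W$ is one position northwest of the upper copy of $W$ in $\gamma_1$; if $\gamma$ is $W\uparrow O\uparrow W$, the same but one position southeast. Composition. For a shape $\alpha$ and a $W\rightarrow O\rightarrow W$ or $W\uparrow O\uparrow W$ shape $\gamma$, $\alpha\circ\gamma$ is the shape made of one copy $\gamma_b$ of $\gamma$ for each box $b$ of $\alpha$ (copies may overlap), positioned so that: if box $b_1$ of $\alpha$ is immediately west of box $b_2$, then $\gamma_{b_1},\gamma_{b_2}$ sit as $\gamma_{b_1}\amalg_W\gamma_{b_2}$ when $\gamma$ is $W\rightarrow O\rightarrow W$ and as $\gamma_{b_1}\cdot_W\gamma_{b_2}$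 when $\gamma$ is $W\uparrow O\uparrow W$; if $b_1$ is immediately south of $b_2$, they sit as $\gamma_{b_1}\cdot_W\gamma_{b_2}$ when $\gamma$ is $W\rightarrow O\rightarrow W$ and as $\gamma_{b_1}\amalg_W\gamma_{b_2}$ when $\gamma$ is $W\uparrow O\uparrow W$. Key ribbons. The upper-left ribbon of a connected shape is the set of its boxes whose northwest diagonal neighbour is not in the shape, and the bottom-right ribbon the set whose southeast diagonal neighbour is not in the shape; both are ordered from southwest (first) to northeast (last). In $\gamma\amalg_W\gamma$ call the southwestern copy the first $\gamma$ and the other the second $\gamma$. Top key ribbon of $\gamma$: if $\gamma$ is $W\rightarrow O\rightarrow W$, the part of the upper-left ribbon of $\gamma\amalg_W\gamma$ from the first box after the $O$ of the first $\gamma$ up to and including the last box of the $O$ of the second $\gamma$; if $\gamma$ is $W\uparrow O\uparrow W$, the part of the upper-left ribbon of $\gamma\amalg_W\gamma$ from the first box of the $O$ of the first $\gamma$ up to and including the last box not in the $O$ of the second $\gamma$. Bottom key ribbon: if $\gamma$ is $W\uparrow O\uparrow W$, the part of the bottom-right ribbon of $\gamma\amalg_W\gamma$ from the first box after the $O$ of the first $\gamma$ up to and including the last box of the $O$ of the second $\gamma$; if $\gamma$ is $W\rightarrow O\rightarrow W$, the part of the bottom-right ribbon from the first box of the $O$ of the first $\gamma$ up to and including the last box not in the $O$ of the second $\gamma$. The two key ribbons have the same size $n$. Taking out. Consider the coproduct $\Delta(\lambda/\nu)=\sum_{\nu\le\eta\le\lambda}\eta/\nu\otimes\lambda/\eta$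 (sum over partitions $\eta$; shapes up to translation, a disconnected shape identified with the product of its components). A shape $\mu$ can be taken out on the left of $\lambda/\nu$ if some term $\mu\otimes A$ occurs with nonzero coefficient, i.e. $\eta/\nu=\mu$ for some such $\eta$; it can be taken out on the right if $\lambda/\eta=\mu$ for some such $\eta$. No loose end ribbons. A $W\rightarrow O\rightarrow W$ shape $\gamma$ with key ribbon size $n$ has no loose end ribbons if no ribbon of length $n$ which begins to the left of the top key ribbon can be taken out on the left and no ribbon of length $n$ which ends to the right of the bottom key ribbon can be taken out on the right. A $W\uparrow O\uparrow W$ shape $\gamma$ has no loose end ribbons if no ribbon of length $n$ which ends to the right of the top key ribbon can be taken out on the left and no ribbon of length $n$ which begins to the left of the bottom key ribbon can be taken out on the right. *)

theory Defs
  imports Main "HOL-Library.Product_Plus" "HOL-Library.FuncSet"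
begin

section \<open>Boxes and shapes\<close>

text \<open>
  A box is (row, column), with rows numbered downwards as in English notation.  Sets of boxes carry
  a position, because amalgamation, composition and taking out ribbons all depend on positions;
  translation invariance is built into \<open>is_shape\<close>.
\<close>

type_synonym box = "int \<times> int"

definition translate :: "box \<Rightarrow> box set \<Rightarrow> box set" where
  "translate v S = (\<lambda>b. b + v) ` S"

definition is_partition :: "(nat \<Rightarrow> nat) \<Rightarrow> bool" where
  "is_partition \<kappa> \<longleftrightarrow> antimono \<kappa> \<and> finite {i. \<kappa> i \<noteq> 0}"

definition skew_diagram :: "(nat \<Rightarrow> nat) \<Rightarrow> (nat \<Rightarrow> nat) \<Rightarrow> box set" where
  "skew_diagram \<kappa> \<mu> = {(int i, int j) | i j. \<mu> i \<le> j \<and> j < \<kappa> i}"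

definition is_shape :: "box set \<Rightarrow> bool" where
  "is_shape S \<longleftrightarrow> (\<exists>\<kappa> \<mu> t. is_partition \<kappa> \<and> is_partition \<mu> \<and> \<mu> \<le> \<kappa> \<and>
     S = translate t (skew_diagram \<kappa> \<mu>))"

definition rotate180 :: "box set \<Rightarrow> box set" where
  "rotate180 S = uminus ` S"

definition adjacent :: "box \<Rightarrow> box \<Rightarrow> bool" where
  "adjacent x y \<longleftrightarrow> \<bar>fst x - fst y\<bar> + \<bar>snd x - snd y\<bar> = 1"

definition connected_boxes :: "box set \<Rightarrow> bool" where
  "connected_boxes S \<longleftrightarrow> S \<noteq> {} \<and>
     (\<forall>x\<in>S. \<forall>y\<in>S. (x, y) \<in> {(p, q). p \<in> S \<and> q \<in> S \<and> adjacent p q}\<^sup>*)"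

definition diag :: "box \<Rightarrow> int" where
  "diag b = fst b - snd b"

text \<open>Strict southwest-to-northeast order along a ribbon, which meets each diagonal at most once.\<close>

definition precedes :: "box \<Rightarrow> box \<Rightarrow> bool" where
  "precedes x y \<longleftrightarrow> diag y < diag x"

definition northeasternmost :: "box set \<Rightarrow> box \<Rightarrow> bool" where
  "northeasternmost S b \<longleftrightarrow> b \<in> S \<and> (\<forall>x\<in>S. fst b \<le> fst x \<and> snd x \<le> snd b)"

definition southwesternmost :: "box set \<Rightarrow> box \<Rightarrow> bool" where
  "southwesternmost S b \<longleftrightarrow> b \<in> S \<and> (\<forall>x\<in>S. fst x \<le> fst b \<and> snd b \<le> snd x)"

text \<open>
  Ribbons have a first and a last box, so they are connected.
\<close>

definition is_ribbon :: "box set \<Rightarrow> bool" where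
  "is_ribbon S \<longleftrightarrow> is_shape S \<and> connected_boxes S \<and>
     \<not> (\<exists>r c. {(r, c), (r, c + 1), (r + 1, c), (r + 1, c + 1)} \<subseteq> S)"

section \<open>Skew Schur functions\<close>

definition ssyt :: "box set \<Rightarrow> (box \<Rightarrow> nat) set" where
  "ssyt S = {T \<in> S \<rightarrow>\<^sub>E {1..}.
     (\<forall>r c c'. (r, c) \<in> S \<and> (r, c') \<in> S \<and> c < c' \<longrightarrow> T (r, c) \<le> T (r, c')) \<and>
     (\<forall>r r' c. (r, c) \<in> S \<and> (r', c) \<in> S \<and> r < r' \<longrightarrow> T (r, c) < T (r', c))}"

text \<open>
  A formal power series in \<open>x\<^sub>1, x\<^sub>2, \<dots>\<close> is given by its coefficients:
  \<open>skew_schur S e\<close> is the coefficient of \<open>\<Prod>\<^sub>i x\<^sub>i ^ e i\<close>.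
\<close>

definition skew_schur :: "box set \<Rightarrow> (nat \<Rightarrow> nat) \<Rightarrow> nat" where
  "skew_schur S e = card {T \<in> ssyt S. \<forall>i. card {b \<in> S. T b = i} = e i}"

definition schur_equiv :: "box set \<Rightarrow> box set \<Rightarrow> bool" (infix "\<sim>\<^sub>s" 50) where
  "A \<sim>\<^sub>s B \<longleftrightarrow> skew_schur A = skew_schur B"

section \<open>WOW shapes\<close>

definition lies_in_top :: "box set \<Rightarrow> box set \<Rightarrow> bool" where
  "lies_in_top W \<alpha> \<longleftrightarrow> is_shape W \<and> connected_boxes W \<and> W \<subseteq> \<alpha> \<and>
     (\<exists>b\<in>W. northeasternmost \<alpha> b)"

definition lies_in_bottom :: "box set \<Rightarrow> box set \<Rightarrow> bool" where
  "lies_in_bottom W \<alpha> \<longleftrightarrow> is_shape W \<and> connected_boxes W \<and> W \<subseteq> \<alpha> \<and>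
     (\<exists>b\<in>W. southwesternmost \<alpha> b)"

text \<open>
  From here on \<open>W\<close> is the lower copy inside \<open>\<gamma>\<close> and \<open>translate v W\<close> is the upper copy.
\<close>

definition W_at_both_ends :: "box set \<Rightarrow> box set \<Rightarrow> box \<Rightarrow> bool" where
  "W_at_both_ends \<gamma> W v \<longleftrightarrow>
     lies_in_bottom W \<gamma> \<and> lies_in_top (translate v W) \<gamma> \<and>
     is_shape (\<gamma> - W) \<and> connected_boxes (\<gamma> - W) \<and>
     is_shape (\<gamma> - translate v W) \<and> connected_boxes (\<gamma> - translate v W)"

definition O_part :: "box set \<Rightarrow> box set \<Rightarrow> box \<Rightarrow> box set" where
  "O_part \<gamma> W v = \<gamma> - W - translate v W"

text \<open>\<open>Rightward\<close> is \<open>W \<rightarrow> O \<rightarrow> W\<close> and \<open>Upward\<close> is \<open>W \<up> O \<up> W\<close>.\<close>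

datatype wow_kind = Rightward | Upward

definition wow_attached :: "wow_kind \<Rightarrow> box set \<Rightarrow> box set \<Rightarrow> box \<Rightarrow> bool" where
  "wow_attached k \<gamma> W v \<longleftrightarrow> (case k of
     Rightward \<Rightarrow>
       (\<exists>r c. southwesternmost (O_part \<gamma> W v) (r, c) \<and> (r, c - 1) \<in> W) \<and>
       (\<exists>r c. northeasternmost (O_part \<gamma> W v) (r, c) \<and> (r, c + 1) \<in> translate v W)
   | Upward \<Rightarrow>
       (\<exists>r c. southwesternmost (O_part \<gamma> W v) (r, c) \<and> (r + 1, c) \<in> W) \<and>
       (\<exists>r c. northeasternmost (O_part \<gamma> W v) (r, c) \<and> (r - 1, c) \<in> translate v W))"

definition wow :: "wow_kind \<Rightarrow> box set \<Rightarrow> box set \<Rightarrow> box \<Rightarrow> bool" where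
  "wow k \<gamma> W v \<longleftrightarrow>
     is_shape \<gamma> \<and> W_at_both_ends \<gamma> W v \<and> is_shape (O_part \<gamma> W v) \<and>
     (\<exists>d. (\<forall>b\<in>W. d < diag b) \<and> (\<forall>b\<in>translate v W. diag b < d)) \<and>
     wow_attached k \<gamma> W v \<and>
     (\<forall>W' v'. W_at_both_ends \<gamma> W' v' \<and> W \<subseteq> W' \<and> diag ` W' = diag ` W \<longrightarrow> W' = W)"

section \<open>Composition\<close>

text \<open>
  In \<open>\<gamma>\<^sub>1 \<amalg>\<^sub>W \<gamma>\<^sub>2\<close> the second copy is the first one shifted by \<open>amalg_shift v\<close>, in
  \<open>\<gamma>\<^sub>1 \<cdot>\<^sub>W \<gamma>\<^sub>2\<close> it is the first one shifted by \<open>dot_shift k v\<close>.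
\<close>

definition amalg_shift :: "box \<Rightarrow> box" where
  "amalg_shift v = v"

definition dot_shift :: "wow_kind \<Rightarrow> box \<Rightarrow> box" where
  "dot_shift k v = (case k of Rightward \<Rightarrow> v + (-1, -1) | Upward \<Rightarrow> v + (1, 1))"

definition amalg :: "box set \<Rightarrow> box \<Rightarrow> box set" where
  "amalg \<gamma> v = \<gamma> \<union> translate (amalg_shift v) \<gamma>"

definition east_shift :: "wow_kind \<Rightarrow> box \<Rightarrow> box" where
  "east_shift k v = (case k of Rightward \<Rightarrow> amalg_shift v | Upward \<Rightarrow> dot_shift k v)"

definition north_shift :: "wow_kind \<Rightarrow> box \<Rightarrow> box" where
  "north_shift k v = (case k of Rightward \<Rightarrow> dot_shift k v | Upward \<Rightarrow> amalg_shift v)"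

text \<open>
  \<open>A\<close> is \<open>\<alpha> \<circ> \<gamma>\<close> (at some position in the plane): \<open>p b\<close> is the displacement of the copy of \<open>\<gamma>\<close>
  belonging to the box \<open>b\<close> of \<open>\<alpha>\<close>.  For connected \<open>\<alpha>\<close> this determines \<open>A\<close> up to translation.
\<close>

definition is_composition ::
    "wow_kind \<Rightarrow> box set \<Rightarrow> box set \<Rightarrow> box \<Rightarrow> box set \<Rightarrow> bool" where
  "is_composition k \<alpha> \<gamma> v A \<longleftrightarrow> (\<exists>p :: box \<Rightarrow> box.
     (\<forall>r c. (r, c) \<in> \<alpha> \<and> (r, c + 1) \<in> \<alpha> \<longrightarrow> p (r, c + 1) = p (r, c) + east_shift k v) \<and>
     (\<forall>r c. (r + 1, c) \<in> \<alpha> \<and> (r, c) \<in> \<alpha> \<longrightarrow> p (r, c) = p (r + 1, c) + north_shift k v) \<and>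
     A = (\<Union>b\<in>\<alpha>. translate (p b) \<gamma>))"

text \<open>The east and north conditions around a two-by-two square are always compatible.\<close>

lemma composition_exists: "\<exists>A. is_composition k \<alpha> \<gamma> v A"
proof -
  define p :: "box \<Rightarrow> box" where
    "p = (\<lambda>(r, c). (- r * fst (north_shift k v) + c * fst (east_shift k v),
                    - r * snd (north_shift k v) + c * snd (east_shift k v)))"
  have "p (r, c + 1) = p (r, c) + east_shift k v" for r c
    by (simp add: p_def prod_eq_iff algebra_simps)
  moreover have "p (r, c) = p (r + 1, c) + north_shift k v" for r c
    by (simp add: p_def prod_eq_iff algebra_simps)
  ultimately show ?thesis
    unfolding is_composition_def by blast
qed

section \<open>Key ribbons\<close>

definition upper_left_ribbon :: "box set \<Rightarrow> box set" where
  "upper_left_ribbon S = {b \<in> S. b + (-1, -1) \<notin> S}"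

definition bottom_right_ribbon :: "box set \<Rightarrow> box set" where
  "bottom_right_ribbon S = {b \<in> S. b + (1, 1) \<notin> S}"

text \<open>
  \<open>from_after_first_O R \<dots>\<close>: from the first box of \<open>R\<close> after the \<open>O\<close> of the first \<open>\<gamma>\<close> up to and
  including the last box of the \<open>O\<close> of the second \<open>\<gamma>\<close>.
  \<open>from_first_O R \<dots>\<close>: from the first box of the \<open>O\<close> of the first \<open>\<gamma>\<close> up to and including the last
  box before \<open>R\<close> enters the \<open>O\<close> of the second \<open>\<gamma>\<close>.
\<close>

definition from_after_first_O :: "box set \<Rightarrow> box set \<Rightarrow> box set \<Rightarrow> box \<Rightarrow> box set" where
  "from_after_first_O R \<gamma> W v = {u \<in> R.
     (\<forall>x \<in> R \<inter> O_part \<gamma> W v. precedes x u) \<and>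
     (\<exists>x \<in> R \<inter> translate (amalg_shift v) (O_part \<gamma> W v). u = x \<or> precedes u x)}"

definition from_first_O :: "box set \<Rightarrow> box set \<Rightarrow> box set \<Rightarrow> box \<Rightarrow> box set" where
  "from_first_O R \<gamma> W v = {u \<in> R.
     (\<exists>x \<in> R \<inter> O_part \<gamma> W v. x = u \<or> precedes x u) \<and>
     (\<forall>x \<in> R \<inter> translate (amalg_shift v) (O_part \<gamma> W v). precedes u x)}"

definition top_key_ribbon :: "wow_kind \<Rightarrow> box set \<Rightarrow> box set \<Rightarrow> box \<Rightarrow> box set" where
  "top_key_ribbon k \<gamma> W v = (case k of
     Rightward \<Rightarrow> from_after_first_O (upper_left_ribbon (amalg \<gamma> v)) \<gamma> W v
   | Upward \<Rightarrow> from_first_O (upper_left_ribbon (amalg \<gamma> v)) \<gamma> W v)"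

definition bottom_key_ribbon :: "wow_kind \<Rightarrow> box set \<Rightarrow> box set \<Rightarrow> box \<Rightarrow> box set" where
  "bottom_key_ribbon k \<gamma> W v = (case k of
     Rightward \<Rightarrow> from_first_O (bottom_right_ribbon (amalg \<gamma> v)) \<gamma> W v
   | Upward \<Rightarrow> from_after_first_O (bottom_right_ribbon (amalg \<gamma> v)) \<gamma> W v)"

definition key_ribbon_size :: "wow_kind \<Rightarrow> box set \<Rightarrow> box set \<Rightarrow> box \<Rightarrow> nat" where
  "key_ribbon_size k \<gamma> W v = card (top_key_ribbon k \<gamma> W v)"

section \<open>Taking out and loose end ribbons\<close>

definition taken_out_left :: "box set \<Rightarrow> box set \<Rightarrow> bool" where
  "taken_out_left S \<rho> \<longleftrightarrow> (\<exists>\<kappa> \<eta> \<nu> t. is_partition \<kappa> \<and> is_partition \<eta> \<and> is_partition \<nu> \<and> \<nu> \<le> \<eta> \<and> \<eta> \<le> \<kappa> \<and>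
     S = translate t (skew_diagram \<kappa> \<nu>) \<and> \<rho> = translate t (skew_diagram \<eta> \<nu>))"

definition taken_out_right :: "box set \<Rightarrow> box set \<Rightarrow> bool" where
  "taken_out_right S \<rho> \<longleftrightarrow> (\<exists>\<kappa> \<eta> \<nu> t. is_partition \<kappa> \<and> is_partition \<eta> \<and> is_partition \<nu> \<and> \<nu> \<le> \<eta> \<and> \<eta> \<le> \<kappa> \<and>
     S = translate t (skew_diagram \<kappa> \<nu>) \<and> \<rho> = translate t (skew_diagram \<kappa> \<eta>))"

definition begins_left_of :: "box set \<Rightarrow> box set \<Rightarrow> bool" where
  "begins_left_of \<rho> K \<longleftrightarrow> (\<exists>x\<in>\<rho>. \<forall>y\<in>K. precedes x y)"

definition ends_right_of :: "box set \<Rightarrow> box set \<Rightarrow> bool" where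
  "ends_right_of \<rho> K \<longleftrightarrow> (\<exists>x\<in>\<rho>. \<forall>y\<in>K. precedes y x)"

text \<open>
  The ribbons are taken out of \<open>\<gamma>\<close>, placed as the copy inside \<open>\<gamma> \<amalg>\<^sub>W \<gamma>\<close> that contains the key ribbon
  in question: the key ribbons built by \<open>from_after_first_O\<close> lie in the second copy, those built by
  \<open>from_first_O\<close> in the first copy.
\<close>

definition no_loose_end_ribbons :: "wow_kind \<Rightarrow> box set \<Rightarrow> box set \<Rightarrow> box \<Rightarrow> bool" where
  "no_loose_end_ribbons k \<gamma> W v \<longleftrightarrow>
     (let n = key_ribbon_size k \<gamma> W v; T = top_key_ribbon k \<gamma> W v; B = bottom_key_ribbon k \<gamma> W v;
          second = translate (amalg_shift v) \<gamma>
      in case k of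
        Rightward \<Rightarrow>
          \<not> (\<exists>\<rho>. is_ribbon \<rho> \<and> card \<rho> = n \<and> begins_left_of \<rho> T \<and> taken_out_left second \<rho>) \<and>
          \<not> (\<exists>\<rho>. is_ribbon \<rho> \<and> card \<rho> = n \<and> ends_right_of \<rho> B \<and> taken_out_right \<gamma> \<rho>)
      | Upward \<Rightarrow>
          \<not> (\<exists>\<rho>. is_ribbon \<rho> \<and> card \<rho> = n \<and> ends_right_of \<rho> T \<and> taken_out_left \<gamma> \<rho>) \<and>
          \<not> (\<exists>\<rho>. is_ribbon \<rho> \<and> card \<rho> = n \<and> begins_left_of \<rho> B \<and> taken_out_right second \<rho>))"

section \<open>Rectangles with the lower right corner removed\<close>

definition rectangle_minus_corner :: "nat \<Rightarrow> nat \<Rightarrow> box set" where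
  "rectangle_minus_corner a b = {0..<int a} \<times> {0..<int b} - {(int a - 1, int b - 1)}"

lemma rectangle_minus_corner_eq_diagram:
  assumes "0 < b"
  shows "rectangle_minus_corner a b =
    skew_diagram (\<lambda>i. if i + 1 < a then b else if i + 1 = a then b - 1 else 0) (\<lambda>_. 0)"
    (is "?L = ?R")
proof (rule set_eqI)
  fix x :: box
  obtain r c where x: "x = (r, c)" by (cases x)
  show "x \<in> ?L \<longleftrightarrow> x \<in> ?R"
  proof (cases "0 \<le> r \<and> 0 \<le> c")
    case True
    then obtain i j where "r = int i" "c = int j" by (metis nonneg_int_cases)
    moreover have "(int i, int j) \<in> ?R \<longleftrightarrow>
        j < (if i + 1 < a then b else if i + 1 = a then b - 1 else 0)"
      by (simp add: skew_diagram_def)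
    moreover have "(int i, int j) \<in> ?L \<longleftrightarrow> i < a \<and> j < b \<and> \<not> (i + 1 = a \<and> j + 1 = b)"
      unfolding rectangle_minus_corner_def mem_Times_iff Diff_iff by simp arith
    moreover have "(i < a \<and> j < b \<and> \<not> (i + 1 = a \<and> j + 1 = b)) \<longleftrightarrow>
        j < (if i + 1 < a then b else if i + 1 = a then b - 1 else 0)"
      using assms by presburger
    ultimately show ?thesis using x by simp
  next
    case False
    then show ?thesis
      unfolding x rectangle_minus_corner_def skew_diagram_def by simp arith
  qed
qed

end

theory Submission
  imports Defs "Jordan_Normal_Form.Determinant"
begin

text \<open>
  The adjoint of multiplication by the power sum \<open>p\<^sub>n\<close> acts on a skew Schur function by removing
  ribbons of length \<open>n\<close>, with signs, and one may remove them at the lower right or at the upper left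
  end of the shape.  If a shape has exactly one removable ribbon of length \<open>n\<close> at either end, the two
  shapes that remain therefore have, up to sign, and hence exactly, the same skew Schur function.

  Let \<open>\<gamma>\<close> be a \<open>W \<rightarrow> O \<rightarrow> W\<close> shape and \<open>R\<close> the full rectangle.  The upper left boundary of \<open>R \<circ> \<gamma>\<close> is periodic along the first
  column and along the first row of copies of \<open>\<gamma>\<close>; the period is the key ribbon size \<open>n\<close>, and one step
  per period changes from up to right at the corner.  A removable ribbon corresponds to an upward step
  that is followed, \<open>n\<close> steps later, by a step to the right, so inside the periodic part there is
  only the top key ribbon at the corner, whose removal leaves \<open>\<beta>\<^sup>* \<circ> \<gamma>\<close>.  A removable ribbon at an end
  of the boundary would be a loose end ribbon of \<open>\<gamma>\<close>.  Rotation by 180 degrees gives the same for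
  the lower right boundary and \<open>\<beta> \<circ> \<gamma>\<close>, and transposition exchanges the two kinds of \<open>\<gamma>\<close>.

  Removing ribbons on the left and on the right agree because this can be checked for the removal of
  one letter: \<open>\<kappa> / \<mu>\<close> is a horizontal strip iff the 0/1 matrix \<open>[\<mu>\<^sub>j - j \<le> \<kappa>\<^sub>i - i]\<close> has determinant 1
  (otherwise the determinant is 0), ribbon removal subtracts \<open>n\<close> in one row, respectively adds \<open>n\<close> in one
  column parameter, and both sums of determinants have the same expansion.
\<close>

section \<open>Determinants of step matrices\<close>

text \<open>Written as a function from contents to rows, a boundary path is determined by the
  positions of its upward steps. Taking out a ribbon of length \<open>n\<close> changes only two
  steps, that is, it moves one such position by \<open>n\<close>; this is what turns ribbons into
  changes of a single row or column parameter of a step determinant. Far out the two boundary paths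
  of a shape may be made to coincide, so both position sets have the same finite size and the
  matrices are square.

  When one ribbon is removable at either end, both sides of the identity are a sign times a count.
  Counts are nonnegative, so the heights of the two ribbons need not be compared.

  The obstacle for the second kind of \<gamma> is that transposition does not preserve skew Schur
  functions. What is transposed is therefore not the conclusion but the geometric fact behind it:
  one common shape with unique removable ribbons (\<open>exchangeable\<close>). Rotation, too, is
  applied only to geometry.

  The corner argument looks at the copies to the east, south and southeast of the corner copy, so it
  needs two rows and two columns of copies; a single row or column is settled by a
  translation.\<close>

definition step_mat :: "int list \<Rightarrow> int list \<Rightarrow> int mat" where
  "step_mat ls ms = mat (length ls) (length ls) (\<lambda>(i, j). of_bool (ms ! j \<le> ls ! i))"

lemma step_mat_carrier [simp]:
  "step_mat ls ms \<in> carrier_mat (length ls) (length ls)"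
  by (simp add: step_mat_def)

lemma step_mat_dim [simp]: "dim_row (step_mat ls ms) = length ls" "dim_col (step_mat ls ms) = length ls"
  by (simp_all add: step_mat_def)

lemma step_mat_index [simp]:
  "i < length ls \<Longrightarrow> j < length ls \<Longrightarrow> step_mat ls ms $$ (i, j) = of_bool (ms ! j \<le> ls ! i)"
  by (simp add: step_mat_def)

lemma det_step_mat_swap_row:
  "det (step_mat (xs @ a # b # ys) ms) = - det (step_mat (xs @ b # a # ys) ms)"
proof -
  have "step_mat (xs @ a # b # ys) ms =
      swaprows (length xs) (Suc (length xs)) (step_mat (xs @ b # a # ys) ms)"
    by (rule eq_matI) (auto simp: nth_append nth_Cons split: nat.splits)
  then show ?thesis
    by (simp add: det_swaprows[OF _ _ _ step_mat_carrier])
qed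

lemma det_step_mat_swap_col:
  assumes "length ls = length (xs @ a # b # ys)"
  shows "det (step_mat ls (xs @ a # b # ys)) = - det (step_mat ls (xs @ b # a # ys))"
proof -
  have "step_mat ls (xs @ a # b # ys) =
      swapcols (length xs) (Suc (length xs)) (step_mat ls (xs @ b # a # ys))"
    using assms by (intro eq_matI) (auto simp: nth_append nth_Cons split: nat.splits)
  then show ?thesis
    using assms by (simp add: det_swapcols[OF _ _ _ step_mat_carrier])
qed

lemma det_step_mat_move_row:
  "det (step_mat (xs @ a # ws @ ys) ms) = (-1) ^ length ws * det (step_mat (xs @ ws @ a # ys) ms)"
proof (induction ws arbitrary: xs)
  case (Cons w ws)
  show ?case
    using det_step_mat_swap_row[of xs a w "ws @ ys" ms] Cons.IH[of "xs @ [w]"] by simp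
qed simp

lemma det_step_mat_move_col:
  assumes "length ls = length (xs @ a # ws @ ys)"
  shows "det (step_mat ls (xs @ a # ws @ ys)) = (-1) ^ length ws * det (step_mat ls (xs @ ws @ a # ys))"
  using assms
proof (induction ws arbitrary: xs)
  case (Cons w ws)
  then show ?case
    using det_step_mat_swap_col[of ls xs a w "ws @ ys"] Cons.IH[of "xs @ [w]"] by simp
qed simp

lemma det_step_mat_repeated_row:
  assumes "i < length ls" "j < length ls" "i \<noteq> j" "ls ! i = ls ! j"
  shows "det (step_mat ls ms) = 0"
  by (rule det_identical_rows[OF step_mat_carrier assms(3,1,2)])
    (use assms in \<open>auto intro!: eq_vecI\<close>)

lemma det_step_mat_repeated_col:
  assumes "i < length ls" "j < length ls" "i \<noteq> j" "ms ! i = ms ! j"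
  shows "det (step_mat ls ms) = 0"
  by (rule det_identical_columns[OF step_mat_carrier assms(3,1,2)])
    (use assms in \<open>auto intro!: eq_vecI\<close>)

text \<open>Both sides equal the sum over \<open>i, j\<close> of the entry \<open>of_bool (ms ! j \<le> ls ! i - d)\<close> times the
  \<open>(i, j)\<close> cofactor of \<open>step_mat ls ms\<close>.\<close>

lemma sum_det_step_mat_shift:
  assumes len: "length ms = length ls"
  shows "(\<Sum>i<length ls. det (step_mat (ls[i := ls ! i - d]) ms)) =
         (\<Sum>j<length ls. det (step_mat ls (ms[j := ms ! j + d])))"
proof -
  let ?N = "length ls"
  let ?P = "{p. p permutes {0..<?N}}"
  let ?e = "\<lambda>l m. of_bool (m \<le> l) :: int"
  have row: "det (step_mat (ls[i := ls ! i - d]) ms) =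
      (\<Sum>p\<in>?P. signof p * (\<Prod>k = 0..<?N. ?e (if k = i then ls ! k - d else ls ! k) (ms ! p k)))"
    if "i < ?N" for i
    by (subst det_def'[where n = ?N])
      (auto intro!: sum.cong prod.cong simp: step_mat_def nth_list_update permutes_in_image[of _ "{0..<length ls}", simplified])
  have col: "det (step_mat ls (ms[j := ms ! j + d])) =
      (\<Sum>p\<in>?P. signof p * (\<Prod>k = 0..<?N. ?e (ls ! k) (if p k = j then ms ! p k + d else ms ! p k)))"
    if "j < ?N" for j
    using len by (subst det_def'[where n = ?N])
      (auto intro!: sum.cong prod.cong simp: step_mat_def nth_list_update permutes_in_image[of _ "{0..<length ls}", simplified])
  \<comment> \<open>For a fixed permutation \<open>p\<close>, lowering row \<open>i\<close> and
    raising column \<open>p i\<close> alter the same factor of the Leibniz product in the same way,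
    since \<open>m \<le> l - d\<close> iff \<open>m + d \<le> l\<close>.\<close>
  have eq: "(\<Sum>i<?N. \<Prod>k = 0..<?N. ?e (if k = i then ls ! k - d else ls ! k) (ms ! p k)) =
      (\<Sum>j<?N. \<Prod>k = 0..<?N. ?e (ls ! k) (if p k = j then ms ! p k + d else ms ! p k))"
    if p: "p \<in> ?P" for p
  proof -
    have bij: "bij_betw p {..<?N} {..<?N}"
      using p permutes_imp_bij[of p "{0..<?N}"] by (simp add: atLeast0LessThan)
    have inj: "inj p" using p permutes_inj by blast
    show ?thesis
      by (subst sum.reindex_bij_betw[OF bij, symmetric])
        (auto intro!: sum.cong prod.cong simp: inj_eq[OF inj] algebra_simps)
  qed
  have "(\<Sum>p\<in>?P. \<Sum>i<?N. signof p * (\<Prod>k = 0..<?N. ?e (if k = i then ls ! k - d else ls ! k) (ms ! p k))) =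
      (\<Sum>p\<in>?P. \<Sum>j<?N. signof p * (\<Prod>k = 0..<?N. ?e (ls ! k) (if p k = j then ms ! p k + d else ms ! p k)))"
    unfolding sum_distrib_left[symmetric]
    by (rule sum.cong[OF refl]) (simp only: eq)
  then show ?thesis
    by (simp add: row col sum.swap[of _ _ ?P])
qed

definition count_ge :: "int list \<Rightarrow> int \<Rightarrow> nat" where
  "count_ge ls x = length (filter (\<lambda>y. x \<le> y) ls)"

text \<open>For strictly decreasing lists of equal length this is the chain
  \<open>ls ! 0 \<ge> ms ! 0 > ls ! 1 \<ge> ms ! 1 > ...\<close>. Counting above a threshold
  expresses it without indices, so that it carries over to sets and to heights of paths.\<close>

definition interlaced :: "int list \<Rightarrow> int list \<Rightarrow> bool" where
  "interlaced ls ms \<longleftrightarrow>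
    (\<forall>x. count_ge ms x \<le> count_ge ls x \<and> count_ge ls x \<le> count_ge ms (x + 1) + 1)"

lemma count_ge_Cons: "count_ge (l # ls) x = of_bool (x \<le> l) + count_ge ls x"
  by (simp add: count_ge_def)

lemma count_ge_eq_0: "(\<And>y. y \<in> set ls \<Longrightarrow> y < x) \<Longrightarrow> count_ge ls x = 0"
  by (force simp: count_ge_def filter_empty_conv)

text \<open>Below the first row column 0 is zero, so the Laplace expansion along it has one
  term.\<close>

lemma det_step_mat_Cons:
  assumes "m \<le> l" "\<And>y. y \<in> set ls \<Longrightarrow> y < m" "length ms = length ls"
  shows "det (step_mat (l # ls) (m # ms)) = det (step_mat ls ms)"
proof -
  let ?A = "step_mat (l # ls) (m # ms)"
  have del: "mat_delete ?A 0 0 = step_mat ls ms"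
    by (rule eq_matI) (auto simp: mat_delete_def)
  have "det ?A = (\<Sum>i<Suc (length ls). ?A $$ (i, 0) * cofactor ?A i 0)"
    by (rule laplace_expansion_column) (auto simp: step_mat_def)
  also have "\<dots> = (\<Sum>i\<in>{0}. ?A $$ (i, 0) * cofactor ?A i 0)"
  proof (rule sum.mono_neutral_right)
    show "\<forall>i\<in>{..<Suc (length ls)} - {0}. ?A $$ (i, 0) * cofactor ?A i 0 = 0"
    proof
      fix i assume "i \<in> {..<Suc (length ls)} - {0}"
      then obtain i' where "i = Suc i'" "i' < length ls" by (cases i) auto
      then show "?A $$ (i, 0) * cofactor ?A i 0 = 0"
        using assms(2)[of "ls ! i'"] by simp
    qed
  qed auto
  also have "\<dots> = det (step_mat ls ms)"
    using assms(1) by (simp add: cofactor_def del)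
  finally show ?thesis .
qed

text \<open>The largest entry \<open>m\<close> of \<open>ms\<close> is compared with the two largest
  entries of \<open>ls\<close>. If both are smaller, column 0 vanishes; if both reach
  \<open>m\<close>, the first two rows consist of ones; in these cases interlacing fails at the
  threshold \<open>m\<close>. Otherwise the first row and column split off.\<close>

lemma det_step_mat_interlaced:
  assumes "length ms = length ls" "sorted_wrt (>) ls" "sorted_wrt (>) ms"
  shows "det (step_mat ls ms) = of_bool (interlaced ls ms)"
  using assms
proof (induction ls ms rule: list_induct2')
  case 1
  then show ?case by (simp add: interlaced_def count_ge_def det_dim_zero[OF step_mat_carrier[of "[]" "[]", simplified]])
next
  case (4 l ls m ms)
  have lsl: "\<And>y. y \<in> set ls \<Longrightarrow> y < l" and msm: "\<And>y. y \<in> set ms \<Longrightarrow> y < m"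
    using 4 by auto
  have ms0: "count_ge ms x = 0" if "m \<le> x" for x
    using that msm by (intro count_ge_eq_0) force
  have ls0: "count_ge ls x = 0" if "l \<le> x" for x
    using that lsl by (intro count_ge_eq_0) force
  consider "l < m" | "m \<le> l" "\<And>y. y \<in> set ls \<Longrightarrow> y < m" | y where "m \<le> l" "y \<in> set ls" "m \<le> y"
    by fastforce
  then show ?case
  proof cases
    case 1
    have "col (step_mat (l # ls) (m # ms)) 0 = 0\<^sub>v (length (l # ls))"
    proof (rule eq_vecI)
      fix i assume "i < dim_vec (0\<^sub>v (length (l # ls)) :: int vec)"
      then have i: "i < length (l # ls)" by simp
      then have "(l # ls) ! i \<le> l" using lsl nth_mem[OF i] by (auto intro: less_imp_le)
      then show "col (step_mat (l # ls) (m # ms)) 0 $ i = 0\<^sub>v (length (l # ls)) $ i"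
        using 1 i by simp
    qed simp
    then have z: "\<And>i. i < Suc (length ls) \<Longrightarrow> step_mat (l # ls) (m # ms) $$ (i, 0) = 0"
      by (metis index_col index_zero_vec(1) step_mat_dim length_Cons zero_less_Suc)
    have "det (step_mat (l # ls) (m # ms)) =
        (\<Sum>i<Suc (length ls). step_mat (l # ls) (m # ms) $$ (i, 0) * cofactor (step_mat (l # ls) (m # ms)) i 0)"
      by (rule laplace_expansion_column) (auto simp: step_mat_def)
    then have "det (step_mat (l # ls) (m # ms)) = 0"
      by (simp add: z del: step_mat_index)
    moreover have "\<not> interlaced (l # ls) (m # ms)"
      unfolding interlaced_def not_all
      by (rule exI[of _ m]) (use 1 ls0 in \<open>simp add: count_ge_Cons\<close>)
    ultimately show ?thesis by simp
  next
    case 2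
    have lsm: "count_ge ls x = 0" if "m \<le> x" for x
      using that 2 by (intro count_ge_eq_0) force
    have "interlaced (l # ls) (m # ms) \<longleftrightarrow> interlaced ls ms"
      unfolding interlaced_def
    proof (rule iff_allI)
      fix x show "(count_ge (m # ms) x \<le> count_ge (l # ls) x \<and> count_ge (l # ls) x \<le> count_ge (m # ms) (x + 1) + 1)
        = (count_ge ms x \<le> count_ge ls x \<and> count_ge ls x \<le> count_ge ms (x + 1) + 1)"
        using 2(1) ms0[of x] ms0[of "x + 1"] lsm[of x] by (cases "m \<le> x") (auto simp: count_ge_Cons)
    qed
    then show ?thesis
      using 4 2 det_step_mat_Cons[of m l ls ms] by simp
  next
    case 3
    then obtain l' ls' where ls: "ls = l' # ls'" by (cases ls) auto
    have l': "m \<le> l'" using 3 4 ls by auto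
    have "det (step_mat (l # ls) (m # ms)) = 0"
    proof (rule det_identical_rows[where i = 0 and j = 1, OF step_mat_carrier])
      have "(m # ms) ! j \<le> m" if "j < Suc (length ms)" for j
        using msm nth_mem[of j "m # ms"] that by (auto intro: less_imp_le)
      then show "row (step_mat (l # ls) (m # ms)) 0 = row (step_mat (l # ls) (m # ms)) 1"
        using 3(1) l' 4(2) by (intro eq_vecI) (fastforce simp: ls intro: order_trans)+
    qed (auto simp: ls)
    moreover have "\<not> interlaced (l # ls) (m # ms)"
      unfolding interlaced_def not_all
      by (rule exI[of _ m]) (use 3 l' ms0 in \<open>simp add: count_ge_Cons ls\<close>)
    ultimately show ?thesis by simp
  qed
qed auto

section \<open>Boxes, shapes and lattice paths\<close>

text \<open>The negative of \<open>diag\<close>, so that it increases along a ribbon from southwest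
  to northeast.\<close>

definition box_content :: "box \<Rightarrow> int" where
  "box_content b = snd b - fst b"

definition box_le :: "box \<Rightarrow> box \<Rightarrow> bool" where
  "box_le x y \<longleftrightarrow> fst x \<le> fst y \<and> snd x \<le> snd y"

text \<open>For finite sets this is the same as being a shape (\<open>shape_iff_convex\<close>). It
  replaces the pair of partitions wherever the position in the plane matters.\<close>

definition convex_boxes :: "box set \<Rightarrow> bool" where
  "convex_boxes S \<longleftrightarrow> (\<forall>x\<in>S. \<forall>y\<in>S. \<forall>z. box_le x z \<longrightarrow> box_le z y \<longrightarrow> z \<in> S)"

text \<open>Order ideals of \<open>S\<close>, which can be taken out on the left; the order filters
  of \<open>upper_in\<close> can be taken out on the right.\<close>

definition lower_in :: "box set \<Rightarrow> box set \<Rightarrow> bool" where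
  "lower_in S \<rho> \<longleftrightarrow> \<rho> \<subseteq> S \<and> (\<forall>x\<in>\<rho>. \<forall>y\<in>S. box_le y x \<longrightarrow> y \<in> \<rho>)"

definition upper_in :: "box set \<Rightarrow> box set \<Rightarrow> bool" where
  "upper_in S \<rho> \<longleftrightarrow> \<rho> \<subseteq> S \<and> (\<forall>x\<in>\<rho>. \<forall>y\<in>S. box_le x y \<longrightarrow> y \<in> \<rho>)"

lemma box_le_trans: "box_le x y \<Longrightarrow> box_le y z \<Longrightarrow> box_le x z"
  by (simp add: box_le_def)

lemma convex_boxesD: "convex_boxes S \<Longrightarrow> x \<in> S \<Longrightarrow> y \<in> S \<Longrightarrow> box_le x z \<Longrightarrow> box_le z y \<Longrightarrow> z \<in> S"
  unfolding convex_boxes_def by blast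

lemma lower_in_subset: "lower_in S \<rho> \<Longrightarrow> \<rho> \<subseteq> S" by (simp add: lower_in_def)
lemma upper_in_subset: "upper_in S \<rho> \<Longrightarrow> \<rho> \<subseteq> S" by (simp add: upper_in_def)
lemma lower_inD: "lower_in S \<rho> \<Longrightarrow> x \<in> \<rho> \<Longrightarrow> y \<in> S \<Longrightarrow> box_le y x \<Longrightarrow> y \<in> \<rho>"
  unfolding lower_in_def by blast
lemma upper_inD: "upper_in S \<rho> \<Longrightarrow> x \<in> \<rho> \<Longrightarrow> y \<in> S \<Longrightarrow> box_le x y \<Longrightarrow> y \<in> \<rho>"
  unfolding upper_in_def by blast

lemma lower_in_iff_upper_in: "\<rho> \<subseteq> S \<Longrightarrow> lower_in S \<rho> \<longleftrightarrow> upper_in S (S - \<rho>)"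
  unfolding lower_in_def upper_in_def by blast

lemma convex_boxesI:
  "(\<And>x y z. x \<in> S \<Longrightarrow> y \<in> S \<Longrightarrow> box_le x z \<Longrightarrow> box_le z y \<Longrightarrow> z \<in> S) \<Longrightarrow> convex_boxes S"
  unfolding convex_boxes_def by blast

lemma convex_lower_in:
  assumes "convex_boxes S" "lower_in S \<rho>"
  shows "convex_boxes \<rho>" and "convex_boxes (S - \<rho>)"
proof -
  show "convex_boxes \<rho>"
  proof (rule convex_boxesI)
    fix x y z assume "x \<in> \<rho>" "y \<in> \<rho>" "box_le x z" "box_le z y"
    then show "z \<in> \<rho>"
      using lower_inD[OF assms(2), of y z] convex_boxesD[OF assms(1), of x y z] lower_in_subset[OF assms(2)] by auto
  qed
  show "convex_boxes (S - \<rho>)"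
  proof (rule convex_boxesI)
    fix x y z assume "x \<in> S - \<rho>" "y \<in> S - \<rho>" "box_le x z" "box_le z y"
    then show "z \<in> S - \<rho>"
      using lower_inD[OF assms(2), of z x] convex_boxesD[OF assms(1), of x y z] by auto
  qed
qed

lemma convex_upper_in:
  assumes "convex_boxes S" "upper_in S \<rho>"
  shows "convex_boxes \<rho>" and "convex_boxes (S - \<rho>)"
proof -
  show "convex_boxes \<rho>"
  proof (rule convex_boxesI)
    fix x y z assume "x \<in> \<rho>" "y \<in> \<rho>" "box_le x z" "box_le z y"
    then show "z \<in> \<rho>"
      using upper_inD[OF assms(2), of x z] convex_boxesD[OF assms(1), of x y z] upper_in_subset[OF assms(2)] by auto
  qed
  show "convex_boxes (S - \<rho>)"
  proof (rule convex_boxesI)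
    fix x y z assume "x \<in> S - \<rho>" "y \<in> S - \<rho>" "box_le x z" "box_le z y"
    then show "z \<in> S - \<rho>"
      using upper_inD[OF assms(2), of z y] convex_boxesD[OF assms(1), of x y z] by auto
  qed
qed

lemma mem_translate: "b \<in> translate t S \<longleftrightarrow> b - t \<in> S"
proof
  assume "b - t \<in> S"
  then have "b - t + t \<in> translate t S" unfolding translate_def by blast
  then show "b \<in> translate t S" by simp
qed (auto simp: translate_def)

section \<open>Partitions from order filters of a convex set\<close>

lemma down_closed_nat:
  fixes A :: "nat set"
  assumes "finite A" "\<And>i j. i \<in> A \<Longrightarrow> j \<le> i \<Longrightarrow> j \<in> A"
  shows "i \<in> A \<longleftrightarrow> i < card A"
proof (cases "A = {}")
  case False
  define m where "m = Max A"
  have A: "A = {..m}"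
    unfolding m_def using assms(1) Max_in[OF assms(1) False] assms(2) by (auto intro: Max_ge)
  show ?thesis unfolding A by auto
qed simp

definition row_length :: "(nat \<times> nat) set \<Rightarrow> nat \<Rightarrow> nat" where
  "row_length E i = card {j. (i, j) \<in> E}"

lemma
  assumes fin: "finite E" and down: "\<And>i j i' j'. (i, j) \<in> E \<Longrightarrow> i' \<le> i \<Longrightarrow> j' \<le> j \<Longrightarrow> (i', j') \<in> E"
  shows mem_iff_less_row_length: "(i, j) \<in> E \<longleftrightarrow> j < row_length E i"
    and is_partition_row_length: "is_partition (row_length E)"
proof -
  have finr: "finite {j. (i, j) \<in> E}" for i
    by (rule finite_subset[of _ "snd ` E"]) (auto intro: rev_image_eqI fin)
  have anti: "{j. (i', j) \<in> E} \<subseteq> {j. (i, j) \<in> E}" if "i \<le> i'" for i i'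
    using down[OF _ that order_refl] by blast
  show "(i, j) \<in> E \<longleftrightarrow> j < row_length E i"
    unfolding row_length_def
    using down_closed_nat[OF finr[of i], of j] down[OF _ order_refl[of i]] by simp
  have "antimono (row_length E)"
    unfolding row_length_def by (intro antimonoI card_mono finr anti)
  moreover have "{i. row_length E i \<noteq> 0} \<subseteq> fst ` E"
  proof
    fix i assume "i \<in> {i. row_length E i \<noteq> 0}"
    then have "{j. (i, j) \<in> E} \<noteq> {}" unfolding row_length_def by (auto simp del: Collect_empty_eq)
    then obtain j where "(i, j) \<in> E" by blast
    then show "i \<in> fst ` E" by (rule rev_image_eqI) simp
  qed
  then have "finite {i. row_length E i \<noteq> 0}"
    using finite_imageI[OF fin] by (rule finite_subset)
  ultimately show "is_partition (row_length E)" by (simp add: is_partition_def)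
qed

lemma row_length_mono: "finite E \<Longrightarrow> D \<subseteq> E \<Longrightarrow> row_length D \<le> row_length E"
  unfolding row_length_def le_fun_def
proof
  fix i assume "finite E" "D \<subseteq> E"
  have "finite {j. (i, j) \<in> E}"
    by (rule finite_subset[of _ "snd ` E"]) (auto intro: rev_image_eqI \<open>finite E\<close>)
  then show "card {j. (i, j) \<in> D} \<le> card {j. (i, j) \<in> E}"
    using \<open>D \<subseteq> E\<close> by (intro card_mono) auto
qed

text \<open>One translation and one assignment \<kappa> serve all upper sets at once, because taking
  out compares three partitions in a common position. \<open>S\<close> is placed in the quadrant
  with corner \<open>(r, c)\<close>, \<open>D\<close> is its closure towards that corner, and the
  partition of \<open>U\<close> has the diagram \<open>D\<close> without \<open>U\<close>.\<close>

lemma upper_sets_as_partitions: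
  assumes fin: "finite S" and conv: "convex_boxes S"
  obtains t \<kappa> where
    "\<And>U. upper_in S U \<Longrightarrow> is_partition (\<kappa> U)"
    "\<And>U V. U \<subseteq> V \<Longrightarrow> \<kappa> V \<le> \<kappa> U"
    "\<And>U V. upper_in S U \<Longrightarrow> upper_in S V \<Longrightarrow> U \<subseteq> V \<Longrightarrow> V - U = translate t (skew_diagram (\<kappa> U) (\<kappa> V))"
proof -
  \<comment> \<open>Inserting 0 keeps \<open>Min\<close> meaningful for empty \<open>S\<close>; any
    corner northwest of \<open>S\<close> would do.\<close>
  define r where "r = Min (insert 0 (fst ` S))"
  define c where "c = Min (insert 0 (snd ` S))"
  define pos where "pos = (\<lambda>(i, j). (r + int i, c + int j))"
  define D where "D = {p. \<exists>s\<in>S. box_le (pos p) s}"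
  define E where "E U = {p \<in> D. pos p \<notin> U}" for U
  have rc: "r \<le> fst s" "c \<le> snd s" if "s \<in> S" for s
    unfolding r_def c_def using that fin by (auto intro!: Min_le)
  have pos_onto: "\<exists>p. s = pos p" if "s \<in> S" for s
    using rc[OF that] unfolding pos_def
    by (intro exI[of _ "(nat (fst s - r), nat (snd s - c))"]) (auto simp: prod_eq_iff)
  have "finite D"
  proof (rule finite_subset)
    show "D \<subseteq> (\<Union>s\<in>S. {..nat (fst s - r)} \<times> {..nat (snd s - c)})"
    proof
      fix p assume "p \<in> D"
      then obtain s where "s \<in> S" "box_le (pos p) s" unfolding D_def by blast
      moreover from this have "fst p \<le> nat (fst s - r) \<and> snd p \<le> nat (snd s - c)"
        by (auto simp: pos_def box_le_def split: prod.splits)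
      ultimately show "p \<in> (\<Union>s\<in>S. {..nat (fst s - r)} \<times> {..nat (snd s - c)})"
        by (auto simp: mem_Times_iff)
    qed
  qed (use fin in auto)
  then have finE: "finite (E U)" for U unfolding E_def by simp
  have mono_pos: "box_le (pos (i', j')) (pos (i, j))" if "i' \<le> i" "j' \<le> j" for i i' j j'
    using that by (simp add: pos_def box_le_def)
  have down: "(i', j') \<in> E U" if U: "upper_in S U" and le: "(i, j) \<in> E U" "i' \<le> i" "j' \<le> j" for U i j i' j'
  proof -
    obtain s where s: "s \<in> S" "box_le (pos (i, j)) s" and n: "pos (i, j) \<notin> U"
      using le(1) unfolding E_def D_def by blast
    note le = mono_pos[OF le(2,3)]
    \<comment> \<open>Otherwise \<open>pos (i, j)\<close> lies between two boxes of
      \<open>S\<close>, hence in \<open>S\<close> by convexity, and then in the upper set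
      \<open>U\<close>.\<close>
    have "pos (i', j') \<notin> U"
    proof
      assume "pos (i', j') \<in> U"
      then have "pos (i, j) \<in> S" using conv s le upper_in_subset[OF U] convex_boxesD by blast
      then show False using n upper_inD[OF U \<open>pos (i', j') \<in> U\<close> _ le] by blast
    qed
    then show ?thesis using s le box_le_trans unfolding E_def D_def by blast
  qed
  show ?thesis
  proof (rule that[of "\<lambda>U. row_length (E U)" "(r, c)"])
    show "is_partition (row_length (E U))" if "upper_in S U" for U
      by (rule is_partition_row_length[OF finE]) (use down[OF that] in blast)
    show "row_length (E V) \<le> row_length (E U)" if "U \<subseteq> V" for U V
      by (rule row_length_mono[OF finE]) (use that E_def in blast)
    show "V - U = translate (r, c) (skew_diagram (row_length (E U)) (row_length (E V)))"
      if U: "upper_in S U" and V: "upper_in S V" and UV: "U \<subseteq> V" for U V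
    proof -
      have memU: "j < row_length (E U) i \<longleftrightarrow> (i, j) \<in> E U" for i j
        by (rule mem_iff_less_row_length[OF finE, symmetric]) (use down[OF U] in blast)
      have memV: "row_length (E V) i \<le> j \<longleftrightarrow> (i, j) \<notin> E V" for i j
        using mem_iff_less_row_length[OF finE, of V i j] down[OF V] by (meson not_le)
      have mem: "pos (i, j) \<in> V - U \<longleftrightarrow> (i, j) \<in> E U \<and> (i, j) \<notin> E V" for i j
        using upper_in_subset[OF V] UV unfolding E_def D_def by (auto simp: box_le_def)
      have "b \<in> V - U \<longleftrightarrow> b - (r, c) \<in> skew_diagram (row_length (E U)) (row_length (E V))" for b
      proof -
        have "b - (r, c) = (int i, int j) \<longleftrightarrow> b = pos (i, j)" for i j
          by (auto simp: pos_def prod_eq_iff)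
        then have "b - (r, c) \<in> skew_diagram (row_length (E U)) (row_length (E V)) \<longleftrightarrow>
            (\<exists>i j. b = pos (i, j) \<and> pos (i, j) \<in> V - U)"
          unfolding skew_diagram_def mem_Collect_eq mem memU memV by blast
        then show ?thesis using pos_onto upper_in_subset[OF V] by (metis DiffD1 prod.exhaust subsetD)
      qed
      then show ?thesis by (intro Set.set_eqI) (simp only: mem_translate)
    qed
  qed
qed

lemma upper_in_empty: "upper_in S {}" and upper_in_self: "upper_in S S"
  by (auto simp: upper_in_def)

lemma is_shape_convex: "finite S \<Longrightarrow> convex_boxes S \<Longrightarrow> is_shape S"
proof -
  assume "finite S" "convex_boxes S"
  then obtain t \<kappa> where "\<And>U. upper_in S U \<Longrightarrow> is_partition (\<kappa> U)"
    "\<And>U V. U \<subseteq> V \<Longrightarrow> \<kappa> V \<le> \<kappa> U"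
    "\<And>U V. upper_in S U \<Longrightarrow> upper_in S V \<Longrightarrow> U \<subseteq> V \<Longrightarrow> V - U = translate t (skew_diagram (\<kappa> U) (\<kappa> V))"
    by (rule upper_sets_as_partitions) blast
  note * = this(1)[OF upper_in_empty] this(1)[OF upper_in_self] this(2)[of "{}" S] this(3)[OF upper_in_empty upper_in_self]
  show ?thesis unfolding is_shape_def
    by (rule exI[of _ "\<kappa> {}"], rule exI[of _ "\<kappa> S"], rule exI[of _ t]) (use * in simp)
qed

lemma taken_out_left_lower_in:
  assumes "finite S" "convex_boxes S" "lower_in S \<rho>"
  shows "taken_out_left S \<rho>"
proof -
  obtain t \<kappa> where k: "\<And>U. upper_in S U \<Longrightarrow> is_partition (\<kappa> U)"
    "\<And>U V. U \<subseteq> V \<Longrightarrow> \<kappa> V \<le> \<kappa> U"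
    "\<And>U V. upper_in S U \<Longrightarrow> upper_in S V \<Longrightarrow> U \<subseteq> V \<Longrightarrow> V - U = translate t (skew_diagram (\<kappa> U) (\<kappa> V))"
    using assms(1,2) by (rule upper_sets_as_partitions) blast
  have U: "upper_in S (S - \<rho>)" using assms(3) lower_in_iff_upper_in lower_in_subset by blast
  have "S - (S - \<rho>) = \<rho>" using lower_in_subset[OF assms(3)] by blast
  then show ?thesis unfolding taken_out_left_def
    using k(1)[OF upper_in_empty] k(1)[OF U] k(1)[OF upper_in_self] k(2)[of "{}" "S - \<rho>"] k(2)[of "S - \<rho>" S]
      k(3)[OF upper_in_empty upper_in_self] k(3)[OF U upper_in_self]
    by (intro exI[of _ "\<kappa> {}"] exI[of _ "\<kappa> (S - \<rho>)"] exI[of _ "\<kappa> S"] exI[of _ t]) auto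
qed

lemma taken_out_right_upper_in:
  assumes "finite S" "convex_boxes S" "upper_in S \<rho>"
  shows "taken_out_right S \<rho>"
proof -
  obtain t \<kappa> where k: "\<And>U. upper_in S U \<Longrightarrow> is_partition (\<kappa> U)"
    "\<And>U V. U \<subseteq> V \<Longrightarrow> \<kappa> V \<le> \<kappa> U"
    "\<And>U V. upper_in S U \<Longrightarrow> upper_in S V \<Longrightarrow> U \<subseteq> V \<Longrightarrow> V - U = translate t (skew_diagram (\<kappa> U) (\<kappa> V))"
    using assms(1,2) by (rule upper_sets_as_partitions) blast
  show ?thesis unfolding taken_out_right_def
    using k(1)[OF upper_in_empty] k(1)[OF assms(3)] k(1)[OF upper_in_self] k(2)[of "{}" \<rho>] 
      k(2)[OF upper_in_subset[OF assms(3)]]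
      k(3)[OF upper_in_empty upper_in_self] k(3)[OF upper_in_empty assms(3)]
    by (intro exI[of _ "\<kappa> {}"] exI[of _ "\<kappa> \<rho>"] exI[of _ "\<kappa> S"] exI[of _ t]) auto
qed

section \<open>Lattice paths: the row as a function of the content, each step going right or
  up\<close>

definition lattice_path :: "(int \<Rightarrow> int) \<Rightarrow> bool" where
  "lattice_path f \<longleftrightarrow> (\<forall>x. f (x + 1) = f x \<or> f (x + 1) = f x - 1)"

lemma lattice_path_step: "lattice_path f \<Longrightarrow> f x = f (x - 1) \<or> f x = f (x - 1) - 1"
  unfolding lattice_path_def by (drule spec[of _ "x - 1"]) simp

lemma lattice_path_le:
  assumes "lattice_path f" "x \<le> y"
  shows "f y \<le> f x \<and> f x \<le> f y + (y - x)"
  using assms(2)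
proof (induction rule: int_ge_induct)
  case (step i)
  then show ?case using lattice_path_step[OF assms(1), of "i + 1"] by auto
qed simp

text \<open>The boxes on or below a lattice path form an upper set for \<open>box_le\<close>: moving
  right raises the content, where the path only rises; moving down lowers the content, where the
  path falls by at most one row per diagonal.\<close>

lemma lattice_path_mono_le:
  assumes f: "lattice_path f" and "box_le x y" "f (box_content x) \<le> fst x"
  shows "f (box_content y) \<le> fst y"
proof (cases "box_content x \<le> box_content y")
  case True
  then show ?thesis using lattice_path_le[OF f True] assms(2,3) by (simp add: box_le_def)
next
  case False
  then show ?thesis using lattice_path_le[OF f, of "box_content y" "box_content x"] assms(2,3)
    by (simp add: box_le_def box_content_def)
qed

definition between :: "(int \<Rightarrow> int) \<Rightarrow> (int \<Rightarrow> int) \<Rightarrow> box set" where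
  "between h g = {b. h (box_content b) \<le> fst b \<and> fst b < g (box_content b)}"

lemma convex_between:
  assumes "lattice_path h" "lattice_path g"
  shows "convex_boxes (between h g)"
proof (rule convex_boxesI)
  fix x y z assume "x \<in> between h g" "y \<in> between h g" "box_le x z" "box_le z y"
  then show "z \<in> between h g"
    unfolding between_def mem_Collect_eq
    using lattice_path_mono_le[OF assms(1), of x z] lattice_path_mono_le[OF assms(2), of z y] by linarith
qed

text \<open>The first row on the diagonal of content \<open>x\<close> that lies outside \<kappa>:
  the condition says that the box \<open>(i, i + x)\<close> stands left of the end of row
  \<open>i\<close>, places with a negative column included.\<close>

definition boundary :: "(nat \<Rightarrow> nat) \<Rightarrow> int \<Rightarrow> int" where
  "boundary \<kappa> x = int (card {i. int i + x < int (\<kappa> i)})"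

lemma
  assumes "is_partition \<kappa>"
  shows less_boundary_iff: "int i < boundary \<kappa> x \<longleftrightarrow> int i + x < int (\<kappa> i)"
    and lattice_path_boundary: "lattice_path (boundary \<kappa>)"
proof -
  let ?A = "\<lambda>x. {i. int i + x < int (\<kappa> i)}"
  have anti: "\<kappa> j \<le> \<kappa> i" if "i \<le> j" for i j
    using assms that unfolding is_partition_def antimono_def by blast
  have fin: "finite (?A x)" for x
  proof (rule finite_subset)
    show "?A x \<subseteq> {i. \<kappa> i \<noteq> 0} \<union> {..nat (- x)}" by auto
  qed (use assms in \<open>auto simp: is_partition_def\<close>)
  have *: "int i < boundary \<kappa> x \<longleftrightarrow> int i + x < int (\<kappa> i)" for i x
  proof -
    have "j \<in> ?A x" if "k \<in> ?A x" "j \<le> k" for j k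
      using that anti[of j k] by simp
    then show ?thesis
      unfolding boundary_def using down_closed_nat[OF fin, of x i] by simp
  qed
  then show "int i < boundary \<kappa> x \<longleftrightarrow> int i + x < int (\<kappa> i)" .
  have "boundary \<kappa> (x + 1) \<le> boundary \<kappa> x" for x
    unfolding boundary_def using fin by (auto intro!: card_mono)
  moreover have "boundary \<kappa> x - 1 \<le> boundary \<kappa> (x + 1)" for x
  proof (rule ccontr)
    let ?i = "nat (boundary \<kappa> (x + 1))"
    assume a: "\<not> ?thesis"
    have nn: "0 \<le> boundary \<kappa> (x + 1)" by (simp add: boundary_def)
    have "int (Suc ?i) < boundary \<kappa> x" using a nn by simp
    then have "int (Suc ?i) + x < int (\<kappa> (Suc ?i))" using * by blast
    then have "int ?i + (x + 1) < int (\<kappa> ?i)" using anti[of ?i "Suc ?i"] by simp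
    then show False using *[of ?i "x + 1"] nn by simp
  qed
  ultimately show "lattice_path (boundary \<kappa>)"
    unfolding lattice_path_def by (metis add_diff_cancel diff_add_cancel dual_order.antisym not_le zle_diff1_eq)
qed

lemma skew_diagram_between:
  assumes "is_partition \<kappa>" "is_partition \<mu>"
  shows "skew_diagram \<kappa> \<mu> = between (boundary \<mu>) (boundary \<kappa>)"
proof (rule Set.set_eqI)
  fix b :: box
  obtain r c where b: "b = (r, c)" by (cases b)
  have nonneg: "b \<in> skew_diagram \<kappa> \<mu> \<longleftrightarrow> b \<in> between (boundary \<mu>) (boundary \<kappa>)" if nn: "0 \<le> r" "0 \<le> c"
  proof -
    obtain i where i: "r = int i" using nn(1) by (rule nonneg_int_cases)
    obtain j where j: "c = int j" using nn(2) by (rule nonneg_int_cases)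
    note ij = i j
    have "b \<in> skew_diagram \<kappa> \<mu> \<longleftrightarrow> \<mu> i \<le> j \<and> j < \<kappa> i"
      by (simp add: b ij skew_diagram_def)
    moreover have "int i < boundary \<kappa> (c - r) \<longleftrightarrow> j < \<kappa> i" "int i < boundary \<mu> (c - r) \<longleftrightarrow> j < \<mu> i"
      unfolding less_boundary_iff[OF assms(1)] less_boundary_iff[OF assms(2)] ij by linarith+
    ultimately show ?thesis
      unfolding b ij between_def box_content_def mem_Collect_eq fst_conv snd_conv by linarith
  qed
  have m: "0 \<le> r \<and> 0 \<le> c" if "b \<in> between (boundary \<mu>) (boundary \<kappa>)"
  proof -
    have r: "boundary \<mu> (c - r) \<le> r" using that by (simp add: between_def b box_content_def)
    moreover have "0 \<le> boundary \<mu> (c - r)" by (simp add: boundary_def)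
    ultimately have r0: "0 \<le> r" by linarith
    then have "\<not> int (nat r) + (c - r) < int (\<mu> (nat r))"
      using r less_boundary_iff[OF assms(2), of "nat r" "c - r"] by simp
    then show ?thesis using r0 by linarith
  qed
  have "0 \<le> r \<and> 0 \<le> c" if "b \<in> skew_diagram \<kappa> \<mu>"
    using that by (auto simp: skew_diagram_def b)
  then show "b \<in> skew_diagram \<kappa> \<mu> \<longleftrightarrow> b \<in> between (boundary \<mu>) (boundary \<kappa>)"
    using m nonneg by blast
qed

lemma shape_between:
  assumes "is_shape S"
  obtains h g where "lattice_path h" "lattice_path g" "\<And>x. h x \<le> g x" "S = between h g"
proof -
  obtain \<kappa> \<mu> t where *: "is_partition \<kappa>" "is_partition \<mu>" "\<mu> \<le> \<kappa>" "S = translate t (skew_diagram \<kappa> \<mu>)"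
    using assms unfolding is_shape_def by blast
  let ?f = "\<lambda>f x. f (x - box_content t) + fst t :: int"
  have lp: "lattice_path (?f f)" if "lattice_path f" for f
    unfolding lattice_path_def
  proof
    fix x show "f (x + 1 - box_content t) + fst t = f (x - box_content t) + fst t \<or>
        f (x + 1 - box_content t) + fst t = f (x - box_content t) + fst t - 1"
      using that[unfolded lattice_path_def, rule_format, of "x - box_content t"]
      by (simp add: algebra_simps)
  qed
  show ?thesis
  proof (rule that[of "?f (boundary \<mu>)" "?f (boundary \<kappa>)"])
    have "boundary \<mu> x \<le> boundary \<kappa> x" for x
    proof (rule ccontr)
      let ?i = "nat (boundary \<kappa> x)"
      assume "\<not> ?thesis"
      then have "int ?i < boundary \<mu> x" by (simp add: boundary_def)
      moreover have "\<not> int ?i < boundary \<kappa> x" by (simp add: boundary_def)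
      moreover have "\<mu> ?i \<le> \<kappa> ?i" using *(3) by (rule le_funD)
      ultimately show False
        unfolding less_boundary_iff[OF *(1)] less_boundary_iff[OF *(2)] by linarith
    qed
    then show "?f (boundary \<mu>) x \<le> ?f (boundary \<kappa>) x" for x by simp
    show "S = between (?f (boundary \<mu>)) (?f (boundary \<kappa>))"
      unfolding *(4) skew_diagram_between[OF *(1,2)]
      by (rule Set.set_eqI) (simp add: mem_translate between_def box_content_def algebra_simps)
  qed (use lp lattice_path_boundary * in auto)
qed

lemma finite_skew_diagram:
  assumes "is_partition \<kappa>"
  shows "finite (skew_diagram \<kappa> \<mu>)"
proof (rule finite_subset)
  show "skew_diagram \<kappa> \<mu> \<subseteq> (\<lambda>(i, j). (int i, int j)) ` (SIGMA i:{i. \<kappa> i \<noteq> 0}. {..<\<kappa> i})"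
    by (force simp: skew_diagram_def)
qed (use assms in \<open>auto simp: is_partition_def\<close>)

lemma shape_iff_convex: "is_shape S \<longleftrightarrow> finite S \<and> convex_boxes S"
proof (intro iffI conjI)
  assume S: "is_shape S"
  then show "convex_boxes S" by (metis shape_between convex_between)
  from S show "finite S" unfolding is_shape_def by (auto simp: translate_def finite_skew_diagram)
qed (use is_shape_convex in blast)

section \<open>Skew Schur functions and horizontal strips\<close>

definition tableaux :: "box set \<Rightarrow> (nat \<Rightarrow> nat) \<Rightarrow> (box \<Rightarrow> nat) set" where
  "tableaux S e = {T \<in> ssyt S. \<forall>i. card {b \<in> S. T b = i} = e i}"

lemma skew_schur_eq_card: "skew_schur S e = card (tableaux S e)"
  by (simp add: skew_schur_def tableaux_def)

lemma translate_translate: "translate s (translate t S) = translate (t + s) S"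
  by (rule Set.set_eqI) (simp add: mem_translate diff_diff_eq add.commute)

lemma translate_0 [simp]: "translate 0 S = S"
  by (rule Set.set_eqI) (simp add: mem_translate)

lemma tableaux_PiE: "T \<in> tableaux S e \<Longrightarrow> T \<in> S \<rightarrow>\<^sub>E {1..}"
  by (simp add: tableaux_def ssyt_def)

lemma tableaux_card: "T \<in> tableaux S e \<Longrightarrow> card {b \<in> S. T b = i} = e i"
  by (simp add: tableaux_def)

lemma tableaux_translate:
  assumes T: "T \<in> tableaux S e"
  shows "restrict (\<lambda>b. T (b - t)) (translate t S) \<in> tableaux (translate t S) e"
proof -
  let ?T = "restrict (\<lambda>b. T (b - t)) (translate t S)"
  obtain t1 t2 where t: "t = (t1, t2)" by (cases t)
  have TS: "T \<in> S \<rightarrow>\<^sub>E {1..}"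
    and row: "\<And>r c c'. (r, c) \<in> S \<Longrightarrow> (r, c') \<in> S \<Longrightarrow> c < c' \<Longrightarrow> T (r, c) \<le> T (r, c')"
    and col: "\<And>r r' c. (r, c) \<in> S \<Longrightarrow> (r', c) \<in> S \<Longrightarrow> r < r' \<Longrightarrow> T (r, c) < T (r', c)"
    and e: "\<And>i. card {b \<in> S. T b = i} = e i"
    using T unfolding tableaux_def ssyt_def by simp_all
  have "card {b \<in> translate t S. ?T b = i} = e i" for i
  proof -
    have "{b \<in> translate t S. ?T b = i} = translate t {b \<in> S. T b = i}"
      by (rule Set.set_eqI) (auto simp: mem_translate)
    moreover have "card (translate t {b \<in> S. T b = i}) = card {b \<in> S. T b = i}"
      unfolding translate_def by (rule card_image) (simp add: inj_on_def)
    ultimately show ?thesis using e by simp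
  qed
  moreover have "?T \<in> translate t S \<rightarrow>\<^sub>E {1..}"
    using TS by (auto simp: PiE_iff mem_translate)
  moreover have "?T (r, c) \<le> ?T (r, c')"
    if "(r, c) \<in> translate t S" "(r, c') \<in> translate t S" "c < c'" for r c c'
    using that row[of "r - t1" "c - t2" "c' - t2"] by (simp add: mem_translate t)
  moreover have "?T (r, c) < ?T (r', c)"
    if "(r, c) \<in> translate t S" "(r', c) \<in> translate t S" "r < r'" for r r' c
    using that col[of "r - t1" "c - t2" "r' - t1"] by (simp add: mem_translate t)
  ultimately show ?thesis unfolding tableaux_def ssyt_def by blast
qed

lemma skew_schur_translate: "skew_schur (translate t S) = skew_schur S"
proof
  fix e
  let ?f = "\<lambda>t S T. restrict (\<lambda>b. T (b - t)) (translate t S) :: box \<Rightarrow> nat"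
  have inv: "translate (- t) (translate t S) = S" by (simp add: translate_translate)
  have *: "?f (- t) (translate t S) (?f t S T) = T" if "T \<in> S \<rightarrow>\<^sub>E X" for T X
  proof
    fix b show "?f (- t) (translate t S) (?f t S T) b = T b"
    proof (cases "b \<in> S")
      case True
      then show ?thesis by (simp add: inv mem_translate)
    next
      case False
      then show ?thesis using PiE_arb[OF that, of b] by (simp add: inv)
    qed
  qed
  have **: "?f t S (?f (- t) (translate t S) T) = T" if "T \<in> translate t S \<rightarrow>\<^sub>E X" for T X
  proof
    fix b show "?f t S (?f (- t) (translate t S) T) b = T b"
    proof (cases "b \<in> translate t S")
      case True
      then show ?thesis by (simp add: inv mem_translate)
    next
      case False
      then show ?thesis using PiE_arb[OF that, of b] by simp
    qed
  qed
  have "bij_betw (?f t S) (tableaux S e) (tableaux (translate t S) e)"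
  proof (rule bij_betw_byWitness[where f' = "?f (- t) (translate t S)"])
    show "\<forall>T\<in>tableaux S e. ?f (- t) (translate t S) (?f t S T) = T"
      using *[OF tableaux_PiE] by (intro ballI)
    show "\<forall>T\<in>tableaux (translate t S) e. ?f t S (?f (- t) (translate t S) T) = T"
      using **[OF tableaux_PiE] by (intro ballI)
    show "?f t S ` tableaux S e \<subseteq> tableaux (translate t S) e"
      using tableaux_translate by (intro image_subsetI)
    show "?f (- t) (translate t S) ` tableaux (translate t S) e \<subseteq> tableaux S e"
      using tableaux_translate[of _ "translate t S" e "- t"] unfolding inv by (intro image_subsetI)
  qed
  then show "skew_schur (translate t S) e = skew_schur S e"
    unfolding skew_schur_eq_card by (simp add: bij_betw_same_card)
qed

section \<open>Splitting off the largest letter of a tableau\<close>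

definition column_free :: "box set \<Rightarrow> bool" where
  "column_free H \<longleftrightarrow> (\<forall>x\<in>H. \<forall>y\<in>H. snd x = snd y \<longrightarrow> x = y)"

definition horizontal_strips :: "nat \<Rightarrow> box set \<Rightarrow> box set set" where
  "horizontal_strips k S = {H. upper_in S H \<and> column_free H \<and> card H = k}"

lemma finite_upper_in: "finite S \<Longrightarrow> finite {H. upper_in S H}"
  by (rule finite_subset[of _ "Pow S"]) (auto simp: upper_in_def)

lemma finite_lower_in: "finite S \<Longrightarrow> finite {H. lower_in S H}"
  by (rule finite_subset[of _ "Pow S"]) (auto simp: lower_in_def)

lemma finite_horizontal_strips: "finite S \<Longrightarrow> finite (horizontal_strips k S)"
  by (rule finite_subset[OF _ finite_upper_in[of S]]) (auto simp: horizontal_strips_def)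

lemma tableau_entry_used:
  assumes fin: "finite S" and T: "T \<in> tableaux S e" and b: "b \<in> S"
  shows "e (T b) \<noteq> 0"
proof
  assume "e (T b) = 0"
  then have "card {b' \<in> S. T b' = T b} = 0" unfolding tableaux_card[OF T, of "T b"] .
  moreover have "finite {b' \<in> S. T b' = T b}" by (rule finite_subset[OF _ fin]) (rule Collect_restrict)
  ultimately have "{b' \<in> S. T b' = T b} = {}" by (simp only: card_0_eq)
  moreover have "b \<in> {b' \<in> S. T b' = T b}" using b by (intro CollectI conjI refl)
  ultimately show False by (simp only: empty_iff)
qed

lemma tableau_entry_le:
  assumes "finite S" "T \<in> tableaux S e" "\<And>i. i > M \<Longrightarrow> e i = 0" "b \<in> S"
  shows "T b \<le> M"
proof (rule ccontr)
  assume "\<not> ?thesis"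
  then have "e (T b) = 0" by (intro assms(3)) simp
  then show False using tableau_entry_used[OF assms(1,2,4)] by simp
qed

lemma finite_tableaux:
  assumes "finite S" "\<And>i. i > M \<Longrightarrow> e i = 0"
  shows "finite (tableaux S e)"
proof (rule finite_subset)
  show "tableaux S e \<subseteq> S \<rightarrow>\<^sub>E {..M}"
    using tableau_entry_le[OF assms(1) _ assms(2)] PiE_arb[OF tableaux_PiE] by (intro subsetI PiE_I) auto
qed (use assms(1) in \<open>simp add: finite_PiE\<close>)

lemma ssyt_mono:
  assumes "convex_boxes S" "T \<in> ssyt S" "x \<in> S" "y \<in> S" "box_le x y"
  shows "T x \<le> T y"
proof -
  obtain r c where x: "x = (r, c)" by (cases x)
  obtain r' c' where y: "y = (r', c')" by (cases y)
  have le: "r \<le> r'" "c \<le> c'" using assms(5) by (simp_all add: box_le_def x y)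
  have z: "(r, c') \<in> S" using convex_boxesD[OF assms(1,3,4), of "(r, c')"] le by (simp add: box_le_def x y)
  have row: "c < c' \<Longrightarrow> T (r, c) \<le> T (r, c')" and col: "r < r' \<Longrightarrow> T (r, c') < T (r', c')"
    using assms(2,3,4) z unfolding ssyt_def x y by blast+
  have "T (r, c) \<le> T (r, c')" using row le(2) by (cases "c = c'") simp_all
  also have "T (r, c') \<le> T (r', c')" using col le(1) by (cases "r = r'") simp_all
  finally show ?thesis by (simp add: x y)
qed

text \<open>The boxes with the largest letter \<open>M\<close> form a horizontal strip at the lower
  right and the other boxes carry a tableau without that letter; \<open>ext\<close> puts the two
  together again.\<close>

lemma skew_schur_recursion:
  assumes fin: "finite S" and conv: "convex_boxes S" and M: "1 \<le> M" and big: "\<And>i. i > M \<Longrightarrow> e i = 0"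
  shows "skew_schur S e = (\<Sum>H\<in>horizontal_strips (e M) S. skew_schur (S - H) (e(M := 0)))"
proof -
  let ?e = "e(M := 0)"
  let ?HS = "horizontal_strips (e M) S"
  define ext :: "box set \<Rightarrow> (box \<Rightarrow> nat) \<Rightarrow> box \<Rightarrow> nat" where "ext H T b = (if b \<in> H then M else T b)" for H T b
  have less: "T b < M" if "T \<in> tableaux (S - H) ?e" "b \<in> S - H" for T H b
  proof -
    have "T b \<le> M"
    proof (rule tableau_entry_le[OF finite_Diff[OF fin] that(1) _ that(2)])
      show "?e i = 0" if "i > M" for i using big[OF that] by simp
    qed
    moreover have "T b \<noteq> M"
    proof
      assume "T b = M"
      then show False using tableau_entry_used[OF finite_Diff[OF fin] that] by simp
    qed
    ultimately show ?thesis by simp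
  qed
  have recover: "{b \<in> S. ext H T b = M} = H" if "H \<subseteq> S" "T \<in> tableaux (S - H) ?e" for H T
  proof (rule Set.set_eqI)
    fix b
    have "b \<in> S - H \<Longrightarrow> T b \<noteq> M" using less[OF that(2), of b] by simp
    then show "b \<in> {b \<in> S. ext H T b = M} \<longleftrightarrow> b \<in> H"
      using subsetD[OF that(1), of b] by (cases "b \<in> H") (simp_all add: ext_def)
  qed
  have ext_in: "ext H T \<in> tableaux S e" if H: "H \<in> ?HS" and T: "T \<in> tableaux (S - H) ?e" for H T
  proof -
    have up: "upper_in S H" and cf: "column_free H" and card: "card H = e M"
      using H by (auto simp: horizontal_strips_def)
    have HS: "H \<subseteq> S" using up by (rule upper_in_subset)
    have TS: "T \<in> (S - H) \<rightarrow>\<^sub>E {1..}"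
      and row: "\<And>r c c'. (r, c) \<in> S - H \<Longrightarrow> (r, c') \<in> S - H \<Longrightarrow> c < c' \<Longrightarrow> T (r, c) \<le> T (r, c')"
      and col: "\<And>r r' c. (r, c) \<in> S - H \<Longrightarrow> (r', c) \<in> S - H \<Longrightarrow> r < r' \<Longrightarrow> T (r, c) < T (r', c)"
      and cnt: "\<And>i. card {b \<in> S - H. T b = i} = ?e i"
      using T unfolding tableaux_def ssyt_def by simp_all
    have "ext H T \<in> S \<rightarrow>\<^sub>E {1..}"
      using TS HS M by (auto simp: PiE_iff ext_def extensional_def)
    moreover have "ext H T (r, c) \<le> ext H T (r, c')" if "(r, c) \<in> S" "(r, c') \<in> S" "c < c'" for r c c'
      using that upper_inD[OF up, of "(r, c)" "(r, c')"] row[of r c c'] less[OF T, of "(r, c)"]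
      by (auto simp: ext_def box_le_def)
    moreover have "ext H T (r, c) < ext H T (r', c)" if "(r, c) \<in> S" "(r', c) \<in> S" "r < r'" for r r' c
    proof (cases "(r, c) \<in> H")
      case True
      then have "(r', c) \<in> H" using upper_inD[OF up True that(2)] that(3) by (simp add: box_le_def)
      then have "(r, c) = (r', c)" using True cf unfolding column_free_def by force
      then show ?thesis using that(3) by simp
    next
      case False
      then show ?thesis using that col[of r c r'] less[OF T, of "(r, c)"] by (auto simp: ext_def)
    qed
    moreover have "card {b \<in> S. ext H T b = i} = e i" for i
    proof (cases "i = M")
      case True
      then show ?thesis using recover[OF HS T] card by simp
    next
      case False
      then have "{b \<in> S. ext H T b = i} = {b \<in> S - H. T b = i}" by (auto simp: ext_def)
      then show ?thesis using cnt[of i] False by simp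
    qed
    ultimately show ?thesis unfolding tableaux_def ssyt_def by blast
  qed
  have ext_onto: "\<exists>H\<in>?HS. T \<in> ext H ` tableaux (S - H) ?e" if T: "T \<in> tableaux S e" for T
  proof -
    define H where "H = {b \<in> S. T b = M}"
    let ?T = "restrict T (S - H)"
    have Ts: "T \<in> ssyt S" and cnt: "\<And>i. card {b \<in> S. T b = i} = e i" using T by (simp_all add: tableaux_def)
    have TS: "T \<in> S \<rightarrow>\<^sub>E {1..}"
      and row: "\<And>r c c'. (r, c) \<in> S \<Longrightarrow> (r, c') \<in> S \<Longrightarrow> c < c' \<Longrightarrow> T (r, c) \<le> T (r, c')"
      and col: "\<And>r r' c. (r, c) \<in> S \<Longrightarrow> (r', c) \<in> S \<Longrightarrow> r < r' \<Longrightarrow> T (r, c) < T (r', c)"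
      using Ts unfolding ssyt_def by simp_all
    have "upper_in S H"
      unfolding upper_in_def H_def
      using ssyt_mono[OF conv Ts] tableau_entry_le[OF fin T big] by (auto intro: antisym)
    moreover have "column_free H"
    proof -
      have "r = r'" if "(r, c) \<in> H" "(r', c) \<in> H" for r r' c
      proof (rule ccontr)
        assume "r \<noteq> r'"
        then consider "r < r'" | "r' < r" by linarith
        then show False
          using that col[of r c r'] col[of r' c r] by cases (simp_all add: H_def)
      qed
      then show ?thesis unfolding column_free_def by (metis prod.collapse)
    qed
    moreover have "card H = e M" using cnt by (simp add: H_def)
    ultimately have H: "H \<in> ?HS" by (simp add: horizontal_strips_def)
    have "card {b \<in> S - H. ?T b = i} = ?e i" for i
    proof -
      have "{b \<in> S - H. ?T b = i} = (if i = M then {} else {b \<in> S. T b = i})" by (auto simp: H_def)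
      then show ?thesis using cnt[of i] by simp
    qed
    moreover have "?T \<in> ssyt (S - H)"
      unfolding ssyt_def using TS row col by (auto simp: PiE_iff)
    ultimately have "?T \<in> tableaux (S - H) ?e" by (simp add: tableaux_def)
    moreover have "T = ext H ?T"
    proof
      fix b show "T b = ext H ?T b"
        using PiE_arb[OF TS, of b] by (cases "b \<in> S") (simp_all add: ext_def H_def)
    qed
    ultimately show ?thesis using H by blast
  qed
  have "tableaux S e = (\<Union>H\<in>?HS. ext H ` tableaux (S - H) ?e)"
  proof
    show "tableaux S e \<subseteq> (\<Union>H\<in>?HS. ext H ` tableaux (S - H) ?e)" using ext_onto by auto
    show "(\<Union>H\<in>?HS. ext H ` tableaux (S - H) ?e) \<subseteq> tableaux S e" using ext_in by auto
  qed
  then have "card (tableaux S e) = card (\<Union>H\<in>?HS. ext H ` tableaux (S - H) ?e)" by simp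
  also have "\<dots> = (\<Sum>H\<in>?HS. card (ext H ` tableaux (S - H) ?e))"
  proof (rule card_UN_disjoint)
    show "finite ?HS" by (rule finite_horizontal_strips[OF fin])
    show "\<forall>H\<in>?HS. finite (ext H ` tableaux (S - H) ?e)"
    proof
      fix H
      show "finite (ext H ` tableaux (S - H) ?e)"
        by (intro finite_imageI finite_tableaux[of _ M]) (simp_all add: fin big)
    qed
    show "\<forall>H\<in>?HS. \<forall>H'\<in>?HS. H \<noteq> H' \<longrightarrow> ext H ` tableaux (S - H) ?e \<inter> ext H' ` tableaux (S - H') ?e = {}"
    proof (intro ballI impI, rule ccontr)
      fix H H' assume "H \<in> ?HS" "H' \<in> ?HS" "H \<noteq> H'"
        "ext H ` tableaux (S - H) ?e \<inter> ext H' ` tableaux (S - H') ?e \<noteq> {}"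
      then obtain T T' where T: "T \<in> tableaux (S - H) ?e" "T' \<in> tableaux (S - H') ?e" "ext H T = ext H' T'"
        by blast
      have HS: "H \<subseteq> S" "H' \<subseteq> S"
        using \<open>H \<in> ?HS\<close> \<open>H' \<in> ?HS\<close> by (auto simp: horizontal_strips_def upper_in_def)
      have "H = H'" using recover[OF HS(1) T(1)] recover[OF HS(2) T(2)] T(3) by simp
      then show False using \<open>H \<noteq> H'\<close> by simp
    qed
  qed
  also have "\<dots> = (\<Sum>H\<in>?HS. card (tableaux (S - H) ?e))"
  proof (rule sum.cong[OF refl card_image])
    fix H assume "H \<in> ?HS"
    show "inj_on (ext H) (tableaux (S - H) ?e)"
    proof (rule inj_onI)
      fix T T' assume T: "T \<in> tableaux (S - H) ?e" "T' \<in> tableaux (S - H) ?e" and eq: "ext H T = ext H T'"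
      show "T = T'"
      proof
        fix b
        have "T b = undefined" "T' b = undefined" if "b \<in> H"
          using that PiE_arb[OF tableaux_PiE[OF T(1)], of b] PiE_arb[OF tableaux_PiE[OF T(2)], of b] by simp_all
        then show "T b = T' b" using fun_cong[OF eq, of b] by (cases "b \<in> H") (auto simp: ext_def)
      qed
    qed
  qed
  finally show ?thesis by (simp add: skew_schur_eq_card)
qed

text \<open>Entries are positive, so only the empty filling of the empty shape remains. It has
  exponent zero everywhere, which also excludes a nonzero \<open>e 0\<close>.\<close>

lemma skew_schur_no_letters:
  assumes "finite S" "\<And>i. 1 \<le> i \<Longrightarrow> e i = 0"
  shows "skew_schur S e = of_bool (S = {} \<and> e = (\<lambda>_. 0))"
proof (cases "S = {}")
  case True
  have "tableaux {} e = (if e = (\<lambda>_. 0) then {\<lambda>_. undefined} else {})"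
    unfolding tableaux_def ssyt_def by (auto simp: fun_eq_iff)
  then show ?thesis using True by (simp add: skew_schur_eq_card)
next
  case False
  have "T \<notin> tableaux S e" for T
  proof
    assume T: "T \<in> tableaux S e"
    obtain b where b: "b \<in> S" using False by blast
    then have "1 \<le> T b" using PiE_mem[OF tableaux_PiE[OF T]] by simp
    then have "e (T b) = 0" by (rule assms(2))
    then show False using tableau_entry_used[OF assms(1) T b] by simp
  qed
  then have "tableaux S e = {}" by (meson equals0I) 
  then show ?thesis using False by (simp add: skew_schur_eq_card)
qed

text \<open>Exponents range over all functions on \<open>nat\<close>, while a finite shape uses
  finitely many letters. This disposes of the exponents that an induction on the largest letter does
  not reach.\<close>

lemma skew_schur_infinite_support:
  assumes "finite S" "\<not> (\<exists>M. \<forall>i>M. e i = 0)"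
  shows "skew_schur S e = 0"
proof -
  have "T \<notin> tableaux S e" for T
  proof
    assume T: "T \<in> tableaux S e"
    obtain i where i: "i > Max (T ` S)" "e i \<noteq> 0" using assms(2) by blast
    then have "card {b \<in> S. T b = i} \<noteq> 0" using tableaux_card[OF T] by simp
    then have "{b \<in> S. T b = i} \<noteq> {}" by (intro notI) (simp only: card.empty)
    then obtain b where "b \<in> S" "T b = i" by blast
    then have "i \<le> Max (T ` S)" using assms(1) by (intro Max_ge) auto
    then show False using i(1) by simp
  qed
  then have "tableaux S e = {}" by (meson equals0I)
  then show ?thesis by (simp add: skew_schur_eq_card)
qed

section \<open>Moving one element of an interlacing pair\<close>

lemma count_ge_distinct: "distinct ls \<Longrightarrow> count_ge ls x = card {y \<in> set ls. x \<le> y}"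
  unfolding count_ge_def by (metis distinct_card distinct_filter set_filter)

definition interlacing :: "int set \<Rightarrow> int set \<Rightarrow> bool" where
  "interlacing L M \<longleftrightarrow> (\<forall>x. card {y \<in> M. x \<le> y} \<le> card {y \<in> L. x \<le> y} \<and>
     card {y \<in> L. x \<le> y} \<le> card {y \<in> M. x + 1 \<le> y} + 1)"

lemma sorted_desc_distinct: "sorted_wrt (>) (ls :: int list) \<Longrightarrow> distinct ls"
  by (induction ls) auto

lemma det_step_mat_interlacing:
  assumes "length ms = length ls" "sorted_wrt (>) ls" "sorted_wrt (>) ms"
  shows "det (step_mat ls ms) = of_bool (interlacing (set ls) (set ms))"
  using det_step_mat_interlaced[OF assms]
  by (simp add: interlaced_def interlacing_def count_ge_distinct sorted_desc_distinct assms)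

lemma sorted_desc_split:
  assumes "sorted_wrt (>) (ys :: int list)" "k \<notin> set ys"
  shows "ys = filter (\<lambda>y. k < y) ys @ filter (\<lambda>y. y < k) ys"
  using assms
proof (induction ys)
  case (Cons y ys)
  show ?case
  proof (cases "k < y")
    case True
    then show ?thesis using Cons by simp
  next
    case False
    then have "\<forall>z\<in>set (y # ys). z < k" using Cons.prems by force
    then show ?thesis by (simp add: filter_empty_conv filter_id_conv not_less less_imp_le)
  qed
qed simp

text \<open>Sorting the lowered entry back into the list passes exactly the entries strictly between
  \<open>k\<close> and \<open>ls ! i\<close>. Each pass is a transposition of rows, and the sorted
  determinant is the interlacing indicator.\<close>

lemma det_step_mat_lower_row:
  assumes ls: "sorted_wrt (>) ls" and ms: "sorted_wrt (>) ms" and len: "length ms = length ls"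
    and i: "i < length ls" and k: "k < ls ! i" "k \<notin> set ls"
  shows "det (step_mat (ls[i := k]) ms) =
    (-1) ^ card {y \<in> set ls. k < y \<and> y < ls ! i} * of_bool (interlacing (insert k (set ls - {ls ! i})) (set ms))"
proof -
  define xs l ys where "xs = take i ls" and "l = ls ! i" and "ys = drop (Suc i) ls"
  have split: "ls = xs @ l # ys" unfolding xs_def l_def ys_def by (rule id_take_nth_drop[OF i])
  have li: "length xs = i" using i by (simp add: xs_def)
  define ws zs where "ws = filter (\<lambda>y. k < y) ys" and "zs = filter (\<lambda>y. y < k) ys"
  have ys: "ys = ws @ zs"
    unfolding ws_def zs_def using ls k(2) by (intro sorted_desc_split) (auto simp: split sorted_wrt_append)
  have wz: "\<And>y. y \<in> set ws \<Longrightarrow> k < y" "\<And>y. y \<in> set zs \<Longrightarrow> y < k" by (auto simp: ws_def zs_def)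
  have kl: "k < l" using k(1) by (simp add: l_def)
  have srt: "\<And>y. y \<in> set xs \<Longrightarrow> l < y" "\<And>y. y \<in> set ws \<Longrightarrow> y < l"
    "sorted_wrt (>) (xs @ ws @ zs)"
    using ls unfolding split ys by (auto simp: sorted_wrt_append)
  have "ls[i := k] = xs @ k # ws @ zs" using split ys li by (simp add: list_update_append)
  then have "det (step_mat (ls[i := k]) ms) = (-1) ^ length ws * det (step_mat (xs @ ws @ k # zs) ms)"
    by (simp add: det_step_mat_move_row)
  also have "det (step_mat (xs @ ws @ k # zs) ms) = of_bool (interlacing (set (xs @ ws @ k # zs)) (set ms))"
  proof (rule det_step_mat_interlacing[OF _ _ ms])
    show "length ms = length (xs @ ws @ k # zs)" using len by (simp add: split ys)
    show "sorted_wrt (>) (xs @ ws @ k # zs)"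
      using srt wz kl by (force simp: sorted_wrt_append)
  qed
  also have "set (xs @ ws @ k # zs) = insert k (set ls - {ls ! i})"
    using sorted_desc_distinct[OF ls] unfolding l_def[symmetric] by (auto simp: split ys)
  also have "length ws = card {y \<in> set ls. k < y \<and> y < ls ! i}"
  proof -
    have "{y \<in> set ls. k < y \<and> y < ls ! i} = set ws"
      unfolding l_def[symmetric] using srt wz by (fastforce simp: split ys)
    moreover have "distinct ws" using sorted_desc_distinct[OF ls] by (simp add: split ys)
    ultimately show ?thesis by (simp add: distinct_card)
  qed
  finally show ?thesis .
qed

lemma det_step_mat_raise_col:
  assumes ls: "sorted_wrt (>) ls" and ms: "sorted_wrt (>) ms" and len: "length ms = length ls"
    and i: "i < length ls" and k: "ms ! i < k" "k \<notin> set ms"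
  shows "det (step_mat ls (ms[i := k])) =
    (-1) ^ card {y \<in> set ms. ms ! i < y \<and> y < k} * of_bool (interlacing (set ls) (insert k (set ms - {ms ! i})))"
proof -
  define xs l ys where "xs = take i ms" and "l = ms ! i" and "ys = drop (Suc i) ms"
  have split: "ms = xs @ l # ys" unfolding xs_def l_def ys_def by (rule id_take_nth_drop) (simp add: len i)
  have li: "length xs = i" using i len by (simp add: xs_def)
  define zs ws where "zs = filter (\<lambda>y. k < y) xs" and "ws = filter (\<lambda>y. y < k) xs"
  have xs: "xs = zs @ ws"
    unfolding ws_def zs_def using ms k(2) by (intro sorted_desc_split) (auto simp: split sorted_wrt_append)
  have wz: "\<And>y. y \<in> set ws \<Longrightarrow> y < k" "\<And>y. y \<in> set zs \<Longrightarrow> k < y" by (auto simp: ws_def zs_def)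
  have kl: "l < k" using k(1) by (simp add: l_def)
  have srt: "\<And>y. y \<in> set ys \<Longrightarrow> y < l" "\<And>y. y \<in> set ws \<Longrightarrow> l < y" 
    "sorted_wrt (>) (zs @ ws @ ys)"
    using ms unfolding split xs by (auto simp: sorted_wrt_append)
  have "ms[i := k] = xs @ k # ys" using split li by (simp add: list_update_append)
  then have "ms[i := k] = zs @ ws @ k # ys" by (simp add: xs)
  moreover have "det (step_mat ls (zs @ k # ws @ ys)) = (-1) ^ length ws * det (step_mat ls (zs @ ws @ k # ys))"
    by (rule det_step_mat_move_col) (use len in \<open>simp add: split xs\<close>)
  \<comment> \<open>\<open>det_step_mat_move_col\<close> moves \<open>k\<close> to the back, whereas
    here it has to come forward; the sign is its own inverse.\<close>
  moreover have "(-1 :: int) ^ length ws * (-1) ^ length ws = 1"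
    by (simp flip: power_mult_distrib)
  ultimately have "det (step_mat ls (ms[i := k])) = (-1) ^ length ws * det (step_mat ls (zs @ k # ws @ ys))"
    by (simp add: mult.assoc[symmetric])
  also have "det (step_mat ls (zs @ k # ws @ ys)) = of_bool (interlacing (set ls) (set (zs @ k # ws @ ys)))"
  proof (rule det_step_mat_interlacing[OF _ ls])
    show "length (zs @ k # ws @ ys) = length ls" using len by (simp add: split xs)
    show "sorted_wrt (>) (zs @ k # ws @ ys)"
      using srt wz kl by (force simp: sorted_wrt_append)
  qed
  also have "set (zs @ k # ws @ ys) = insert k (set ms - {ms ! i})"
    using sorted_desc_distinct[OF ms] unfolding l_def[symmetric] by (auto simp: split xs)
  also have "length ws = card {y \<in> set ms. ms ! i < y \<and> y < k}"
  proof -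
    have "{y \<in> set ms. ms ! i < y \<and> y < k} = set ws"
      unfolding l_def[symmetric] using srt wz by (fastforce simp: split xs)
    moreover have "distinct ws" using sorted_desc_distinct[OF ms] by (simp add: split xs)
    ultimately show ?thesis by (simp add: distinct_card)
  qed
  finally show ?thesis .
qed

text \<open>With the elements seen as beads, either side sums over the moves of one bead by
  \<open>n\<close> to a free place, the sign counting the beads jumped over. A move to an occupied
  place repeats a row or a column and gives 0, so both sums are those of
  \<open>sum_det_step_mat_shift\<close>.\<close>

lemma interlacing_exchange:
  fixes L M :: "int set"
  assumes fin: "finite L" "finite M" and card: "card L = card M" and n: "n > 0"
  shows "(\<Sum>l | l \<in> L \<and> l - n \<notin> L \<and> interlacing (insert (l - n) (L - {l})) M. (-1) ^ card {y \<in> L. l - n < y \<and> y < l}) =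
         (\<Sum>m | m \<in> M \<and> m + n \<notin> M \<and> interlacing L (insert (m + n) (M - {m})). (-1) ^ card {y \<in> M. m < y \<and> y < m + n} :: int)"
proof -
  define ls where "ls = rev (sorted_list_of_set L)"
  define ms where "ms = rev (sorted_list_of_set M)"
  have ls: "sorted_wrt (>) ls" "set ls = L" and ms: "sorted_wrt (>) ms" "set ms = M"
    and len: "length ms = length ls" and N: "length ls = card L"
    using fin card strict_sorted_list_of_set unfolding ls_def ms_def
    by (auto simp: sorted_wrt_rev)
  have dls: "distinct ls" and dms: "distinct ms" using ls ms sorted_desc_distinct by auto
  have bl: "bij_betw ((!) ls) {..<length ls} L" and bm: "bij_betw ((!) ms) {..<length ls} M"
    using bij_betw_nth[OF dls refl ls(2)[symmetric]] bij_betw_nth[OF dms _ ms(2)[symmetric]] len by simp_all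
  have rows: "det (step_mat (ls[i := ls ! i - n]) ms) =
      (if ls ! i - n \<notin> L \<and> interlacing (insert (ls ! i - n) (L - {ls ! i})) M
       then (-1) ^ card {y \<in> L. ls ! i - n < y \<and> y < ls ! i} else 0)" if i: "i < length ls" for i
  proof (cases "ls ! i - n \<in> L")
    case True
    then obtain j where j: "j < length ls" "ls ! j = ls ! i - n" by (metis in_set_conv_nth ls(2))
    then have "j \<noteq> i" using n by auto
    then have "det (step_mat (ls[i := ls ! i - n]) ms) = 0"
      using i j by (intro det_step_mat_repeated_row[of i _ j]) auto
    then show ?thesis using True by simp
  next
    case False
    then show ?thesis
      using det_step_mat_lower_row[OF ls(1) ms(1) len i, of "ls ! i - n"] n by (simp add: ls(2) ms(2))
  qed
  have cols: "det (step_mat ls (ms[i := ms ! i + n])) =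
      (if ms ! i + n \<notin> M \<and> interlacing L (insert (ms ! i + n) (M - {ms ! i}))
       then (-1) ^ card {y \<in> M. ms ! i < y \<and> y < ms ! i + n} else 0)" if i: "i < length ls" for i
  proof (cases "ms ! i + n \<in> M")
    case True
    then obtain j where j: "j < length ls" "ms ! j = ms ! i + n" by (metis in_set_conv_nth ms(2) len)
    then have "j \<noteq> i" using n by auto
    then have "det (step_mat ls (ms[i := ms ! i + n])) = 0"
      using i j len by (intro det_step_mat_repeated_col[of i _ j]) auto
    then show ?thesis using True by simp
  next
    case False
    then show ?thesis
      using det_step_mat_raise_col[OF ls(1) ms(1) len i, of "ms ! i + n"] n by (simp add: ls(2) ms(2))
  qed
  have "(\<Sum>i<length ls. det (step_mat (ls[i := ls ! i - n]) ms)) =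
      (\<Sum>l\<in>L. if l - n \<notin> L \<and> interlacing (insert (l - n) (L - {l})) M
        then (-1) ^ card {y \<in> L. l - n < y \<and> y < l} else 0)"
    by (subst sum.reindex_bij_betw[OF bl, symmetric]) (rule sum.cong[OF refl], simp add: rows)
  moreover have "(\<Sum>i<length ls. det (step_mat ls (ms[i := ms ! i + n]))) =
      (\<Sum>m\<in>M. if m + n \<notin> M \<and> interlacing L (insert (m + n) (M - {m}))
        then (-1) ^ card {y \<in> M. m < y \<and> y < m + n} else 0)"
    by (subst sum.reindex_bij_betw[OF bm, symmetric]) (rule sum.cong[OF refl], simp add: cols)
  ultimately show ?thesis
    using sum_det_step_mat_shift[OF len, of n]
    by (simp add: sum.inter_filter[OF fin(1), symmetric] sum.inter_filter[OF fin(2), symmetric] conj_assoc)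
qed

section \<open>Strips with one box on each diagonal\<close>

text \<open>For convex sets connectedness follows (\<open>strip_is_ribbon\<close>); the counting
  arguments see only contents.\<close>

definition strip :: "nat \<Rightarrow> box set \<Rightarrow> bool" where
  "strip n \<rho> \<longleftrightarrow> (\<exists>s. bij_betw box_content \<rho> {s..<s + int n})"

definition lower_strips :: "nat \<Rightarrow> box set \<Rightarrow> box set set" where
  "lower_strips n S = {\<rho>. lower_in S \<rho> \<and> strip n \<rho>}"

definition upper_strips :: "nat \<Rightarrow> box set \<Rightarrow> box set set" where
  "upper_strips n S = {\<rho>. upper_in S \<rho> \<and> strip n \<rho>}"

text \<open>The sign of the Murnaghan-Nakayama rule: for a ribbon the exponent is the number of its
  rows minus one.\<close>

definition strip_sign :: "box set \<Rightarrow> int" where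
  "strip_sign \<rho> = (-1) ^ card {b \<in> \<rho>. b + (1, 0) \<in> \<rho>}"

definition path_box :: "(int \<Rightarrow> int) \<Rightarrow> int \<Rightarrow> box" where
  "path_box f x = (f x, f x + x)"

definition path_strip :: "(int \<Rightarrow> int) \<Rightarrow> int \<Rightarrow> int \<Rightarrow> box set" where
  "path_strip f s n = path_box f ` {s..<s + n}"

text \<open>The positions of the upward steps, that is, the bead positions (beta set) of the
  path.\<close>

definition descents :: "(int \<Rightarrow> int) \<Rightarrow> int set" where
  "descents f = {y. f (y + 1) = f y - 1}"

lemma box_content_path_box [simp]: "box_content (path_box f x) = x"
  and fst_path_box [simp]: "fst (path_box f x) = f x"
  by (simp_all add: path_box_def box_content_def)

lemma path_box_eq_iff: "b = path_box f x \<longleftrightarrow> box_content b = x \<and> fst b = f x"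
  by (auto simp: path_box_def box_content_def prod_eq_iff)

lemma mem_path_strip: "b \<in> path_strip f s n \<longleftrightarrow> s \<le> box_content b \<and> box_content b < s + n \<and> fst b = f (box_content b)"
  unfolding path_strip_def by (auto simp: image_iff path_box_eq_iff)

lemma path_strip_subset_iff: "path_strip f s n \<subseteq> S \<longleftrightarrow> (\<forall>x. s \<le> x \<longrightarrow> x < s + n \<longrightarrow> path_box f x \<in> S)"
  unfolding path_strip_def by auto

lemma bij_betw_path_strip: "bij_betw box_content (path_strip f s n) {s..<s + n}"
  by (rule bij_betw_byWitness[where f' = "path_box f"]) (auto simp: path_strip_def)

lemma inj_path_strip: "n > 0 \<Longrightarrow> path_strip f s n = path_strip f s' n \<Longrightarrow> s = s'"
  using bij_betw_imp_surj_on[OF bij_betw_path_strip[of f s n]]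
    bij_betw_imp_surj_on[OF bij_betw_path_strip[of f s' n]] atLeastLessThan_inj(1)[of s "s + n" s' "s' + n"] by simp

text \<open>A vertical pair of boxes is an upward step with both of its ends in the strip. The steps
  entering and leaving the strip do not count, hence the strict bounds.\<close>

lemma strip_sign_path_strip:
  assumes f: "lattice_path f"
  shows "strip_sign (path_strip f s n) = (-1) ^ card {y \<in> descents f. s - 1 < y \<and> y < s + n - 1}"
proof -
  have "bij_betw (\<lambda>y. path_box f (y + 1)) {y \<in> descents f. s - 1 < y \<and> y < s + n - 1}
      {b \<in> path_strip f s n. b + (1, 0) \<in> path_strip f s n}"
  proof (rule bij_betw_byWitness[where f' = "\<lambda>b. box_content b - 1"])
    show "\<forall>b\<in>{b \<in> path_strip f s n. b + (1, 0) \<in> path_strip f s n}. path_box f (box_content b - 1 + 1) = b"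
      by (auto simp: mem_path_strip path_box_def box_content_def prod_eq_iff)
    show "(\<lambda>y. path_box f (y + 1)) ` {y \<in> descents f. s - 1 < y \<and> y < s + n - 1}
        \<subseteq> {b \<in> path_strip f s n. b + (1, 0) \<in> path_strip f s n}"
      by (auto simp: mem_path_strip path_box_def box_content_def descents_def)
    show "(\<lambda>b. box_content b - 1) ` {b \<in> path_strip f s n. b + (1, 0) \<in> path_strip f s n}
        \<subseteq> {y \<in> descents f. s - 1 < y \<and> y < s + n - 1}"
    proof (intro image_subsetI)
      fix b assume b: "b \<in> {b \<in> path_strip f s n. b + (1, 0) \<in> path_strip f s n}"
      have "box_content (b + (1, 0)) = box_content b - 1" "fst (b + (1, 0)) = fst b + 1"
        by (simp_all add: box_content_def)
      then show "box_content b - 1 \<in> {y \<in> descents f. s - 1 < y \<and> y < s + n - 1}"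
        using b by (simp add: mem_path_strip descents_def)
    qed
  qed simp
  then show ?thesis unfolding strip_sign_def by (simp add: bij_betw_same_card)
qed

section \<open>Removable strips along a lattice path\<close>

definition bump :: "(int \<Rightarrow> int) \<Rightarrow> int \<Rightarrow> int \<Rightarrow> int \<Rightarrow> int \<Rightarrow> int" where
  "bump f s n e x = f x + (if s \<le> x \<and> x < s + n then e else 0)"

text \<open>Lowering a stretch of the path by one row turns the upward step into the stretch into a
  step right, and the step right out of it into an upward step.\<close>

lemma lattice_path_bump_up:
  assumes f: "lattice_path f" and n: "n > 0" and s: "f s = f (s - 1) - 1" "f (s + n) = f (s + n - 1)"
  shows "lattice_path (bump f s n 1)"
  unfolding lattice_path_def
proof
  fix x
  have "f (x + 1) = f x \<or> f (x + 1) = f x - 1" using f by (simp add: lattice_path_def)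
  moreover have "f (x + 1) = f x - 1" if "x + 1 = s" using that s(1) by force
  moreover have "f (x + 1) = f x" if "x + 1 = s + n"
  proof -
    show ?thesis using s(2) unfolding that[symmetric] by simp
  qed
  ultimately show "bump f s n 1 (x + 1) = bump f s n 1 x \<or> bump f s n 1 (x + 1) = bump f s n 1 x - 1"
    using n unfolding bump_def by (smt (verit))
qed

lemma lattice_path_bump_down:
  assumes f: "lattice_path f" and n: "n > 0" and s: "f s = f (s - 1)" "f (s + n) = f (s + n - 1) - 1"
  shows "lattice_path (bump f s n (-1))"
  unfolding lattice_path_def
proof
  fix x
  have "f (x + 1) = f x \<or> f (x + 1) = f x - 1" using f by (simp add: lattice_path_def)
  moreover have "f (x + 1) = f x" if "x + 1 = s" using that s(1) by force
  moreover have "f (x + 1) = f x - 1" if "x + 1 = s + n"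
  proof -
    show ?thesis using s(2) unfolding that[symmetric] by simp
  qed
  ultimately show "bump f s n (-1) (x + 1) = bump f s n (-1) x \<or> bump f s n (-1) (x + 1) = bump f s n (-1) x - 1"
    using n unfolding bump_def by (smt (verit))
qed

text \<open>What remains of \<open>S\<close> lies on or below the bumped path, and the boxes there
  form an upper set.\<close>

lemma lower_in_path_strip:
  assumes f: "lattice_path f" and n: "n > 0" and s: "f s = f (s - 1) - 1" "f (s + n) = f (s + n - 1)"
    and sub: "path_strip f s n \<subseteq> S" and above: "\<And>b. b \<in> S \<Longrightarrow> f (box_content b) \<le> fst b"
  shows "lower_in S (path_strip f s n)"
  unfolding lower_in_def
proof (intro conjI ballI impI sub)
  fix x y assume x: "x \<in> path_strip f s n" and y: "y \<in> S" "box_le y x"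
  show "y \<in> path_strip f s n"
  proof (rule ccontr)
    assume "y \<notin> path_strip f s n"
    then have "bump f s n 1 (box_content y) \<le> fst y"
      using above[OF y(1)] by (auto simp: bump_def mem_path_strip)
    then have "bump f s n 1 (box_content x) \<le> fst x"
      by (rule lattice_path_mono_le[OF lattice_path_bump_up[OF f n s] y(2)])
    then show False using x by (simp add: bump_def mem_path_strip)
  qed
qed

lemma upper_in_path_strip:
  assumes f: "lattice_path f" and n: "n > 0" and s: "f s = f (s - 1)" "f (s + n) = f (s + n - 1) - 1"
    and sub: "path_strip f s n \<subseteq> S" and below: "\<And>b. b \<in> S \<Longrightarrow> fst b \<le> f (box_content b)"
  shows "upper_in S (path_strip f s n)"
  unfolding upper_in_def
proof (intro conjI ballI impI sub)
  fix x y assume x: "x \<in> path_strip f s n" and y: "y \<in> S" "box_le x y"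
  show "y \<in> path_strip f s n"
  proof (rule ccontr)
    assume "y \<notin> path_strip f s n"
    then have y': "fst y \<le> bump f s n (-1) (box_content y)"
      using below[OF y(1)] by (auto simp: bump_def mem_path_strip)
    have "lattice_path (\<lambda>z. bump f s n (-1) z + 1)"
      using lattice_path_bump_down[OF f n s] unfolding lattice_path_def by (metis add_diff_eq diff_add_eq)
    from lattice_path_mono_le[OF this y(2)] show False
      using x y' by (simp add: bump_def mem_path_strip)
  qed
qed

text \<open>Converse of \<open>lower_in_path_strip\<close>. Being lower forces \<rho> onto the first
  box of each diagonal. With a wrong step at an end, the next box of the path would be directly west
  or north of a box of \<rho>; \<open>ends\<close> places it in \<open>S\<close>, so it would belong
  to \<rho> although its content is out of range.\<close>

lemma lower_strip_eq_path_strip: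
  assumes \<rho>: "lower_in S \<rho>" "bij_betw box_content \<rho> {s..<s + n}" and n: "n > 0"
    and f: "lattice_path f" and above: "\<And>b. b \<in> S \<Longrightarrow> f (box_content b) \<le> fst b"
    and top: "\<And>b. b \<in> S \<Longrightarrow> path_box f (box_content b) \<in> S"
    and ends: "f s = f (s - 1) \<Longrightarrow> path_box f s \<in> S \<Longrightarrow> path_box f (s - 1) \<in> S"
      "f (s + n) = f (s + n - 1) - 1 \<Longrightarrow> path_box f (s + n - 1) \<in> S \<Longrightarrow> path_box f (s + n) \<in> S"
  shows "\<rho> = path_strip f s n" and "f s = f (s - 1) - 1" and "f (s + n) = f (s + n - 1)"
proof -
  have box: "path_box f x \<in> \<rho> \<and> path_box f x \<in> S \<and> (\<forall>b\<in>\<rho>. box_content b = x \<longrightarrow> b = path_box f x)" if "s \<le> x" "x < s + n" for x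
  proof -
    have "x \<in> box_content ` \<rho>" using bij_betw_imp_surj_on[OF \<rho>(2)] that by simp
    then obtain b where b: "b \<in> \<rho>" "box_content b = x" by blast
    have bS: "b \<in> S" using b(1) lower_in_subset[OF \<rho>(1)] by blast
    have S: "path_box f x \<in> S" using top[OF bS] b(2) by simp
    have "box_le (path_box f x) b"
      using above[OF bS] b(2) by (auto simp: box_le_def path_box_def box_content_def)
    then have r: "path_box f x \<in> \<rho>" using lower_inD[OF \<rho>(1) b(1) S] by blast
    have "b' = path_box f x" if "b' \<in> \<rho>" "box_content b' = x" for b'
      using inj_onD[OF bij_betw_imp_inj_on[OF \<rho>(2)], of b' "path_box f x"] that r by simp
    then show ?thesis using r S by blast
  qed
  have cont: "s \<le> box_content b \<and> box_content b < s + n" if "b \<in> \<rho>" for b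
    using bij_betw_apply[OF \<rho>(2) that] by simp
  show "\<rho> = path_strip f s n"
  proof
    show "\<rho> \<subseteq> path_strip f s n"
    proof
      fix b assume b: "b \<in> \<rho>"
      then have "b = path_box f (box_content b)" using box[of "box_content b"] cont[OF b] by blast
      then show "b \<in> path_strip f s n" using cont[OF b] unfolding path_strip_def by auto
    qed
    show "path_strip f s n \<subseteq> \<rho>" using box by (auto simp: path_strip_def)
  qed
  have s_in: "s \<le> s" "s < s + n" and e_in: "s \<le> s + n - 1" "s + n - 1 < s + n" using n by auto
  show "f s = f (s - 1) - 1"
  proof (rule ccontr)
    assume "\<not> ?thesis"
    then have eq: "f s = f (s - 1)" using lattice_path_step[OF f, of s] by blast
    then have "path_box f (s - 1) \<in> S" using ends(1) box[OF s_in] by blast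
    moreover have "box_le (path_box f (s - 1)) (path_box f s)" using eq by (simp add: box_le_def path_box_def)
    ultimately have "path_box f (s - 1) \<in> \<rho>" using lower_inD[OF \<rho>(1)] box[OF s_in] by blast
    then show False using cont by fastforce
  qed
  show "f (s + n) = f (s + n - 1)"
  proof (rule ccontr)
    assume "\<not> ?thesis"
    then have eq: "f (s + n) = f (s + n - 1) - 1" using lattice_path_step[OF f, of "s + n"] by blast
    then have "path_box f (s + n) \<in> S" using ends(2) box[OF e_in] by blast
    moreover have "box_le (path_box f (s + n)) (path_box f (s + n - 1))" using eq by (simp add: box_le_def path_box_def)
    ultimately have "path_box f (s + n) \<in> \<rho>" using lower_inD[OF \<rho>(1)] box[OF e_in] by blast
    then show False using cont by fastforce
  qed
qed


section \<open>Rotation by 180 degrees and strips at the lower right\<close>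

lemma mem_rotate180: "b \<in> rotate180 S \<longleftrightarrow> - b \<in> S"
  unfolding rotate180_def by (metis imageE image_eqI minus_minus)

lemma box_content_uminus [simp]: "box_content (- b) = - box_content b"
  by (simp add: box_content_def)

lemma box_le_uminus: "box_le (- x) (- y) \<longleftrightarrow> box_le y x"
  by (auto simp: box_le_def)

lemma rotate180_rotate180 [simp]: "rotate180 (rotate180 S) = S"
  by (rule Set.set_eqI) (simp add: mem_rotate180)

lemma finite_rotate180 [simp]: "finite (rotate180 S) \<longleftrightarrow> finite S"
  by (metis finite_imageI rotate180_def rotate180_rotate180)

lemma lower_in_rotate180: "lower_in (rotate180 S) (rotate180 \<rho>) \<longleftrightarrow> upper_in S \<rho>"
proof
  assume l: "lower_in (rotate180 S) (rotate180 \<rho>)"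
  show "upper_in S \<rho>"
    unfolding upper_in_def
  proof (intro conjI subsetI ballI impI)
    fix x assume "x \<in> \<rho>" then show "x \<in> S"
      using lower_in_subset[OF l] mem_rotate180[of "- x"] by auto
  next
    fix x y assume "x \<in> \<rho>" "y \<in> S" "box_le x y"
    then show "y \<in> \<rho>" using lower_inD[OF l, of "- x" "- y"] by (simp add: mem_rotate180 box_le_uminus)
  qed
next
  assume u: "upper_in S \<rho>"
  show "lower_in (rotate180 S) (rotate180 \<rho>)"
    unfolding lower_in_def
  proof (intro conjI subsetI ballI impI)
    fix x assume "x \<in> rotate180 \<rho>" then show "x \<in> rotate180 S"
      using upper_in_subset[OF u] by (auto simp: mem_rotate180)
  next
    fix x y assume "x \<in> rotate180 \<rho>" "y \<in> rotate180 S" "box_le y x"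
    then show "y \<in> rotate180 \<rho>" using upper_inD[OF u, of "- x" "- y"] by (simp add: mem_rotate180 box_le_uminus)
  qed
qed

lemma bij_betw_box_content_rotate180:
  assumes "bij_betw box_content \<rho> {s..<s + n}"
  shows "bij_betw box_content (rotate180 \<rho>) {1 - s - n..<1 - s - n + n}"
proof -
  have "bij_betw uminus (rotate180 \<rho>) \<rho>"
    by (rule bij_betw_byWitness[where f' = uminus]) (auto simp: mem_rotate180)
  moreover have "bij_betw uminus {s..<s + n} {1 - s - n..<1 - s - n + n}"
    by (rule bij_betw_byWitness[where f' = uminus]) auto
  ultimately have "bij_betw (uminus \<circ> (box_content \<circ> uminus)) (rotate180 \<rho>) {1 - s - n..<1 - s - n + n}"
    using assms by (intro bij_betw_trans)
  moreover have "uminus \<circ> (box_content \<circ> uminus) = box_content" by (auto simp: fun_eq_iff)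
  ultimately show ?thesis by simp
qed

lemma lattice_path_reflect:
  assumes "lattice_path f"
  shows "lattice_path (\<lambda>x. c - f (d - x))"
  unfolding lattice_path_def
proof
  fix x
  have "f (d - x) = f (d - (x + 1)) \<or> f (d - x) = f (d - (x + 1)) - 1"
    using lattice_path_step[OF assms, of "d - x"] by (simp add: algebra_simps)
  then show "c - f (d - (x + 1)) = c - f (d - x) \<or> c - f (d - (x + 1)) = c - f (d - x) - 1" by auto
qed

lemma uminus_path_box: "- path_box f x = path_box (\<lambda>x. - f (- x)) (- x)"
  by (simp add: path_box_def)

text \<open>The rotated form of \<open>lower_strip_eq_path_strip\<close>. Contents change sign, so
  the strip that started at \<open>s\<close> starts at \<open>1 - s - n\<close>, and the conditions
  on its two ends change places.\<close>

lemma upper_strip_eq_path_strip: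
  assumes \<rho>: "upper_in S \<rho>" "bij_betw box_content \<rho> {s..<s + n}" and n: "n > 0"
    and f: "lattice_path f" and below: "\<And>b. b \<in> S \<Longrightarrow> fst b \<le> f (box_content b)"
    and bottom: "\<And>b. b \<in> S \<Longrightarrow> path_box f (box_content b) \<in> S"
    and ends: "f s = f (s - 1) - 1 \<Longrightarrow> path_box f s \<in> S \<Longrightarrow> path_box f (s - 1) \<in> S"
      "f (s + n) = f (s + n - 1) \<Longrightarrow> path_box f (s + n - 1) \<in> S \<Longrightarrow> path_box f (s + n) \<in> S"
  shows "\<rho> = path_strip f s n" and "f s = f (s - 1)" and "f (s + n) = f (s + n - 1) - 1"
proof -
  let ?F = "\<lambda>x. - f (- x)"
  have mem: "path_box ?F x \<in> rotate180 S \<longleftrightarrow> path_box f (- x) \<in> S" for x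
    by (simp add: mem_rotate180 uminus_path_box)
  have F: "lattice_path ?F" using lattice_path_reflect[OF f, of 0 0] by simp
  have above: "?F (box_content b) \<le> fst b" if "b \<in> rotate180 S" for b
    using below[of "- b"] that by (simp add: mem_rotate180)
  have top: "path_box ?F (box_content b) \<in> rotate180 S" if "b \<in> rotate180 S" for b
    unfolding mem using bottom[of "- b"] that by (simp add: mem_rotate180)
  have l: "lower_in (rotate180 S) (rotate180 \<rho>)" using \<rho>(1) by (simp add: lower_in_rotate180)
  have e: "- (1 - s - n) = s + n - 1" "- (1 - s - n - 1) = s + n" "- (1 - s - n + n) = s - 1" "- (1 - s - n + n - 1) = s"
    by simp_all
  have e1: "path_box ?F (1 - s - n - 1) \<in> rotate180 S"
    if "?F (1 - s - n) = ?F (1 - s - n - 1)" "path_box ?F (1 - s - n) \<in> rotate180 S"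
    using ends(2) that unfolding mem e by simp
  have e2: "path_box ?F (1 - s - n + n) \<in> rotate180 S"
    if "?F (1 - s - n + n) = ?F (1 - s - n + n - 1) - 1" "path_box ?F (1 - s - n + n - 1) \<in> rotate180 S"
    using ends(1) that unfolding mem e by simp
  note * = lower_strip_eq_path_strip[OF l bij_betw_box_content_rotate180[OF \<rho>(2)] n F above top e1 e2]
  show "f s = f (s - 1)" "f (s + n) = f (s + n - 1) - 1" using *(2,3) unfolding e by simp_all
  have *: "rotate180 \<rho> = path_strip ?F (1 - s - n) n" using *(1) by simp
  show "\<rho> = path_strip f s n"
  proof (rule Set.set_eqI)
    fix b
    have "b \<in> \<rho> \<longleftrightarrow> - b \<in> rotate180 \<rho>" by (simp add: mem_rotate180)
    also have "\<dots> \<longleftrightarrow> b \<in> path_strip f s n" unfolding * mem_path_strip by auto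
    finally show "b \<in> \<rho> \<longleftrightarrow> b \<in> path_strip f s n" .
  qed
qed

text \<open>Off the diagonals of \<open>S\<close> the paths enclose nothing, so from the
  neighbouring diagonals \<open>lo\<close> and \<open>hi\<close> on both can be continued by one
  constant. This makes the descent sets finite and of equal size, as square matrices
  require.\<close>

lemma convex_between_constant:
  assumes "finite S" "convex_boxes S"
  obtains h g lo hi k where "lattice_path h" "lattice_path g" "\<And>x. h x \<le> g x" "S = between h g"
    "\<And>x. x \<le> lo \<Longrightarrow> h x = h lo \<and> g x = h lo" "\<And>x. hi \<le> x \<Longrightarrow> h x = k \<and> g x = k"
proof -
  obtain h g where hg: "lattice_path h" "lattice_path g" "\<And>x. h x \<le> g x" "S = between h g"
    using shape_between[of S] assms by (auto simp: shape_iff_convex)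
  define lo hi where "lo = Min (insert 0 (box_content ` S)) - 1" and "hi = Max (insert 0 (box_content ` S)) + 1"
  have range: "lo < box_content b \<and> box_content b < hi" if "b \<in> S" for b
  proof -
    have "Min (insert 0 (box_content ` S)) \<le> box_content b" "box_content b \<le> Max (insert 0 (box_content ` S))"
      using that assms(1) by auto
    then show ?thesis by (simp add: lo_def hi_def)
  qed
  have "Min (insert 0 (box_content ` S)) \<le> 0" "0 \<le> Max (insert 0 (box_content ` S))"
    using assms(1) by auto
  then have lohi: "lo < hi" by (simp add: lo_def hi_def)
  have eq: "h x = g x" if "x \<le> lo \<or> hi \<le> x" for x
  proof (rule ccontr)
    assume "h x \<noteq> g x"
    then have "path_box h x \<in> S" using hg(3)[of x] by (simp add: hg(4) between_def)
    then show False using range[of "path_box h x"] that by simp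
  qed
  define clip where "clip x = max lo (min hi x)" for x
  have clip: "lattice_path (f \<circ> clip)" if "lattice_path f" for f
    unfolding lattice_path_def
  proof
    fix x
    have "clip (x + 1) = clip x \<or> clip (x + 1) = clip x + 1" by (auto simp: clip_def)
    then show "(f \<circ> clip) (x + 1) = (f \<circ> clip) x \<or> (f \<circ> clip) (x + 1) = (f \<circ> clip) x - 1"
      using that unfolding lattice_path_def by auto
  qed
  show ?thesis
  proof (rule that[of "h \<circ> clip" "g \<circ> clip" lo hi "h hi"])
    show "S = between (h \<circ> clip) (g \<circ> clip)"
    proof (rule Set.set_eqI)
      fix b
      show "b \<in> S \<longleftrightarrow> b \<in> between (h \<circ> clip) (g \<circ> clip)"
      proof (cases "lo < box_content b \<and> box_content b < hi")
        case True
        then have "clip (box_content b) = box_content b" by (simp add: clip_def)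
        then show ?thesis by (simp add: hg(4) between_def)
      next
        case False
        then have "clip (box_content b) \<le> lo \<or> hi \<le> clip (box_content b)" by (auto simp: clip_def)
        then have "h (clip (box_content b)) = g (clip (box_content b))" by (rule eq)
        then show ?thesis using range[of b] False by (auto simp: between_def)
      qed
    qed
  qed (use hg clip eq lohi in \<open>auto simp: clip_def min_def max_def\<close>)
qed

section \<open>Upward steps of the two boundary paths\<close>

lemma card_descents:
  assumes f: "lattice_path f" and k: "\<And>x. hi \<le> x \<Longrightarrow> f x = k"
  shows "finite {y \<in> descents f. x \<le> y} \<and> int (card {y \<in> descents f. x \<le> y}) = f x - k"
proof (cases "x \<le> hi")
  case True
  then show ?thesis
  proof (induction rule: int_le_induct)
    case base
    have "{y \<in> descents f. hi \<le> y} = {}" using k by (auto simp: descents_def)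
    then show ?case using k[of hi] by (simp only:) simp
  next
    case (step i)
    have "{y \<in> descents f. i - 1 \<le> y} =
        (if f i = f (i - 1) - 1 then insert (i - 1) {y \<in> descents f. i \<le> y} else {y \<in> descents f. i \<le> y})"
    proof -
      have "i - 1 \<le> y \<longleftrightarrow> y = i - 1 \<or> i \<le> y" for y by auto
      then show ?thesis by (auto simp: descents_def)
    qed
    then show ?case using step.IH lattice_path_step[OF f, of i] by auto
  qed
next
  case False
  then have "{y \<in> descents f. x \<le> y} = {}" using k by (auto simp: descents_def)
  then show ?thesis using k[of x] False by (simp only:) simp
qed

text \<open>By \<open>card_descents\<close> the counts are heights above the common limit
  \<open>k\<close>. The two interlacing inequalities then say that the paths do not cross and, by
  \<open>column_free_between\<close>, that no column holds two boxes.\<close>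

lemma interlacing_descents:
  assumes "lattice_path h" "lattice_path g" "\<And>x. hi \<le> x \<Longrightarrow> h x = k \<and> g x = k"
  shows "interlacing (descents g) (descents h) \<longleftrightarrow> (\<forall>x. h x \<le> g x \<and> g x \<le> h (x + 1) + 1)"
proof -
  have h: "int (card {y \<in> descents h. x \<le> y}) = h x - k" for x
    using card_descents[OF assms(1), of hi k x] assms(3) by blast
  have g: "int (card {y \<in> descents g. x \<le> y}) = g x - k" for x
    using card_descents[OF assms(2), of hi k x] assms(3) by blast
  show ?thesis unfolding interlacing_def
  proof (rule iff_allI)
    fix x
    have "int (card {y \<in> descents g. x \<le> y}) \<le> int (card {y \<in> descents h. x + 1 \<le> y} + 1) \<longleftrightarrow> g x \<le> h (x + 1) + 1"
      unfolding of_nat_add h g by auto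
    moreover have "int (card {y \<in> descents h. x \<le> y}) \<le> int (card {y \<in> descents g. x \<le> y}) \<longleftrightarrow> h x \<le> g x"
      by (simp add: h g)
    ultimately show "card {y \<in> descents h. x \<le> y} \<le> card {y \<in> descents g. x \<le> y} \<and>
        card {y \<in> descents g. x \<le> y} \<le> card {y \<in> descents h. x + 1 \<le> y} + 1 \<longleftrightarrow>
        h x \<le> g x \<and> g x \<le> h (x + 1) + 1"
      by (simp only: of_nat_le_iff)
  qed
qed

text \<open>A box and the one below it have contents \<open>x + 1\<close> and \<open>x\<close>.
  Because of the bounded slope of \<open>g\<close> it is enough to test the place below the first
  box of each diagonal.\<close>

lemma column_free_between:
  assumes h: "lattice_path h" and g: "lattice_path g"
  shows "column_free (between h g) \<longleftrightarrow> (\<forall>x. g x \<le> h (x + 1) + 1)"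
proof
  assume cf: "column_free (between h g)"
  show "\<forall>x. g x \<le> h (x + 1) + 1"
  proof (rule allI, rule ccontr)
    fix x assume a: "\<not> g x \<le> h (x + 1) + 1"
    let ?r = "h (x + 1)"
    have "(?r, ?r + x + 1) \<in> between h g"
      using a lattice_path_step[OF g, of "x + 1"] by (auto simp: between_def box_content_def algebra_simps)
    moreover have "(?r + 1, ?r + x + 1) \<in> between h g"
      using a lattice_path_step[OF h, of "x + 1"] by (auto simp: between_def box_content_def algebra_simps)
    ultimately have "(?r, ?r + x + 1) = (?r + 1, ?r + x + 1)" using cf unfolding column_free_def by fastforce
    then show False by simp
  qed
next
  assume a: "\<forall>x. g x \<le> h (x + 1) + 1"
  have no: False if "(r, c) \<in> between h g" "(r', c) \<in> between h g" "r < r'" for r r' c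
  proof -
    have "r' < g (c - r')" "h (c - r) \<le> r" using that(1,2) by (simp_all add: between_def box_content_def)
    moreover have "g (c - r') \<le> g (c - r - 1) + (r' - r - 1)"
      using lattice_path_le[OF g, of "c - r'" "c - r - 1"] that(3) by simp
    moreover have "g (c - r - 1) \<le> h (c - r) + 1" using a[rule_format, of "c - r - 1"] by simp
    ultimately show False by linarith
  qed
  show "column_free (between h g)"
    unfolding column_free_def
  proof (intro ballI impI)
    fix x y assume xy: "x \<in> between h g" "y \<in> between h g" "snd x = snd y"
    obtain r c r' where "x = (r, c)" "y = (r', c)" using xy(3) by (metis prod.collapse)
    then show "x = y" using no[of r c r'] no[of r' c r] xy by (cases r r' rule: linorder_cases) auto
  qed
qed


text \<open>Taking out a strip at the upper left is the move of one bead by \<open>n\<close> to a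
  free place on the right; at the lower right the bead moves left.\<close>

lemma descents_bump_up:
  assumes "n > 0" "f s = f (s - 1) - 1" "f (s + n) = f (s + n - 1)"
  shows "descents (bump f s n 1) = insert (s - 1 + n) (descents f - {s - 1})"
proof (rule Set.set_eqI)
  fix y
  consider "y = s - 1" | "y = s + n - 1" | "y \<noteq> s - 1" "y \<noteq> s + n - 1" by blast
  then show "y \<in> descents (bump f s n 1) \<longleftrightarrow> y \<in> insert (s - 1 + n) (descents f - {s - 1})"
    by cases (use assms in \<open>auto simp: descents_def bump_def\<close>)
qed

lemma descents_bump_down:
  assumes "n > 0" "f s = f (s - 1)" "f (s + n) = f (s + n - 1) - 1"
  shows "descents (bump f s n (-1)) = insert (s + n - 1 - n) (descents f - {s + n - 1})"
proof (rule Set.set_eqI)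
  fix y
  consider "y = s - 1" | "y = s + n - 1" | "y \<noteq> s - 1" "y \<noteq> s + n - 1" by blast
  then show "y \<in> descents (bump f s n (-1)) \<longleftrightarrow> y \<in> insert (s + n - 1 - n) (descents f - {s + n - 1})"
    by cases (use assms in \<open>auto simp: descents_def bump_def\<close>)
qed

lemma between_Diff_lower: "between h g - path_strip h s n = between (bump h s n 1) g"
  by (rule Set.set_eqI) (auto simp: between_def mem_path_strip bump_def)

lemma between_Diff_upper: "between h g - path_strip (\<lambda>x. g x - 1) s n = between h (bump g s n (-1))"
  by (rule Set.set_eqI) (auto simp: between_def mem_path_strip bump_def)

lemma bump_eventually:
  assumes "\<And>x. hi \<le> x \<Longrightarrow> f x = k"
  shows "max hi (s + n) \<le> x \<Longrightarrow> bump f s n e x = k"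
  using assms by (simp add: bump_def)

text \<open>Both sums run over the terms of \<open>interlacing_exchange\<close> for the descent sets of the two
  boundary paths of \<open>X\<close>.\<close>

lemma strip_exchange:
  fixes n :: nat
  assumes X: "finite X" "convex_boxes X" and n: "n > 0"
  shows "(\<Sum>\<rho> | \<rho> \<in> upper_strips n X \<and> column_free (X - \<rho>). strip_sign \<rho>) =
         (\<Sum>\<rho> | \<rho> \<in> lower_strips n X \<and> column_free (X - \<rho>). strip_sign \<rho>)"
proof -
  obtain h g lo hi k where hg: "lattice_path h" "lattice_path g" "\<And>x. h x \<le> g x" "X = between h g"
    and lo: "\<And>x. x \<le> lo \<Longrightarrow> h x = h lo \<and> g x = h lo" and hi: "\<And>x. hi \<le> x \<Longrightarrow> h x = k \<and> g x = k"
    using convex_between_constant[OF X] by blast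
  let ?n = "int n"
  let ?L = "descents g" and ?M = "descents h"
  \<comment> \<open>\<open>g\<close> is the first row outside \<open>X\<close>, so the boxes of an
    upper strip lie one row higher.\<close>
  let ?g = "\<lambda>x. g x - 1"
  have n0: "?n > 0" using n by simp
  have sub: "descents f = {y \<in> descents f. lo \<le> y}" if const: "\<And>x. x \<le> lo \<Longrightarrow> f x = f lo" for f
  proof -
    have "lo \<le> y" if y: "y \<in> descents f" for y
    proof (rule ccontr)
      assume "\<not> lo \<le> y"
      then have "f y = f lo" "f (y + 1) = f lo" using const[of y] const[of "y + 1"] by auto
      then show False using y by (simp add: descents_def)
    qed
    then show ?thesis by auto
  qed
  have cL: "finite ?L \<and> int (card ?L) = g lo - k"
  proof -
    have "g x = g lo" if "x \<le> lo" for x using lo[OF that] lo[of lo] by simp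
    then have eq: "{y \<in> ?L. lo \<le> y} = ?L" by (rule sub[symmetric])
    show ?thesis using card_descents[OF hg(2), of hi k lo] hi unfolding eq by blast
  qed
  have cM: "finite ?M \<and> int (card ?M) = h lo - k"
  proof -
    have "h x = h lo" if "x \<le> lo" for x using lo[OF that] by simp
    then have eq: "{y \<in> ?M. lo \<le> y} = ?M" by (rule sub[symmetric])
    show ?thesis using card_descents[OF hg(1), of hi k lo] hi unfolding eq by blast
  qed
  have card: "card ?L = card ?M" using cL cM lo[of lo] by simp
  have g1: "lattice_path ?g" using hg(2) unfolding lattice_path_def by (metis diff_right_commute)
  have nonempty: "h x \<le> fst b \<and> fst b < g x" if "b \<in> X" "box_content b = x" for b x
    using that by (simp add: hg(4) between_def)
  have memh: "path_box h x \<in> X \<longleftrightarrow> h x < g x" and memg: "path_box ?g x \<in> X \<longleftrightarrow> h x < g x" for x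
    by (auto simp: hg(4) between_def)
  let ?low = "\<lambda>m. m \<in> ?M \<and> m + ?n \<notin> ?M \<and> interlacing ?L (insert (m + ?n) (?M - {m}))"
  let ?upp = "\<lambda>l. l \<in> ?L \<and> l - ?n \<notin> ?L \<and> interlacing (insert (l - ?n) (?L - {l})) ?M"
  \<comment> \<open>The bead \<open>s - 1\<close> moves to \<open>s - 1 + n\<close>. Of the two
    inequalities that express interlacing with the bumped path, one says that the strip fits into
    \<open>X\<close>, the other that the remainder has no two boxes in a column.\<close>
  have low: "(path_strip h s ?n \<in> lower_strips n X \<and> column_free (X - path_strip h s ?n)) \<longleftrightarrow> ?low (s - 1)"
    if steps: "h s = h (s - 1) - 1" "h (s + ?n) = h (s + ?n - 1)" for s
  proof -
    let ?h = "bump h s ?n 1"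
    have h': "lattice_path ?h" by (rule lattice_path_bump_up[OF hg(1) n0 steps])
    have "s - 1 \<in> ?M" "s - 1 + ?n \<notin> ?M" using steps by (auto simp: descents_def algebra_simps)
    moreover have "interlacing ?L (insert (s - 1 + ?n) (?M - {s - 1})) \<longleftrightarrow> (\<forall>x. ?h x \<le> g x \<and> g x \<le> ?h (x + 1) + 1)"
      unfolding descents_bump_up[of ?n h s, OF n0 steps, symmetric]
      by (rule interlacing_descents[OF h' hg(2), of "max hi (s + ?n)" k])
        (use hi bump_eventually[of hi h k s ?n] in auto)
    moreover have "(\<forall>x. ?h x \<le> g x) \<longleftrightarrow> path_strip h s ?n \<in> lower_strips n X"
    proof
      assume a: "\<forall>x. ?h x \<le> g x"
      have "h x < g x" if "s \<le> x" "x < s + ?n" for x using a[rule_format, of x] that by (simp add: bump_def)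
      then have "path_strip h s ?n \<subseteq> X" by (simp add: path_strip_subset_iff memh)
      then have "lower_in X (path_strip h s ?n)"
        by (intro lower_in_path_strip[OF hg(1) n0 steps]) (use nonempty in auto)
      then show "path_strip h s ?n \<in> lower_strips n X"
        using bij_betw_path_strip by (auto simp: lower_strips_def strip_def)
    next
      assume "path_strip h s ?n \<in> lower_strips n X"
      then have "path_strip h s ?n \<subseteq> X" by (simp add: lower_strips_def lower_in_def)
      then have "h x < g x" if "s \<le> x" "x < s + ?n" for x
        using that by (simp add: path_strip_subset_iff memh)
      then show "\<forall>x. ?h x \<le> g x" using hg(3) by (simp add: bump_def add1_zle_eq)
    qed
    moreover have "column_free (X - path_strip h s ?n) \<longleftrightarrow> (\<forall>x. g x \<le> ?h (x + 1) + 1)"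
      unfolding hg(4) between_Diff_lower by (rule column_free_between[OF h' hg(2)])
    ultimately show ?thesis by blast
  qed
  have upp: "(path_strip ?g s ?n \<in> upper_strips n X \<and> column_free (X - path_strip ?g s ?n)) \<longleftrightarrow> ?upp (s + ?n - 1)"
    if steps: "g s = g (s - 1)" "g (s + ?n) = g (s + ?n - 1) - 1" for s
  proof -
    let ?g' = "bump g s ?n (-1)"
    have g': "lattice_path ?g'" by (rule lattice_path_bump_down[OF hg(2) n0 steps])
    have "s + ?n - 1 \<in> ?L" "s + ?n - 1 - ?n \<notin> ?L" using steps by (auto simp: descents_def algebra_simps)
    moreover have "interlacing (insert (s + ?n - 1 - ?n) (?L - {s + ?n - 1})) ?M \<longleftrightarrow> (\<forall>x. h x \<le> ?g' x \<and> ?g' x \<le> h (x + 1) + 1)"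
      unfolding descents_bump_down[of ?n g s, OF n0 steps, symmetric]
      by (rule interlacing_descents[OF hg(1) g', of "max hi (s + ?n)" k])
        (use hi bump_eventually[of hi g k s ?n] in auto)
    moreover have "(\<forall>x. h x \<le> ?g' x) \<longleftrightarrow> path_strip ?g s ?n \<in> upper_strips n X"
    proof
      assume a: "\<forall>x. h x \<le> ?g' x"
      have "h x < g x" if "s \<le> x" "x < s + ?n" for x using a[rule_format, of x] that by (simp add: bump_def)
      then have "path_strip ?g s ?n \<subseteq> X" by (simp add: path_strip_subset_iff memg)
      then have "upper_in X (path_strip ?g s ?n)"
        by (intro upper_in_path_strip[OF g1 n0]) (use nonempty steps in auto)
      then show "path_strip ?g s ?n \<in> upper_strips n X"
        using bij_betw_path_strip by (auto simp: upper_strips_def strip_def)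
    next
      assume "path_strip ?g s ?n \<in> upper_strips n X"
      then have "path_strip ?g s ?n \<subseteq> X" by (simp add: upper_strips_def upper_in_def)
      then have "h x < g x" if "s \<le> x" "x < s + ?n" for x
        using that by (simp add: path_strip_subset_iff memg)
      then show "\<forall>x. h x \<le> ?g' x" using hg(3) by (simp add: bump_def)
    qed
    moreover have "column_free (X - path_strip ?g s ?n) \<longleftrightarrow> (\<forall>x. ?g' x \<le> h (x + 1) + 1)"
      unfolding hg(4) between_Diff_upper by (rule column_free_between[OF hg(1) g'])
    ultimately show ?thesis by blast
  qed
  have low_ex: "\<exists>s. \<rho> = path_strip h s ?n \<and> h s = h (s - 1) - 1 \<and> h (s + ?n) = h (s + ?n - 1)"
    if \<rho>: "\<rho> \<in> lower_strips n X" for \<rho>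
  proof -
    obtain s where s: "bij_betw box_content \<rho> {s..<s + ?n}" "lower_in X \<rho>"
      using \<rho> by (auto simp: lower_strips_def strip_def)
    have "path_box h (s - 1) \<in> X" if "h s = h (s - 1)" "path_box h s \<in> X"
      using that lattice_path_step[OF hg(2), of s] unfolding memh by linarith
    moreover have "path_box h (s + ?n) \<in> X" if "h (s + ?n) = h (s + ?n - 1) - 1" "path_box h (s + ?n - 1) \<in> X"
      using that lattice_path_step[OF hg(2), of "s + ?n"] unfolding memh by linarith
    moreover have "path_box h (box_content b) \<in> X" "h (box_content b) \<le> fst b" if "b \<in> X" for b
      using nonempty[OF that refl] memh[of "box_content b"] by auto
    ultimately show ?thesis using lower_strip_eq_path_strip[OF s(2,1) n0 hg(1)] by blast
  qed
  have upp_ex: "\<exists>s. \<rho> = path_strip ?g s ?n \<and> g s = g (s - 1) \<and> g (s + ?n) = g (s + ?n - 1) - 1"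
    if \<rho>: "\<rho> \<in> upper_strips n X" for \<rho>
  proof -
    obtain s where s: "bij_betw box_content \<rho> {s..<s + ?n}" "upper_in X \<rho>"
      using \<rho> by (auto simp: upper_strips_def strip_def)
    have 1: "path_box ?g (s - 1) \<in> X" if "?g s = ?g (s - 1) - 1" "path_box ?g s \<in> X"
      using that lattice_path_step[OF hg(1), of s] unfolding memg by linarith
    have 2: "path_box ?g (s + ?n) \<in> X" if "?g (s + ?n) = ?g (s + ?n - 1)" "path_box ?g (s + ?n - 1) \<in> X"
      using that lattice_path_step[OF hg(1), of "s + ?n"] unfolding memg by linarith
    have 3: "path_box ?g (box_content b) \<in> X" "fst b \<le> ?g (box_content b)" if "b \<in> X" for b
      using nonempty[OF that refl] memg[of "box_content b"] by auto
    note * = upper_strip_eq_path_strip[OF s(2,1) n0 g1 3(2) 3(1) 1 2]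
    show ?thesis using * by (intro exI[of _ s]) simp
  qed
  have "(\<Sum>\<rho> | \<rho> \<in> lower_strips n X \<and> column_free (X - \<rho>). strip_sign \<rho>) =
      (\<Sum>m | ?low m. (-1) ^ card {y \<in> ?M. m < y \<and> y < m + ?n})"
  proof -
    let ?p = "\<lambda>m. path_strip h (m + 1) ?n"
    have "bij_betw ?p {m. ?low m} {\<rho>. \<rho> \<in> lower_strips n X \<and> column_free (X - \<rho>)}"
    proof (rule bij_betwI')
      fix m assume m: "m \<in> {m. ?low m}"
      then have "h (m + 1) = h (m + 1 - 1) - 1" "h (m + 1 + ?n) = h (m + 1 + ?n - 1)"
        using lattice_path_step[OF hg(1), of "m + 1 + ?n"] by (auto simp: descents_def algebra_simps)
      from low[OF this] m show "?p m \<in> {\<rho>. \<rho> \<in> lower_strips n X \<and> column_free (X - \<rho>)}" by simp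
    next
      fix \<rho> assume \<rho>: "\<rho> \<in> {\<rho>. \<rho> \<in> lower_strips n X \<and> column_free (X - \<rho>)}"
      then obtain s where s: "\<rho> = path_strip h s ?n" "h s = h (s - 1) - 1" "h (s + ?n) = h (s + ?n - 1)"
        using low_ex by blast
      then have "?low (s - 1)" using low[OF s(2,3)] \<rho> by simp
      then show "\<exists>m\<in>{m. ?low m}. \<rho> = ?p m" by (intro bexI[of _ "s - 1"]) (simp_all add: s(1))
    next
      fix m m' show "?p m = ?p m' \<longleftrightarrow> m = m'" using inj_path_strip[OF n0, of h "m + 1" "m' + 1"] by auto
    qed
    from sum.reindex_bij_betw[OF this, of strip_sign, symmetric] show ?thesis
      by (simp add: strip_sign_path_strip[OF hg(1)])
  qed
  moreover have "(\<Sum>\<rho> | \<rho> \<in> upper_strips n X \<and> column_free (X - \<rho>). strip_sign \<rho>) =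
      (\<Sum>l | ?upp l. (-1) ^ card {y \<in> ?L. l - ?n < y \<and> y < l})"
  proof -
    let ?p = "\<lambda>l. path_strip ?g (l + 1 - ?n) ?n"
    have "bij_betw ?p {l. ?upp l} {\<rho>. \<rho> \<in> upper_strips n X \<and> column_free (X - \<rho>)}"
    proof (rule bij_betwI')
      fix l assume l: "l \<in> {l. ?upp l}"
      then have "g (l + 1 - ?n) = g (l + 1 - ?n - 1)" "g (l + 1 - ?n + ?n) = g (l + 1 - ?n + ?n - 1) - 1"
        using lattice_path_step[OF hg(2), of "l + 1 - ?n"] by (auto simp: descents_def algebra_simps)
      from upp[OF this] l show "?p l \<in> {\<rho>. \<rho> \<in> upper_strips n X \<and> column_free (X - \<rho>)}" by simp
    next
      fix \<rho> assume \<rho>: "\<rho> \<in> {\<rho>. \<rho> \<in> upper_strips n X \<and> column_free (X - \<rho>)}"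
      then obtain s where s: "\<rho> = path_strip ?g s ?n" "g s = g (s - 1)" "g (s + ?n) = g (s + ?n - 1) - 1"
        using upp_ex by blast
      then have "?upp (s + ?n - 1)" using upp[OF s(2,3)] \<rho> by simp
      then show "\<exists>l\<in>{l. ?upp l}. \<rho> = ?p l" by (intro bexI[of _ "s + ?n - 1"]) (simp_all add: s(1))
    next
      fix l l' show "?p l = ?p l' \<longleftrightarrow> l = l'" using inj_path_strip[OF n0, of ?g "l + 1 - ?n" "l' + 1 - ?n"] by auto
    qed
    moreover have "descents ?g = ?L" by (auto simp: descents_def)
    ultimately show ?thesis
      using sum.reindex_bij_betw[of ?p "{l. ?upp l}" _ strip_sign, symmetric]
      by (simp add: strip_sign_path_strip[OF g1])
  qed
  ultimately show ?thesis
    using interlacing_exchange[of ?L ?M ?n] cL cM card n0 by simp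
qed

section \<open>Removing strips from either end\<close>

lemma Diff_Diff_Un: "A - B - C = A - (B \<union> C)"
  by blast

lemma strip_card: "strip n \<rho> \<Longrightarrow> card \<rho> = n"
  unfolding strip_def by (metis bij_betw_same_card card_atLeastLessThan_int add_diff_cancel_left' nat_int)

lemma finite_upper_strips: "finite S \<Longrightarrow> finite (upper_strips n S)"
  by (rule finite_subset[OF _ finite_upper_in[of S]]) (auto simp: upper_strips_def)

lemma finite_lower_strips: "finite S \<Longrightarrow> finite (lower_strips n S)"
  by (rule finite_subset[OF _ finite_lower_in[of S]]) (auto simp: lower_strips_def)

section \<open>Nested order ideals and filters\<close>

lemma upper_in_Un:
  assumes "upper_in S \<rho>" "upper_in (S - \<rho>) H"
  shows "upper_in S (\<rho> \<union> H)" "upper_in (\<rho> \<union> H) \<rho>" "\<rho> \<inter> H = {}"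
proof -
  show "upper_in S (\<rho> \<union> H)"
    unfolding upper_in_def
  proof (intro conjI ballI impI)
    show "\<rho> \<union> H \<subseteq> S" using assms by (auto simp: upper_in_def)
    fix x y assume "x \<in> \<rho> \<union> H" "y \<in> S" "box_le x y"
    then show "y \<in> \<rho> \<union> H" using upper_inD[OF assms(1), of x y] upper_inD[OF assms(2), of x y] by blast
  qed
  show "upper_in (\<rho> \<union> H) \<rho>"
    unfolding upper_in_def
  proof (intro conjI ballI impI)
    fix x y assume "x \<in> \<rho>" "y \<in> \<rho> \<union> H" "box_le x y"
    then show "y \<in> \<rho>" using upper_inD[OF assms(1), of x y] upper_in_subset[OF assms(2)] by blast
  qed simp
  show "\<rho> \<inter> H = {}" using upper_in_subset[OF assms(2)] by blast
qed

lemma upper_in_upper_in: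
  assumes "upper_in S X" "upper_in X \<rho>"
  shows "upper_in S \<rho>" "upper_in (S - \<rho>) (X - \<rho>)"
proof -
  note sub = upper_in_subset[OF assms(1)] upper_in_subset[OF assms(2)]
  show "upper_in S \<rho>"
    unfolding upper_in_def
  proof (intro conjI ballI impI)
    show "\<rho> \<subseteq> S" using sub by blast
    fix x y assume "x \<in> \<rho>" "y \<in> S" "box_le x y"
    then show "y \<in> \<rho>" using upper_inD[OF assms(1), of x y] upper_inD[OF assms(2), of x y] sub by blast
  qed
  show "upper_in (S - \<rho>) (X - \<rho>)"
    unfolding upper_in_def
  proof (intro conjI ballI impI)
    show "X - \<rho> \<subseteq> S - \<rho>" using sub by blast
    fix x y assume "x \<in> X - \<rho>" "y \<in> S - \<rho>" "box_le x y"
    then show "y \<in> X - \<rho>" using upper_inD[OF assms(1), of x y] by blast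
  qed
qed

lemma upper_in_lower_in:
  assumes "upper_in S X" "lower_in X \<rho>"
  shows "upper_in S (X - \<rho>)" "upper_in (S - (X - \<rho>)) \<rho>"
proof -
  note sub = upper_in_subset[OF assms(1)] lower_in_subset[OF assms(2)]
  show "upper_in S (X - \<rho>)"
    unfolding upper_in_def
  proof (intro conjI ballI impI)
    show "X - \<rho> \<subseteq> S" using sub by blast
    fix x y assume "x \<in> X - \<rho>" "y \<in> S" "box_le x y"
    then show "y \<in> X - \<rho>" using upper_inD[OF assms(1), of x y] lower_inD[OF assms(2), of y x] sub by blast
  qed
  show "upper_in (S - (X - \<rho>)) \<rho>"
    unfolding upper_in_def
  proof (intro conjI ballI impI)
    show "\<rho> \<subseteq> S - (X - \<rho>)" using sub by blast
    fix x y assume "x \<in> \<rho>" "y \<in> S - (X - \<rho>)" "box_le x y"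
    then show "y \<in> \<rho>" using upper_inD[OF assms(1), of x y] sub by blast
  qed
qed

lemma upper_in_Un_lower_in:
  assumes "upper_in S H" "upper_in (S - H) \<rho>"
  shows "upper_in S (H \<union> \<rho>)" "lower_in (H \<union> \<rho>) \<rho>"
proof -
  show "upper_in S (H \<union> \<rho>)" by (rule upper_in_Un(1)[OF assms])
  show "lower_in (H \<union> \<rho>) \<rho>"
    unfolding lower_in_def
  proof (intro conjI ballI impI)
    fix x y assume "x \<in> \<rho>" "y \<in> H \<union> \<rho>" "box_le y x"
    then show "y \<in> \<rho>"
      using upper_inD[OF assms(1), of y x] upper_in_subset[OF assms(2)] by blast
  qed simp
qed

text \<open>Disjoint pieces at opposite ends do not obstruct each other, so either may be removed
  before the other.\<close>

lemma lower_upper_swap: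
  "upper_in S H \<and> lower_in (S - H) \<rho> \<longleftrightarrow> lower_in S \<rho> \<and> upper_in (S - \<rho>) H"
proof
  assume a: "upper_in S H \<and> lower_in (S - H) \<rho>"
  then have u: "upper_in S H" and l: "lower_in (S - H) \<rho>" by auto
  note sub = upper_in_subset[OF u] lower_in_subset[OF l]
  show "lower_in S \<rho> \<and> upper_in (S - \<rho>) H"
    unfolding lower_in_def upper_in_def
  proof (intro conjI ballI impI)
    show "\<rho> \<subseteq> S" "H \<subseteq> S - \<rho>" using sub by blast+
  next
    fix x y assume "x \<in> \<rho>" "y \<in> S" "box_le y x"
    then show "y \<in> \<rho>" using lower_inD[OF l, of x y] upper_inD[OF u, of y x] sub by blast
  next
    fix x y assume "x \<in> H" "y \<in> S - \<rho>" "box_le x y"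
    then show "y \<in> H" using upper_inD[OF u, of x y] by blast
  qed
next
  assume a: "lower_in S \<rho> \<and> upper_in (S - \<rho>) H"
  then have u: "upper_in (S - \<rho>) H" and l: "lower_in S \<rho>" by auto
  note sub = upper_in_subset[OF u] lower_in_subset[OF l]
  show "upper_in S H \<and> lower_in (S - H) \<rho>"
    unfolding lower_in_def upper_in_def
  proof (intro conjI ballI impI)
    show "H \<subseteq> S" "\<rho> \<subseteq> S - H" using sub by blast+
  next
    fix x y assume "x \<in> \<rho>" "y \<in> S - H" "box_le y x"
    then show "y \<in> \<rho>" using lower_inD[OF l, of x y] by blast
  next
    fix x y assume "x \<in> H" "y \<in> S" "box_le x y"
    then show "y \<in> H" using upper_inD[OF u, of x y] lower_inD[OF l, of y x] sub by blast
  qed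
qed

text \<open>The two sides are the two ways of applying the adjoint of multiplication by the power sum
  \<open>p\<^sub>n\<close> to a skew Schur function.\<close>

theorem skew_schur_strip_removal:
  assumes "finite S" "convex_boxes S" and n: "n > 0"
  shows "(\<Sum>\<rho>\<in>upper_strips n S. strip_sign \<rho> * int (skew_schur (S - \<rho>) e)) =
         (\<Sum>\<rho>\<in>lower_strips n S. strip_sign \<rho> * int (skew_schur (S - \<rho>) e))"
proof (cases "\<exists>M. \<forall>i>M. e i = 0")
  case False
  then show ?thesis using assms(1) by (simp add: skew_schur_infinite_support)
next
  case True
  then obtain M where "\<forall>i>M. e i = 0" by blast
  then show ?thesis using assms(1,2)
  proof (induction M arbitrary: S e)
    case 0
    let ?f = "\<lambda>\<rho>. strip_sign \<rho> * int (skew_schur (S - \<rho>) e)"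
    \<comment> \<open>Without letters a remainder contributes only if it is empty. Both sums thus
      reduce to the strip \<open>S\<close> itself, which is lower and upper at once.\<close>
    have f: "?f \<rho> = (if \<rho> = S then strip_sign S * of_bool (e = (\<lambda>_. 0)) else 0)" if "\<rho> \<subseteq> S" for \<rho>
    proof -
      have "skew_schur (S - \<rho>) e = of_bool (S - \<rho> = {} \<and> e = (\<lambda>_. 0))"
        by (rule skew_schur_no_letters) (use 0 in auto)
      moreover have "S - \<rho> = {} \<longleftrightarrow> \<rho> = S" using that by blast
      ultimately show ?thesis by simp
    qed
    have "sum ?f (upper_strips n S) = (\<Sum>\<rho>\<in>upper_strips n S. if \<rho> = S then strip_sign S * of_bool (e = (\<lambda>_. 0)) else 0)"
      by (rule sum.cong[OF refl f]) (simp add: upper_strips_def upper_in_def)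
    also have "\<dots> = (if strip n S then strip_sign S * of_bool (e = (\<lambda>_. 0)) else 0)"
      using finite_upper_strips[OF 0(2)] by (subst sum.delta) (auto simp: upper_strips_def upper_in_def)
    also have "\<dots> = (\<Sum>\<rho>\<in>lower_strips n S. if \<rho> = S then strip_sign S * of_bool (e = (\<lambda>_. 0)) else 0)"
      using finite_lower_strips[OF 0(2)] by (subst sum.delta) (auto simp: lower_strips_def lower_in_def)
    also have "\<dots> = sum ?f (lower_strips n S)"
      by (rule sum.cong[OF refl f[symmetric]]) (simp add: lower_strips_def lower_in_def)
    finally show ?case .
  next
    case (Suc M)
    let ?k = "e (Suc M)" and ?e = "e(Suc M := 0)"
    let ?HS = "horizontal_strips ?k"
    let ?s = "\<lambda>S. int (skew_schur S ?e)"
    have e: "\<forall>i>M. ?e i = 0" and big: "\<And>i. i > Suc M \<Longrightarrow> e i = 0" using Suc.prems(1) by auto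
    have fin: "finite X" if "X \<subseteq> S" for X using that Suc.prems(2) finite_subset by blast
    have rec: "int (skew_schur (S - \<rho>) e) = (\<Sum>H\<in>?HS (S - \<rho>). ?s (S - \<rho> - H))"
      if "convex_boxes (S - \<rho>)" for \<rho>
      using skew_schur_recursion[of "S - \<rho>" "Suc M" e, OF finite_Diff[OF Suc.prems(2)] that] big by simp
    \<comment> \<open>\<open>X\<close> is the union of the strip and the boxes that carry the letter
      \<open>Suc M\<close>. For fixed \<open>X\<close> the factor for \<open>S - X\<close> is
      common, and what is left is \<open>strip_exchange\<close> inside \<open>X\<close>.\<close>
    define XS where "XS = {X. upper_in S X \<and> card X = n + ?k}"
    have finXS: "finite XS"
      unfolding XS_def by (rule finite_subset[OF _ finite_upper_in[OF Suc.prems(2)]]) auto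
    have subU: "upper_in S X \<Longrightarrow> X \<subseteq> S" and subL: "lower_in S X \<Longrightarrow> X \<subseteq> S" for X
      by (simp_all add: upper_in_def lower_in_def)
    have subH: "H \<in> ?HS S \<Longrightarrow> H \<subseteq> S" for H by (simp add: horizontal_strips_def upper_in_def)
    have finX: "X \<in> XS \<Longrightarrow> finite X" for X using subU fin by (simp add: XS_def)
    have convX: "X \<in> XS \<Longrightarrow> convex_boxes X" for X
      using convex_upper_in(1)[OF Suc.prems(3)] by (simp add: XS_def)
    have finUX: "finite {\<rho>. \<rho> \<in> upper_strips n X \<and> column_free (X - \<rho>)}"
      and finLX: "finite {\<rho>. \<rho> \<in> lower_strips n X \<and> column_free (X - \<rho>)}" if "X \<in> XS" for X
      using finite_upper_strips[OF finX[OF that]] finite_lower_strips[OF finX[OF that]] by simp_all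
    have "(\<Sum>\<rho>\<in>upper_strips n S. strip_sign \<rho> * int (skew_schur (S - \<rho>) e)) =
        (\<Sum>\<rho>\<in>upper_strips n S. \<Sum>H\<in>?HS (S - \<rho>). strip_sign \<rho> * ?s (S - \<rho> - H))"
    proof (rule sum.cong[OF refl])
      fix \<rho> assume "\<rho> \<in> upper_strips n S"
      then have "convex_boxes (S - \<rho>)" using convex_upper_in(2)[OF Suc.prems(3)] by (simp add: upper_strips_def)
      then show "strip_sign \<rho> * int (skew_schur (S - \<rho>) e) = (\<Sum>H\<in>?HS (S - \<rho>). strip_sign \<rho> * ?s (S - \<rho> - H))"
        by (simp add: rec sum_distrib_left)
    qed
    also have "\<dots> = (\<Sum>(\<rho>, H)\<in>(SIGMA \<rho>:upper_strips n S. ?HS (S - \<rho>)). strip_sign \<rho> * ?s (S - \<rho> - H))"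
      using finite_upper_strips finite_horizontal_strips Suc.prems(2) by (subst sum.Sigma) auto
    also have "\<dots> = (\<Sum>(X, \<rho>)\<in>(SIGMA X:XS. {\<rho>. \<rho> \<in> upper_strips n X \<and> column_free (X - \<rho>)}). strip_sign \<rho> * ?s (S - X))"
    proof (rule sum.reindex_bij_witness[where j = "\<lambda>(\<rho>, H). (\<rho> \<union> H, \<rho>)" and i = "\<lambda>(X, \<rho>). (\<rho>, X - \<rho>)"])
      fix p assume "p \<in> (SIGMA \<rho>:upper_strips n S. ?HS (S - \<rho>))"
      then obtain \<rho> H where p: "p = (\<rho>, H)" "\<rho> \<in> upper_strips n S" "H \<in> ?HS (S - \<rho>)" by blast
      then have u: "upper_in S \<rho>" "upper_in (S - \<rho>) H" and o: "strip n \<rho>" "column_free H" "card H = ?k"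
        by (auto simp: upper_strips_def horizontal_strips_def)
      note * = upper_in_Un[OF u]
      have d: "\<rho> \<union> H - \<rho> = H" using *(3) by blast
      show "(\<lambda>(X, \<rho>). (\<rho>, X - \<rho>)) ((\<lambda>(\<rho>, H). (\<rho> \<union> H, \<rho>)) p) = p" using d p(1) by simp
      have "card (\<rho> \<union> H) = n + ?k"
        using card_Un_disjoint[OF fin fin *(3)] u o(3) strip_card[OF o(1)] subU by (auto simp: upper_in_def)
      then show "(\<lambda>(\<rho>, H). (\<rho> \<union> H, \<rho>)) p \<in> (SIGMA X:XS. {\<rho>. \<rho> \<in> upper_strips n X \<and> column_free (X - \<rho>)})"
        using * o d p(1) by (simp add: XS_def upper_strips_def)
      show "(case (\<lambda>(\<rho>, H). (\<rho> \<union> H, \<rho>)) p of (X, \<rho>) \<Rightarrow> strip_sign \<rho> * ?s (S - X)) =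
          (case p of (\<rho>, H) \<Rightarrow> strip_sign \<rho> * ?s (S - \<rho> - H))"
        by (simp add: Diff_Diff_Un p(1))
    next
      fix p assume "p \<in> (SIGMA X:XS. {\<rho>. \<rho> \<in> upper_strips n X \<and> column_free (X - \<rho>)})"
      then obtain X \<rho> where p: "p = (X, \<rho>)" "X \<in> XS" "\<rho> \<in> upper_strips n X" "column_free (X - \<rho>)" by blast
      then have X: "upper_in S X" "card X = n + ?k" and \<rho>: "upper_in X \<rho>" "strip n \<rho>" and cf: "column_free (X - \<rho>)"
        by (auto simp: upper_strips_def XS_def)
      have sub: "\<rho> \<subseteq> X" using \<rho>(1) by (rule upper_in_subset)
      show "(\<lambda>(\<rho>, H). (\<rho> \<union> H, \<rho>)) ((\<lambda>(X, \<rho>). (\<rho>, X - \<rho>)) p) = p" using sub p(1) by auto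
      have "finite \<rho>" using sub fin subU[OF X(1)] by blast
      then have "card (X - \<rho>) = ?k" using card_Diff_subset[OF _ sub] X(2) strip_card[OF \<rho>(2)] by simp
      then show "(\<lambda>(X, \<rho>). (\<rho>, X - \<rho>)) p \<in> (SIGMA \<rho>:upper_strips n S. ?HS (S - \<rho>))"
        using p(1) upper_in_upper_in[OF X(1) \<rho>(1)] \<rho>(2) cf by (simp add: upper_strips_def horizontal_strips_def)
    qed
    also have "\<dots> = (\<Sum>X\<in>XS. ?s (S - X) * (\<Sum>\<rho> | \<rho> \<in> upper_strips n X \<and> column_free (X - \<rho>). strip_sign \<rho>))"
      using finXS finUX by (subst sum.Sigma[symmetric]) (auto simp: sum_distrib_left mult.commute)
    also have "\<dots> = (\<Sum>X\<in>XS. ?s (S - X) * (\<Sum>\<rho> | \<rho> \<in> lower_strips n X \<and> column_free (X - \<rho>). strip_sign \<rho>))"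
      by (rule sum.cong[OF refl]) (simp add: strip_exchange[OF finX convX n])
    also have "\<dots> = (\<Sum>(X, \<rho>)\<in>(SIGMA X:XS. {\<rho>. \<rho> \<in> lower_strips n X \<and> column_free (X - \<rho>)}). strip_sign \<rho> * ?s (S - X))"
      using finXS finLX by (subst sum.Sigma[symmetric]) (auto simp: sum_distrib_left mult.commute)
    \<comment> \<open>After the exchange \<rho> sits at the inner end of \<open>X\<close>, so
      \<open>H = X - \<rho>\<close> is a horizontal strip of \<open>S\<close> itself and \<rho> an
      upper strip of \<open>S - H\<close>: the two removals have changed their order.\<close>
    also have "\<dots> = (\<Sum>(H, \<rho>)\<in>(SIGMA H:?HS S. upper_strips n (S - H)). strip_sign \<rho> * ?s (S - H - \<rho>))"
    proof (rule sum.reindex_bij_witness[where i = "\<lambda>(H, \<rho>). (H \<union> \<rho>, \<rho>)" and j = "\<lambda>(X, \<rho>). (X - \<rho>, \<rho>)"])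
      fix p assume "p \<in> (SIGMA H:?HS S. upper_strips n (S - H))"
      then obtain H \<rho> where p: "p = (H, \<rho>)" "H \<in> ?HS S" "\<rho> \<in> upper_strips n (S - H)" by blast
      then have u: "upper_in S H" "upper_in (S - H) \<rho>" and o: "strip n \<rho>" "column_free H" "card H = ?k"
        by (auto simp: upper_strips_def horizontal_strips_def)
      note * = upper_in_Un_lower_in[OF u]
      have rs: "\<rho> \<subseteq> S" using upper_in_subset[OF u(2)] by blast
      have dis: "H \<inter> \<rho> = {}" using upper_in_subset[OF u(2)] by blast
      then have d: "H \<union> \<rho> - \<rho> = H" by blast
      show "(\<lambda>(X, \<rho>). (X - \<rho>, \<rho>)) ((\<lambda>(H, \<rho>). (H \<union> \<rho>, \<rho>)) p) = p" using d p(1) by simp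
      have "card (H \<union> \<rho>) = n + ?k"
        using card_Un_disjoint[OF fin[OF subU[OF u(1)]] fin[OF rs] dis] o(3) strip_card[OF o(1)] by simp
      then show "(\<lambda>(H, \<rho>). (H \<union> \<rho>, \<rho>)) p \<in> (SIGMA X:XS. {\<rho>. \<rho> \<in> lower_strips n X \<and> column_free (X - \<rho>)})"
        using * o d p(1) by (simp add: XS_def lower_strips_def)
    next
      fix p assume "p \<in> (SIGMA X:XS. {\<rho>. \<rho> \<in> lower_strips n X \<and> column_free (X - \<rho>)})"
      then obtain X \<rho> where p: "p = (X, \<rho>)" "X \<in> XS" "\<rho> \<in> lower_strips n X" "column_free (X - \<rho>)" by blast
      then have X: "upper_in S X" "card X = n + ?k" and \<rho>: "lower_in X \<rho>" "strip n \<rho>" and cf: "column_free (X - \<rho>)"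
        by (auto simp: lower_strips_def XS_def)
      have sub: "\<rho> \<subseteq> X" using \<rho>(1) by (rule lower_in_subset)
      show "(\<lambda>(H, \<rho>). (H \<union> \<rho>, \<rho>)) ((\<lambda>(X, \<rho>). (X - \<rho>, \<rho>)) p) = p" using sub p(1) by auto
      have "finite \<rho>" using sub fin subU[OF X(1)] by blast
      then have "card (X - \<rho>) = ?k" using card_Diff_subset[OF _ sub] X(2) strip_card[OF \<rho>(2)] by simp
      then show "(\<lambda>(X, \<rho>). (X - \<rho>, \<rho>)) p \<in> (SIGMA H:?HS S. upper_strips n (S - H))"
        using p(1) upper_in_lower_in[OF X(1) \<rho>(1)] \<rho>(2) cf by (simp add: upper_strips_def horizontal_strips_def)
      have "S - (X - \<rho>) - \<rho> = S - X" using sub by blast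
      then show "(case (\<lambda>(X, \<rho>). (X - \<rho>, \<rho>)) p of (H, \<rho>) \<Rightarrow> strip_sign \<rho> * ?s (S - H - \<rho>)) =
          (case p of (X, \<rho>) \<Rightarrow> strip_sign \<rho> * ?s (S - X))"
        using p(1) by simp
    qed
    also have "\<dots> = (\<Sum>H\<in>?HS S. \<Sum>\<rho>\<in>upper_strips n (S - H). strip_sign \<rho> * ?s (S - H - \<rho>))"
      using finite_upper_strips finite_horizontal_strips Suc.prems(2) by (subst sum.Sigma) auto
    \<comment> \<open>The letter \<open>Suc M\<close> is used up, so the induction hypothesis
      applies to \<open>S - H\<close> and carries the strip from the lower right to the upper left
      end.\<close>
    also have "\<dots> = (\<Sum>H\<in>?HS S. \<Sum>\<rho>\<in>lower_strips n (S - H). strip_sign \<rho> * ?s (S - H - \<rho>))"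
    proof (rule sum.cong[OF refl])
      fix H assume "H \<in> ?HS S"
      then have "convex_boxes (S - H)" using convex_upper_in(2)[OF Suc.prems(3)] by (simp add: horizontal_strips_def)
      then show "(\<Sum>\<rho>\<in>upper_strips n (S - H). strip_sign \<rho> * ?s (S - H - \<rho>)) =
          (\<Sum>\<rho>\<in>lower_strips n (S - H). strip_sign \<rho> * ?s (S - H - \<rho>))"
        by (rule Suc.IH[OF e finite_Diff[OF Suc.prems(2)]])
    qed
    also have "\<dots> = (\<Sum>(H, \<rho>)\<in>(SIGMA H:?HS S. lower_strips n (S - H)). strip_sign \<rho> * ?s (S - H - \<rho>))"
      using finite_lower_strips finite_horizontal_strips Suc.prems(2) by (subst sum.Sigma) auto
    also have "\<dots> = (\<Sum>(\<rho>, H)\<in>(SIGMA \<rho>:lower_strips n S. ?HS (S - \<rho>)). strip_sign \<rho> * ?s (S - \<rho> - H))"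
    proof (rule sum.reindex_bij_witness[where i = "\<lambda>(\<rho>, H). (H, \<rho>)" and j = "\<lambda>(H, \<rho>). (\<rho>, H)"])
    qed (use lower_upper_swap in \<open>auto simp: lower_strips_def horizontal_strips_def Diff_Diff_Un Un_commute\<close>)
    also have "\<dots> = (\<Sum>\<rho>\<in>lower_strips n S. \<Sum>H\<in>?HS (S - \<rho>). strip_sign \<rho> * ?s (S - \<rho> - H))"
      using finite_lower_strips finite_horizontal_strips Suc.prems(2) by (subst sum.Sigma) auto
    also have "\<dots> = (\<Sum>\<rho>\<in>lower_strips n S. strip_sign \<rho> * int (skew_schur (S - \<rho>) e))"
    proof (rule sum.cong[OF refl])
      fix \<rho> assume "\<rho> \<in> lower_strips n S"
      then have "convex_boxes (S - \<rho>)" using convex_lower_in(2)[OF Suc.prems(3)] by (simp add: lower_strips_def)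
      then show "(\<Sum>H\<in>?HS (S - \<rho>). strip_sign \<rho> * ?s (S - \<rho> - H)) = strip_sign \<rho> * int (skew_schur (S - \<rho>) e)"
        by (simp add: rec sum_distrib_left)
    qed
    finally show ?case .
  qed
qed

text \<open>Each sum has a single term, a sign times a count; taking absolute values discards the
  signs.\<close>

lemma unique_strips_schur_equiv:
  assumes S: "finite S" "convex_boxes S" and n: "n > 0"
    and low: "lower_strips n S = {\<rho>}" and upp: "upper_strips n S = {\<sigma>}"
  shows "skew_schur (S - \<sigma>) = skew_schur (S - \<rho>)"
proof
  fix e
  have "strip_sign \<sigma> * int (skew_schur (S - \<sigma>) e) = strip_sign \<rho> * int (skew_schur (S - \<rho>) e)"
    using skew_schur_strip_removal[OF S n, of e] unfolding low upp by simp
  then have "\<bar>strip_sign \<sigma> * int (skew_schur (S - \<sigma>) e)\<bar> = \<bar>strip_sign \<rho> * int (skew_schur (S - \<rho>) e)\<bar>"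
    by simp
  moreover have "\<bar>strip_sign \<tau>\<bar> = 1" for \<tau> by (simp add: strip_sign_def power_abs)
  ultimately show "skew_schur (S - \<sigma>) e = skew_schur (S - \<rho>) e" by (simp add: abs_mult)
qed

section \<open>Rectangular arrays of overlapping bands\<close>

text \<open>A step east in the rectangle moves a copy by \<open>(\<delta>, \<delta> + n)\<close>, a
  step south by the negative of this plus \<open>(1, 1)\<close>. So contents depend on
  \<open>j - i\<close> alone, and the rows get the additional \<open>i\<close>.\<close>

definition copies :: "(int \<Rightarrow> int) \<Rightarrow> (int \<Rightarrow> int) \<Rightarrow> int \<Rightarrow> int \<Rightarrow> int \<Rightarrow> (int \<times> int) set \<Rightarrow> box set" where
  "copies h g n w \<delta> Q = {p. \<exists>(i, j) \<in> Q. 0 \<le> box_content p - (j - i) * n \<and> box_content p - (j - i) * n < n + w \<and>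
     h (box_content p - (j - i) * n) + (j - i) * \<delta> + i \<le> fst p \<and>
     fst p < g (box_content p - (j - i) * n) + (j - i) * \<delta> + i}"

text \<open>The boundary data of a \<open>W \<rightarrow> O \<rightarrow> W\<close> shape:
  \<open>w\<close> is the number of diagonals of \<open>W\<close>, \<open>n\<close> and \<delta> are
  the content and the row of the displacement between its copies, and \<open>n + t\<close> is the
  first content beyond \<open>O\<close>. On the overlap with the next copy the band starts strictly
  higher before \<open>n + t\<close> and in the same row from there on
  (\<open>overlap_above\<close>, \<open>overlap_eq\<close>). The rotated band is of the same form
  with its own \<open>t\<close>, so one analysis serves both ends of the array.\<close>

locale corner_band =
  fixes h g :: "int \<Rightarrow> int" and n w t \<delta> a b :: int
  assumes path_h: "lattice_path h"
    and before: "\<And>x. x \<le> 0 \<Longrightarrow> h x = h 0 - x"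
    and after: "\<And>x. n + w - 1 \<le> x \<Longrightarrow> h x = h (n + w - 1)"
    and nonempty: "\<And>x. 0 \<le> x \<Longrightarrow> x < n + w \<Longrightarrow> h x < g x"
    and single: "g 0 = h 0 + 1" "g (n + w - 1) = h (n + w - 1) + 1"
    and bounds: "0 \<le> t" "t < w" "w < n"
    and overlap_above: "\<And>x. n \<le> x \<Longrightarrow> x < n + t \<Longrightarrow> h x < h (x - n) + \<delta>"
    and overlap_eq: "\<And>x. n + t \<le> x \<Longrightarrow> x < n + w \<Longrightarrow> h x = h (x - n) + \<delta>"
    and step_out: "h (n + t) = h (n + t - 1)"
    and step_in: "h w = h (w - 1)"
    and overlap_nonempty: "\<And>x. 0 \<le> x \<Longrightarrow> x < w \<Longrightarrow> h x + \<delta> < g (x + n)"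
    and no_loose_end: "\<And>s. 0 \<le> s \<Longrightarrow> s < t \<Longrightarrow> h s = h (s - 1) - 1 \<Longrightarrow> h (s + n) = h (s + n - 1) \<Longrightarrow> False"
    and ab: "2 \<le> a" "2 \<le> b"
begin

definition rect :: "(int \<times> int) set" where "rect = {0..<a} \<times> {0..<b}"

abbreviation C :: "box set" where "C \<equiv> copies h g n w \<delta> rect"

definition lo :: int where "lo = (1 - a) * n"
definition hi :: int where "hi = (b - 1) * n + n + w - 1"

lemma n_pos: "0 < n" using bounds by linarith

lemma overlap_le: "0 \<le> x \<Longrightarrow> x < w \<Longrightarrow> h (x + n) \<le> h x + \<delta>"
  using overlap_above[of "x + n"] overlap_eq[of "x + n"] by (cases "x < t") auto

text \<open>The copies of the band on the diagonal \<open>j - i = q\<close> of the rectangle are stacked on the same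
  contents; on content \<open>x\<close> the topmost one of them starts in row \<open>top_row q x\<close>.\<close>

definition top_row :: "int \<Rightarrow> int \<Rightarrow> int" where
  "top_row q x = h (x - q * n) + q * \<delta> + max 0 (- q)"

definition bottom_row :: "int \<Rightarrow> int \<Rightarrow> int" where
  "bottom_row q x = g (x - q * n) + q * \<delta> + min (a - 1) (b - 1 - q)"

definition meets :: "int \<Rightarrow> int \<Rightarrow> bool" where
  "meets q x \<longleftrightarrow> 1 - a \<le> q \<and> q \<le> b - 1 \<and> 0 \<le> x - q * n \<and> x - q * n < n + w"

lemma mem_copies: "p \<in> copies h g n w \<delta> Q \<longleftrightarrow> (\<exists>i j. (i, j) \<in> Q \<and>
    0 \<le> box_content p - (j - i) * n \<and> box_content p - (j - i) * n < n + w \<and>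
    h (box_content p - (j - i) * n) + (j - i) * \<delta> + i \<le> fst p \<and>
    fst p < g (box_content p - (j - i) * n) + (j - i) * \<delta> + i)"
  unfolding copies_def by blast

lemma mem_copiesI:
  assumes "(i, j) \<in> Q" "q = j - i" "0 \<le> box_content p - q * n" "box_content p - q * n < n + w"
    "h (box_content p - q * n) + q * \<delta> + i \<le> fst p"
    "fst p < g (box_content p - q * n) + q * \<delta> + i"
  shows "p \<in> copies h g n w \<delta> Q"
  unfolding mem_copies using assms by blast

lemma mem_C: "p \<in> C \<longleftrightarrow> (\<exists>q. meets q (box_content p) \<and> top_row q (box_content p) \<le> fst p \<and> fst p < bottom_row q (box_content p))"
proof
  assume "p \<in> C"
  then obtain i j where "0 \<le> i" "i < a" "0 \<le> j" "j < b"
    "0 \<le> box_content p - (j - i) * n" "box_content p - (j - i) * n < n + w"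
    "h (box_content p - (j - i) * n) + (j - i) * \<delta> + i \<le> fst p"
    "fst p < g (box_content p - (j - i) * n) + (j - i) * \<delta> + i"
    unfolding mem_copies rect_def by auto
  then show "\<exists>q. meets q (box_content p) \<and> top_row q (box_content p) \<le> fst p \<and> fst p < bottom_row q (box_content p)"
    by (intro exI[of _ "j - i"]) (auto simp: meets_def top_row_def bottom_row_def)
next
  assume "\<exists>q. meets q (box_content p) \<and> top_row q (box_content p) \<le> fst p \<and> fst p < bottom_row q (box_content p)"
  then obtain q where q: "meets q (box_content p)" "top_row q (box_content p) \<le> fst p" "fst p < bottom_row q (box_content p)"
    by blast
  define z where "z = box_content p - q * n"
  have z: "0 \<le> z" "z < n + w" using q(1) by (auto simp: meets_def z_def)
  \<comment> \<open>The lowest copy of the stack that does not start below \<open>p\<close> on this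
    diagonal. Each copy is the previous one moved by \<open>(1, 1)\<close>, so the row ranges of a
    stack have no gaps.\<close>
  define i where "i = min (fst p - h z - q * \<delta>) (min (a - 1) (b - 1 - q))"
  have m: "max 0 (- q) \<le> min (a - 1) (b - 1 - q)" using q(1) ab by (auto simp: meets_def)
  have "max 0 (- q) \<le> fst p - h z - q * \<delta>" using q(2) unfolding top_row_def z_def[symmetric] by linarith
  then have i1: "max 0 (- q) \<le> i" using m by (simp add: i_def)
  have i2: "i \<le> min (a - 1) (b - 1 - q)" and i3: "i \<le> fst p - h z - q * \<delta>"
    unfolding i_def by linarith+
  have i4: "fst p < g z + q * \<delta> + i"
    using q(3) nonempty[OF z] unfolding i_def bottom_row_def z_def[symmetric] by (auto simp: min_def)
  show "p \<in> C"
    by (rule mem_copiesI[of i "q + i" _ q]) (use i1 i2 i3 i4 z in \<open>auto simp: rect_def z_def\<close>)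
qed

text \<open>Band \<open>q\<close> forms the upper left boundary from the content behind the
  \<open>O\<close> of band \<open>q - 1\<close> up to the last content of its own \<open>O\<close>.
  The two outermost bands carry the rest of the line, so that every content has a carrier.\<close>

definition carries :: "int \<Rightarrow> int \<Rightarrow> bool" where
  "carries q x \<longleftrightarrow> 1 - a \<le> q \<and> q \<le> b - 1 \<and> (q \<noteq> 1 - a \<longrightarrow> t \<le> x - q * n) \<and> (q \<noteq> b - 1 \<longrightarrow> x - q * n < n + t)"

lemma mult_n_mono: "q < q' \<Longrightarrow> q * n + n \<le> q' * n"
proof -
  assume "q < q'"
  then have "(q + 1) * n \<le> q' * n" using n_pos by (intro mult_right_mono) auto
  then show ?thesis by (simp add: algebra_simps)
qed

lemma carries_unique: "carries q x \<Longrightarrow> carries q' x \<Longrightarrow> q = q'"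
proof -
  have "\<not> q < q'" if "carries q x" "carries q' x" for q q'
  proof
    assume "q < q'"
    moreover have "x - q * n < n + t" "t \<le> x - q' * n" using that \<open>q < q'\<close> by (auto simp: carries_def)
    ultimately show False using mult_n_mono[of q q'] by linarith
  qed
  then show "carries q x \<Longrightarrow> carries q' x \<Longrightarrow> q = q'" by (meson linorder_cases)
qed

text \<open>The bounds in \<open>carries\<close> solved for \<open>q\<close>: a quotient, cut off at
  the first and the last diagonal of the rectangle.\<close>

definition carrier_of :: "int \<Rightarrow> int" where
  "carrier_of x = max (1 - a) (min (b - 1) ((x - t) div n))"

lemma carries_carrier_of: "carries (carrier_of x) x"
proof -
  let ?d = "(x - t) div n"
  have d: "?d * n \<le> x - t" "x - t < ?d * n + n"
    using n_pos pos_mod_sign[of n "x - t"] pos_mod_bound[of n "x - t"] div_mult_mod_eq[of "x - t" n] by linarith+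
  have "t \<le> x - carrier_of x * n" if "carrier_of x \<noteq> 1 - a"
  proof -
    have "carrier_of x \<le> ?d" using that by (auto simp: carrier_of_def)
    then have "carrier_of x * n \<le> ?d * n" using n_pos by (intro mult_right_mono) auto
    then show ?thesis using d by linarith
  qed
  moreover have "x - carrier_of x * n < n + t" if "carrier_of x \<noteq> b - 1"
  proof -
    have "?d \<le> carrier_of x" using that ab by (auto simp: carrier_of_def)
    then have "?d * n \<le> carrier_of x * n" using n_pos by (intro mult_right_mono) auto
    then show ?thesis using d by linarith
  qed
  ultimately show ?thesis using ab by (auto simp: carries_def carrier_of_def)
qed

definition H :: "int \<Rightarrow> int" where "H x = top_row (carrier_of x) x"

lemma H_eq: "carries q x \<Longrightarrow> H x = top_row q x"
  using carries_unique[OF carries_carrier_of] by (simp add: H_def)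

lemma carries_prev:
  assumes "carries q x"
  shows "carries q (x - 1) \<or> (q \<noteq> 1 - a \<and> x = q * n + t \<and> carries (q - 1) (x - 1))"
proof (cases "q = 1 - a \<or> t \<le> x - 1 - q * n")
  case True
  then show ?thesis using assms by (auto simp: carries_def)
next
  case False
  then have "x = q * n + t" using assms by (auto simp: carries_def)
  then show ?thesis using False assms bounds by (auto simp: carries_def left_diff_distrib)
qed

text \<open>Inside a band the steps are those of \<open>h\<close>. At a change of carrier
  \<open>step_out\<close> contributes a step right, but the index \<open>max 0 (- q)\<close> of the
  topmost copy drops by one as long as \<open>q \<le> 0\<close>. So the changing step goes up along
  the first column of copies and right along the first row; this is the only difference between the
  periods.\<close>

lemma H_step:
  assumes "carries q x"
  shows "carries q (x - 1) \<and> H x - H (x - 1) = h (x - q * n) - h (x - q * n - 1) \<or>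
    q \<noteq> 1 - a \<and> x = q * n + t \<and> H x - H (x - 1) = (if q \<le> 0 then - 1 else 0)"
proof -
  from carries_prev[OF assms] show ?thesis
  proof
    assume c: "carries q (x - 1)"
    have "x - 1 - q * n = x - q * n - 1" by simp
    then have "H (x - 1) = h (x - q * n - 1) + q * \<delta> + max 0 (- q)"
      using H_eq[OF c] by (simp only: top_row_def)
    moreover have "H x = h (x - q * n) + q * \<delta> + max 0 (- q)"
      using H_eq[OF assms] by (simp only: top_row_def)
    ultimately show ?thesis using c by linarith
  next
    assume c: "q \<noteq> 1 - a \<and> x = q * n + t \<and> carries (q - 1) (x - 1)"
    then have x: "x - q * n = t" "x - 1 - (q - 1) * n = n + t - 1" by (auto simp: left_diff_distrib)
    have "H x = h t + q * \<delta> + max 0 (- q)" using H_eq[OF assms] unfolding top_row_def x(1) .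
    moreover have "H (x - 1) = h (n + t - 1) + (q - 1) * \<delta> + max 0 (1 - q)"
      using H_eq[OF c[THEN conjunct2, THEN conjunct2]] unfolding top_row_def x(2) by simp
    moreover have "h (n + t) = h t + \<delta>" using overlap_eq[of "n + t"] bounds by simp
    ultimately have "H x - H (x - 1) = (if q \<le> 0 then - 1 else 0)"
      using step_out by (simp add: left_diff_distrib)
    then show ?thesis using c by blast
  qed
qed

lemma lattice_path_H: "lattice_path H"
  unfolding lattice_path_def
proof
  fix x
  have "H (x + 1) - H x = 0 \<or> H (x + 1) - H x = - 1"
    using H_step[OF carries_carrier_of[of "x + 1"]]
      lattice_path_step[OF path_h, of "x + 1 - carrier_of (x + 1) * n"] by (auto split: if_splits)
  then show "H (x + 1) = H x \<or> H (x + 1) = H x - 1" by auto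
qed

text \<open>As \<open>w < n\<close>, only neighbouring bands share a diagonal. Before relative
  content \<open>n + t\<close> the earlier band is strictly higher; after it the first rows of the
  bands agree and the later band has the smaller topmost index.\<close>

lemma top_row_min:
  assumes c: "carries q x" and m: "meets q' x"
  shows "top_row q x \<le> top_row q' x"
proof -
  define z where "z = x - q * n"
  consider "q = q'" | "q < q'" | "q' < q" by linarith
  then show ?thesis
  proof cases
    case 2
    then have z: "z < n + t" using c m by (auto simp: carries_def meets_def z_def)
    have "q' = q + 1"
    proof (rule ccontr)
      assume "q' \<noteq> q + 1"
      then have "(q + 1) * n + n \<le> q' * n" using 2 by (intro mult_n_mono) auto
      then show False using z m bounds by (auto simp: meets_def z_def algebra_simps)
    qed
    then have z': "x - q' * n = z - n" by (simp add: z_def algebra_simps)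
    then have "h z < h (z - n) + \<delta>" using m z by (intro overlap_above) (auto simp: meets_def)
    then show ?thesis unfolding top_row_def z' z_def[symmetric] by (simp add: \<open>q' = q + 1\<close> distrib_right)
  next
    case 3
    then have z: "t \<le> z" using c m by (auto simp: carries_def meets_def z_def)
    have "q = q' + 1"
    proof (rule ccontr)
      assume "q \<noteq> q' + 1"
      then have "(q' + 1) * n + n \<le> q * n" using 3 by (intro mult_n_mono) auto
      then show False using z m bounds by (auto simp: meets_def z_def algebra_simps)
    qed
    then have z': "x - q' * n = z + n" by (simp add: z_def algebra_simps)
    then have "h (z + n) = h (z + n - n) + \<delta>" using m z by (intro overlap_eq) (auto simp: meets_def)
    then show ?thesis unfolding top_row_def z' z_def[symmetric] by (simp add: \<open>q = q' + 1\<close> distrib_right)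
  qed simp
qed

lemma H_le: "p \<in> C \<Longrightarrow> H (box_content p) \<le> fst p"
  using top_row_min[OF carries_carrier_of] unfolding mem_C H_def by (meson order_trans)

lemma content_C: "p \<in> C \<Longrightarrow> lo \<le> box_content p \<and> box_content p \<le> hi"
proof -
  assume "p \<in> C"
  then obtain q where q: "meets q (box_content p)" unfolding mem_C by blast
  then have "(1 - a) * n \<le> q * n" "q * n \<le> (b - 1) * n"
    using n_pos by (intro mult_right_mono; simp add: meets_def)+
  then show ?thesis using q by (simp add: meets_def lo_def hi_def)
qed

lemma carries_meets:
  assumes "carries q x" "lo \<le> x" "x \<le> hi"
  shows "meets q x"
proof -
  have "0 \<le> x - q * n"
    using assms bounds by (cases "q = 1 - a") (auto simp: carries_def lo_def)
  moreover have "x - q * n < n + w"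
    using assms bounds by (cases "q = b - 1") (auto simp: carries_def hi_def)
  ultimately show ?thesis using assms(1) by (simp add: meets_def carries_def)
qed

lemma meets_rows:
  assumes "meets q x"
  shows "top_row q x < bottom_row q x"
proof -
  have "h (x - q * n) < g (x - q * n)" using assms by (intro nonempty) (auto simp: meets_def)
  then show ?thesis using assms ab by (auto simp: meets_def top_row_def bottom_row_def)
qed

lemma H_in_C: "lo \<le> x \<Longrightarrow> x \<le> hi \<Longrightarrow> path_box H x \<in> C"
  unfolding mem_C using carries_meets[OF carries_carrier_of, of x] meets_rows
  by (auto simp: H_def)

text \<open>The row ranges of two bands on one diagonal leave no gap, so each diagonal of
  \<open>C\<close> is an interval. Together with the two boundary paths this gives the convexity of
  \<open>C\<close>.\<close>

lemma rows_overlap: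
  assumes q: "meets q x" and q': "meets q' x"
  shows "top_row q' x \<le> bottom_row q x"
proof -
  define z where "z = x - q * n"
  consider "q = q'" | "q < q'" | "q' < q" by linarith
  then show ?thesis
  proof cases
    case 1
    then show ?thesis using meets_rows[OF q] by simp
  next
    case 2
    have "q' = q + 1"
    proof (rule ccontr)
      assume "q' \<noteq> q + 1"
      then have "(q + 1) * n + n \<le> q' * n" using 2 by (intro mult_n_mono) auto
      then show False using q q' bounds by (auto simp: meets_def algebra_simps)
    qed
    then have z': "x - q' * n = z - n" by (simp add: z_def algebra_simps)
    then have "h (z - n) + \<delta> < g z"
      using overlap_nonempty[of "z - n"] q q' by (simp add: meets_def z_def)
    moreover have "max 0 (- q') \<le> min (a - 1) (b - 1 - q)" using q q' ab \<open>q' = q + 1\<close> by (auto simp: meets_def)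
    moreover have "q' * \<delta> = q * \<delta> + \<delta>" using \<open>q' = q + 1\<close> by (simp add: distrib_right)
    ultimately show ?thesis
      unfolding top_row_def bottom_row_def z' z_def[symmetric] by linarith
  next
    case 3
    have "q = q' + 1"
    proof (rule ccontr)
      assume "q \<noteq> q' + 1"
      then have "(q' + 1) * n + n \<le> q * n" using 3 by (intro mult_n_mono) auto
      then show False using q q' bounds by (auto simp: meets_def algebra_simps)
    qed
    then have z': "x - q' * n = z + n" by (simp add: z_def algebra_simps)
    then have "0 \<le> z" "z < w" using q q' by (auto simp: meets_def z_def)
    then have "h (z + n) \<le> h z + \<delta>" "h z < g z"
      using overlap_le[of z] nonempty[of z] bounds by auto
    moreover have "max 0 (- q') \<le> 1 + min (a - 1) (b - 1 - q)" using q q' ab \<open>q = q' + 1\<close> by (auto simp: meets_def)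
    moreover have "q * \<delta> = q' * \<delta> + \<delta>" using \<open>q = q' + 1\<close> by (simp add: distrib_right)
    ultimately show ?thesis
      unfolding top_row_def bottom_row_def z' z_def[symmetric] by linarith
  qed
qed

lemma C_diagonal_interval:
  assumes p: "p \<in> C" "p' \<in> C" "box_content p' = box_content p"
    and r: "box_content z = box_content p" "fst p \<le> fst z" "fst z \<le> fst p'"
  shows "z \<in> C"
proof -
  let ?x = "box_content p"
  obtain q where q: "meets q ?x" "top_row q ?x \<le> fst p" using p(1) unfolding mem_C by blast
  obtain q' where q': "meets q' ?x" "fst p' < bottom_row q' ?x" using p(2) unfolding mem_C p(3) by blast
  show ?thesis
  proof (cases "fst z < bottom_row q ?x")
    case True
    then show ?thesis unfolding mem_C r(1) using q r by auto
  next
    case False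
    then have "top_row q' ?x \<le> fst z" using rows_overlap[OF q(1) q'(1)] by linarith
    then show ?thesis unfolding mem_C r(1) using q' r by auto
  qed
qed

lemma carries_lo: "x \<le> lo + n \<Longrightarrow> x < lo + n + t \<Longrightarrow> carries (1 - a) x"
  using ab by (auto simp: carries_def lo_def)

lemma carries_hi: "(b - 1) * n + t \<le> x \<Longrightarrow> carries (b - 1) x"
  using ab by (auto simp: carries_def)

lemma H_before: "x \<le> lo \<Longrightarrow> H x = H lo + (lo - x)"
proof -
  assume x: "x \<le> lo"
  have c: "carries (1 - a) x" "carries (1 - a) lo" using x n_pos bounds by (auto intro!: carries_lo)
  have e: "x - (1 - a) * n = x - lo" "lo - (1 - a) * n = 0" by (simp_all add: lo_def)
  show ?thesis unfolding H_eq[OF c(1)] H_eq[OF c(2)] top_row_def e using before[of "x - lo"] x by linarith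
qed

lemma H_after: "hi \<le> x \<Longrightarrow> H x = H hi"
proof -
  assume x: "hi \<le> x"
  have c: "carries (b - 1) x" "carries (b - 1) hi" using x n_pos bounds by (auto intro!: carries_hi simp: hi_def)
  have e: "hi - (b - 1) * n = n + w - 1" by (simp add: hi_def)
  have "n + w - 1 \<le> x - (b - 1) * n" using x by (simp add: hi_def)
  then show ?thesis unfolding H_eq[OF c(1)] H_eq[OF c(2)] top_row_def e using after[of "x - (b - 1) * n"] by linarith
qed

lemma C_single_lo: "p \<in> C \<Longrightarrow> box_content p = lo \<Longrightarrow> fst p = H lo"
proof -
  assume p: "p \<in> C" "box_content p = lo"
  then obtain q where q: "meets q lo" "top_row q lo \<le> fst p" "fst p < bottom_row q lo" unfolding mem_C by auto
  have "q = 1 - a"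
  proof (rule ccontr)
    assume "q \<noteq> 1 - a"
    then have "(1 - a) * n + n \<le> q * n" using q(1) by (intro mult_n_mono) (auto simp: meets_def)
    then show False using q(1) n_pos unfolding meets_def lo_def by linarith
  qed
  moreover have "carries (1 - a) lo" using n_pos bounds by (intro carries_lo) auto
  ultimately show ?thesis
    using q(2,3) single(1) ab by (simp add: H_eq top_row_def bottom_row_def lo_def)
qed

lemma C_single_hi: "p \<in> C \<Longrightarrow> box_content p = hi \<Longrightarrow> fst p = H hi"
proof -
  assume p: "p \<in> C" "box_content p = hi"
  then obtain q where q: "meets q hi" "top_row q hi \<le> fst p" "fst p < bottom_row q hi" unfolding mem_C by auto
  have "q = b - 1"
  proof (rule ccontr)
    assume "q \<noteq> b - 1"
    then have "q * n + n \<le> (b - 1) * n" using q(1) by (intro mult_n_mono) (auto simp: meets_def)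
    then show False using q(1) n_pos unfolding meets_def hi_def by linarith
  qed
  moreover have "carries (b - 1) hi" using n_pos bounds by (intro carries_hi) (auto simp: hi_def)
  moreover have "hi - (b - 1) * n = n + w - 1" by (simp add: hi_def)
  ultimately show ?thesis
    using q(2,3) single(2) ab H_eq[of "b - 1" hi] unfolding top_row_def bottom_row_def by simp
qed

section \<open>The removable strip at the corner\<close>

lemma corner_steps: "H t = H (t - 1) - 1" "H (t + n) = H (t + n - 1)"
proof -
  have c: "carries 0 t" "carries 1 (t + n)" using ab n_pos by (auto simp: carries_def)
  have "\<not> carries 0 (t - 1)" "\<not> carries 1 (t + n - 1)" using ab by (auto simp: carries_def)
  then show "H t = H (t - 1) - 1" "H (t + n) = H (t + n - 1)"
    using H_step[OF c(1)] H_step[OF c(2)] by auto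
qed

lemma corner_strip_H: "path_strip H t n = path_strip h t n"
proof -
  have "H x = h x" if "t \<le> x" "x < t + n" for x
  proof -
    have "carries 0 x" using that ab by (auto simp: carries_def)
    then show ?thesis by (simp add: H_eq top_row_def)
  qed
  then show ?thesis by (auto simp: path_strip_def path_box_def)
qed

lemma corner_strip_in_C: "path_strip h t n \<subseteq> C"
proof -
  have "(1 - a) * n \<le> 0" "0 \<le> (b - 1) * n" using ab n_pos by (simp_all add: mult_nonpos_nonneg)
  then have "lo \<le> t" "t + n \<le> hi + 1" using bounds by (auto simp: lo_def hi_def)
  then show ?thesis unfolding corner_strip_H[symmetric] path_strip_subset_iff using H_in_C by auto
qed

lemma corner_strip_lower: "path_strip h t n \<in> lower_strips (nat n) C"
proof -
  have "lower_in C (path_strip h t n)"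
    using lower_in_path_strip[OF lattice_path_H n_pos corner_steps] corner_strip_in_C H_le
    by (simp add: corner_strip_H)
  then show ?thesis
    using bij_betw_path_strip[of h t n] n_pos by (auto simp: lower_strips_def strip_def)
qed

text \<open>Steps of \<open>H\<close> at distance \<open>n\<close> agree except around the corner, where an upward step precedes a
  step to the right; \<open>no_loose_end\<close> and \<open>step_in\<close> exclude strips at the two ends of \<open>H\<close>.\<close>

lemma corner_strip_unique:
  assumes lo: "lo \<le> s" and hi: "s + n \<le> hi + 1" and up: "H s = H (s - 1) - 1" and right: "H (s + n) = H (s + n - 1)"
  shows "s = t"
proof -
  obtain q where q: "carries q s" using carries_carrier_of by blast
  obtain q' where q': "carries q' (s + n)" using carries_carrier_of by blast
  define z where "z = s - q * n"
  have step: "carries q (s - 1) \<and> h z = h (z - 1) - 1 \<or> q \<noteq> 1 - a \<and> z = t \<and> q \<le> 0"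
    using H_step[OF q] up by (auto simp: z_def split: if_splits)
  have step': "carries q' (s + n - 1) \<and> h (s + n - q' * n) = h (s + n - q' * n - 1) \<or>
      q' \<noteq> 1 - a \<and> s + n = q' * n + t \<and> 0 < q'"
    using H_step[OF q'] right by (auto split: if_splits)
  consider "q = b - 1" | "q \<noteq> b - 1" "t \<le> z" | "q \<noteq> b - 1" "z < t" by linarith
  then show ?thesis
  proof cases
    case 1
    then have "carries q (s + n)" using q n_pos by (auto simp: carries_def)
    then have "q' = q" by (rule carries_unique[OF q'])
    have zt: "t \<le> z" using q 1 ab by (auto simp: carries_def z_def)
    have "z \<le> w" using hi 1 by (simp add: z_def hi_def)
    have up: "h z = h (z - 1) - 1" "z \<noteq> t"
    proof -
      have "q > 0" using 1 ab by simp
      then show "h z = h (z - 1) - 1" using step by auto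
      show "z \<noteq> t"
      proof
        assume "z = t"
        then have "\<not> carries q (s - 1)" using 1 ab by (auto simp: carries_def z_def)
        then show False using step \<open>q > 0\<close> by auto
      qed
    qed
    \<comment> \<open>For \<open>z = w\<close> the strip would end on the last diagonal
      \<open>hi\<close>, behind which \<open>H\<close> always goes right. There the step into
      \<open>z\<close> decides, and \<open>step_in\<close> makes it a step right.\<close>
    then have "z \<noteq> w" using step_in by auto
    then have "z < w" using \<open>z \<le> w\<close> by simp
    have "h (z + n) = h (z + n - 1)"
    proof -
      have e: "s + n - q' * n = z + n" using \<open>q' = q\<close> by (simp add: z_def)
      have "s + n \<noteq> q' * n + t" using \<open>q' = q\<close> zt n_pos by (simp add: z_def)
      then show ?thesis using step' unfolding e by auto
    qed
    moreover have "h (z + n) = h z + \<delta>" "h (z + n - 1) = h (z - 1) + \<delta>"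
      using overlap_eq[of "z + n"] overlap_eq[of "z + n - 1"] zt up(2) \<open>z < w\<close> by auto
    ultimately show ?thesis using up by simp
  next
    case 2
    \<comment> \<open>Contents \<open>s\<close> and \<open>s + n\<close> have the same position
      relative to their carriers. The steps there coincide unless both are changes of carrier, and a
      change up followed by a change right happens only for \<open>q = 0\<close>.\<close>
    have "carries (q + 1) (s + n)" using q 2 by (auto simp: carries_def z_def algebra_simps)
    then have q1: "q' = q + 1" by (rule carries_unique[OF q'])
    have e: "s + n - q' * n = z" using q1 by (simp add: z_def algebra_simps)
    show ?thesis
    proof (cases "z = t")
      case True
      then have "\<not> carries q' (s + n - 1)" using q q1 by (auto simp: carries_def z_def algebra_simps)
      then have "0 \<le> q" using step' q1 by auto
      moreover have "q \<le> 0"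
      proof (rule ccontr)
        assume "\<not> q \<le> 0"
        then have "\<not> carries q (s - 1)" using True ab by (auto simp: carries_def z_def)
        then show False using step \<open>\<not> q \<le> 0\<close> by auto
      qed
      ultimately show ?thesis using True by (simp add: z_def)
    next
      case False
      then have "h z = h (z - 1) - 1" using step by auto
      moreover have "s + n \<noteq> q' * n + t" using False e by auto
      then have "h z = h (z - 1)" using step' unfolding e by auto
      ultimately show ?thesis by simp
    qed
  next
    case 3
    \<comment> \<open>These are the first \<open>t\<close> diagonals of the southwestern copy, where
      the periodic pattern has not begun: the case of a loose end.\<close>
    then have qa: "q = 1 - a" using q by (auto simp: carries_def z_def)
    then have "carries q (s + n)" using q 3 ab by (auto simp: carries_def z_def)
    then have "q' = q" by (rule carries_unique[OF q'])
    have "0 \<le> z" using lo qa by (simp add: z_def lo_def)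
    have "h (z + n) = h (z + n - 1)"
    proof -
      have e: "s + n - q' * n = z + n" using \<open>q' = q\<close> by (simp add: z_def)
      show ?thesis using step' qa \<open>q' = q\<close> unfolding e by auto
    qed
    then show ?thesis using no_loose_end[of z] \<open>0 \<le> z\<close> 3 step qa by auto
  qed
qed

lemma lower_strips_C: "lower_strips (nat n) C = {path_strip h t n}"
proof -
  have "\<rho> = path_strip h t n" if \<rho>: "\<rho> \<in> lower_strips (nat n) C" for \<rho>
  proof -
    obtain s where s: "bij_betw box_content \<rho> {s..<s + n}" "lower_in C \<rho>"
      using \<rho> n_pos by (auto simp: lower_strips_def strip_def)
    have range: "lo \<le> x \<and> x \<le> hi" if "s \<le> x" "x < s + n" for x
    proof -
      have "x \<in> box_content ` \<rho>" using bij_betw_imp_surj_on[OF s(1)] that by simp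
      then show ?thesis using content_C lower_in_subset[OF s(2)] by blast
    qed
    have rs: "lo \<le> s" "s \<le> hi" "lo \<le> s + n - 1" "s + n - 1 \<le> hi"
      using range[of s] range[of "s + n - 1"] n_pos by auto
    have top: "path_box H (box_content p) \<in> C" if "p \<in> C" for p using content_C[OF that] H_in_C by blast
    \<comment> \<open>The continuation of \<open>H\<close> is vertical before \<open>lo\<close> and
      horizontal after \<open>hi\<close>, so the wrong steps that would require a neighbouring box
      outside the array do not occur there.\<close>
    have e1: "path_box H (s - 1) \<in> C" if "H s = H (s - 1)" "path_box H s \<in> C"
    proof (cases "s = lo")
      case True
      then show ?thesis using that(1) H_before[of "lo - 1"] by simp
    next
      case False
      then show ?thesis using rs by (intro H_in_C) auto
    qed
    have e2: "path_box H (s + n) \<in> C" if "H (s + n) = H (s + n - 1) - 1" "path_box H (s + n - 1) \<in> C"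
    proof (cases "s + n - 1 = hi")
      case True
      then show ?thesis using that(1) H_after[of "s + n"] by simp
    next
      case False
      then show ?thesis using rs by (intro H_in_C) auto
    qed
    note * = lower_strip_eq_path_strip[OF s(2,1) n_pos lattice_path_H H_le top e1 e2]
    have "s = t" using *(2,3) rs by (intro corner_strip_unique) auto
    then show ?thesis using *(1) corner_strip_H by simp
  qed
  then show ?thesis using corner_strip_lower by blast
qed

text \<open>A box of the corner copy below its first row also lies in copy \<open>(1, 1)\<close>. In
  the first row the contents below \<open>t\<close> are covered by copy \<open>(1, 0)\<close>
  because of \<open>overlap_above\<close>, those from \<open>n + t\<close> on by copy
  \<open>(0, 1)\<close> because of \<open>overlap_eq\<close>. Exactly the strip in between is left
  to the corner copy alone.\<close>

lemma copies_without_corner: "copies h g n w \<delta> (rect - {(0, 0)}) = C - path_strip h t n"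
proof (intro equalityI subsetI)
  fix p assume p: "p \<in> copies h g n w \<delta> (rect - {(0, 0)})"
  then obtain i j where ij: "(i, j) \<in> rect" "(i, j) \<noteq> (0, 0)"
    "0 \<le> box_content p - (j - i) * n" "box_content p - (j - i) * n < n + w"
    "h (box_content p - (j - i) * n) + (j - i) * \<delta> + i \<le> fst p"
    "fst p < g (box_content p - (j - i) * n) + (j - i) * \<delta> + i"
    unfolding mem_copies by auto
  then have "p \<in> C" by (intro mem_copiesI[of i j _ "j - i"]) auto
  moreover have "p \<notin> path_strip h t n"
  proof
    assume "p \<in> path_strip h t n"
    then have x: "t \<le> box_content p" "box_content p < t + n" "fst p = h (box_content p)"
      by (auto simp: mem_path_strip)
    define q where "q = j - i"
    have i0: "0 \<le> i" "0 \<le> j" using ij(1) by (auto simp: rect_def)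
    have "\<not> 1 < q"
    proof
      assume "1 < q"
      then have "1 * n + n \<le> q * n" by (rule mult_n_mono)
      then show False using ij(3) x bounds unfolding q_def[symmetric] by linarith
    qed
    moreover have "\<not> q < - 1"
    proof
      assume "q < - 1"
      then have "q * n + n \<le> - 1 * n" by (rule mult_n_mono)
      then show False using ij(4) x bounds unfolding q_def[symmetric] by linarith
    qed
    ultimately consider "q = 0" | "q = 1" | "q = - 1" by linarith
    then show False
    proof cases
      case 1
      then have "i \<noteq> 0" using ij(2) by (auto simp: q_def)
      then show False using 1 ij(5) x i0 by (simp add: q_def[symmetric])
    next
      case 2
      then have "h (box_content p) < h (box_content p - n) + \<delta>"
        using ij(3) x by (intro overlap_above) (auto simp: q_def[symmetric])
      then show False using 2 ij(5) x i0 by (simp add: q_def[symmetric])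
    next
      case 3
      then have "h (box_content p + n) = h (box_content p + n - n) + \<delta>"
        using ij(4) x by (intro overlap_eq) (auto simp: q_def[symmetric])
      moreover have "1 \<le> i" using 3 i0 by (simp add: q_def)
      ultimately show False using 3 ij(5) x by (simp add: q_def[symmetric])
    qed
  qed
  ultimately show "p \<in> C - path_strip h t n" by blast
next
  fix p assume p: "p \<in> C - path_strip h t n"
  let ?x = "box_content p"
  have np: "\<not> (t \<le> ?x \<and> ?x < t + n \<and> fst p = h ?x)" using p by (auto simp: mem_path_strip)
  obtain i j where ij: "(i, j) \<in> rect"
    "0 \<le> ?x - (j - i) * n" "?x - (j - i) * n < n + w"
    "h (?x - (j - i) * n) + (j - i) * \<delta> + i \<le> fst p"
    "fst p < g (?x - (j - i) * n) + (j - i) * \<delta> + i"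
    using p unfolding Diff_iff mem_copies by blast
  show "p \<in> copies h g n w \<delta> (rect - {(0, 0)})"
  proof (cases "(i, j) = (0, 0)")
    case False
    then show ?thesis using ij by (intro mem_copiesI[of i j _ "j - i"]) auto
  next
    case True
    then have x: "0 \<le> ?x" "?x < n + w" "h ?x \<le> fst p" "fst p < g ?x" using ij by auto
    show ?thesis
    proof (cases "h ?x + 1 \<le> fst p")
      case True
      show ?thesis by (rule mem_copiesI[of 1 1 _ 0]) (use x True ab in \<open>auto simp: rect_def\<close>)
    next
      case False
      then have e: "fst p = h ?x" using x by simp
      consider "?x < t" | "n + t \<le> ?x" using np e by fastforce
      then show ?thesis
      proof cases
        case 1
        then have "h (?x + n) < h (?x + n - n) + \<delta>" using x by (intro overlap_above) auto
        moreover have "h ?x + \<delta> < g (?x + n)" using x 1 bounds by (intro overlap_nonempty) auto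
        ultimately show ?thesis
          by (intro mem_copiesI[of 1 0 _ "- 1"]) (use x 1 e ab bounds in \<open>auto simp: rect_def\<close>)
      next
        case 2
        then have "h ?x = h (?x - n) + \<delta>" using x by (intro overlap_eq) auto
        moreover have "h (?x - n) < g (?x - n)" using x 2 bounds by (intro nonempty) auto
        ultimately show ?thesis
          by (intro mem_copiesI[of 0 1 _ 1]) (use x 2 e ab bounds in \<open>auto simp: rect_def\<close>)
      qed
    qed
  qed
qed

end

section \<open>Symmetries of the plane\<close>

definition reflect :: "box \<Rightarrow> box set \<Rightarrow> box set" where
  "reflect k S = {p. k - p \<in> S}"

definition transpose_box :: "box \<Rightarrow> box" where
  "transpose_box p = (snd p, fst p)"

definition transpose_boxes :: "box set \<Rightarrow> box set" where
  "transpose_boxes S = {p. transpose_box p \<in> S}"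

lemma transpose_box_simps [simp]:
  "transpose_box (transpose_box p) = p"
  "fst (transpose_box p) = snd p" "snd (transpose_box p) = fst p"
  "transpose_box (r, c) = (c, r)"
  "box_content (transpose_box p) = - box_content p"
  "box_le (transpose_box p) (transpose_box q) \<longleftrightarrow> box_le p q"
  by (auto simp: transpose_box_def box_content_def box_le_def)

lemma transpose_box_add: "transpose_box (p + q) = transpose_box p + transpose_box q"
  and transpose_box_diff: "transpose_box (p - q) = transpose_box p - transpose_box q"
  by (simp_all add: transpose_box_def)

lemma mem_transpose_boxes: "p \<in> transpose_boxes S \<longleftrightarrow> transpose_box p \<in> S"
  by (simp add: transpose_boxes_def)

lemma transpose_boxes_transpose_boxes [simp]: "transpose_boxes (transpose_boxes S) = S"
  by (rule Set.set_eqI) (simp add: mem_transpose_boxes)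

lemma mem_reflect: "p \<in> reflect k S \<longleftrightarrow> k - p \<in> S"
  by (simp add: reflect_def)

lemma reflect_reflect [simp]: "reflect k (reflect k S) = S"
  by (rule Set.set_eqI) (simp add: mem_reflect)

lemma box_content_diff: "box_content (p - q) = box_content p - box_content q"
  and box_content_add: "box_content (p + q) = box_content p + box_content q"
  by (simp_all add: box_content_def)

lemma box_le_diff: "box_le (k - p) (k - q) \<longleftrightarrow> box_le q p"
  and box_le_add: "box_le (p + t) (q + t) \<longleftrightarrow> box_le p q"
  by (auto simp: box_le_def)

text \<open>Bijections acting on contents by sign and shift, which is enough to preserve strips. A
  point reflection reverses \<open>box_le\<close> and is only a \<open>plane_map\<close>;
  translations and the transposition are also \<open>order_map\<close>s.\<close>

locale plane_map =
  fixes f f' :: "box \<Rightarrow> box" and \<epsilon> d :: int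
  assumes inverse: "\<And>p. f (f' p) = p" "\<And>p. f' (f p) = p"
    and content: "\<And>p. box_content (f p) = \<epsilon> * box_content p + d"
    and eps: "\<epsilon> = 1 \<or> \<epsilon> = - 1"
begin

lemma mem_image: "p \<in> f ` S \<longleftrightarrow> f' p \<in> S"
  by (metis inverse imageE image_eqI)

lemma image_Diff: "f ` (S - T) = f ` S - f ` T"
  by (rule Set.set_eqI) (simp add: mem_image)

lemma strip_image:
  assumes "strip n \<rho>"
  shows "strip n (f ` \<rho>)"
proof -
  obtain s where s: "bij_betw box_content \<rho> {s..<s + int n}" using assms by (auto simp: strip_def)
  have 1: "bij_betw f' (f ` \<rho>) \<rho>"
    by (rule bij_betw_byWitness[where f' = f]) (auto simp: inverse)
  let ?s = "if \<epsilon> = 1 then s + d else d - s - int n + 1"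
  have 2: "bij_betw (\<lambda>x. \<epsilon> * x + d) {s..<s + int n} {?s..<?s + int n}"
    by (rule bij_betw_byWitness[where f' = "\<lambda>x. \<epsilon> * (x - d)"]) (use eps in auto)
  have "bij_betw ((\<lambda>x. \<epsilon> * x + d) \<circ> (box_content \<circ> f')) (f ` \<rho>) {?s..<?s + int n}"
    by (intro bij_betw_trans[OF bij_betw_trans[OF 1 s] 2])
  moreover have "(\<lambda>x. \<epsilon> * x + d) \<circ> (box_content \<circ> f') = box_content"
  proof
    fix p
    show "((\<lambda>x. \<epsilon> * x + d) \<circ> (box_content \<circ> f')) p = box_content p"
      using content[of "f' p"] by (simp add: inverse)
  qed
  ultimately show ?thesis unfolding strip_def by auto
qed

end

locale order_map = plane_map +
  assumes order: "\<And>p q. box_le (f p) (f q) \<longleftrightarrow> box_le p q"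
begin

lemma inverse_map: "order_map f' f \<epsilon> (- \<epsilon> * d)"
proof
  show "box_content (f' p) = \<epsilon> * box_content p + - \<epsilon> * d" for p
    using content[of "f' p"] eps by (auto simp: inverse)
  show "box_le (f' p) (f' q) \<longleftrightarrow> box_le p q" for p q using order[of "f' p" "f' q"] by (simp add: inverse)
qed (use inverse eps in auto)

lemma order': "box_le (f' p) (f' q) \<longleftrightarrow> box_le p q"
  using order[of "f' p" "f' q"] by (simp add: inverse)

lemma convex_image: 
  assumes "convex_boxes S"
  shows "convex_boxes (f ` S)"
proof (rule convex_boxesI)
  fix x y z assume "x \<in> f ` S" "y \<in> f ` S" "box_le x z" "box_le z y"
  then show "z \<in> f ` S" using convex_boxesD[OF assms, of "f' x" "f' y" "f' z"] by (simp add: mem_image order')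
qed

lemma lower_in_image: "lower_in S \<rho> \<Longrightarrow> lower_in (f ` S) (f ` \<rho>)"
  unfolding lower_in_def using order by auto

lemma upper_in_image: "upper_in S \<rho> \<Longrightarrow> upper_in (f ` S) (f ` \<rho>)"
  unfolding upper_in_def using order by auto

lemma lower_strips_image_subset: "(`) f ` lower_strips n S \<subseteq> lower_strips n (f ` S)"
  unfolding lower_strips_def using lower_in_image strip_image by auto

lemma upper_strips_image_subset: "(`) f ` upper_strips n S \<subseteq> upper_strips n (f ` S)"
  unfolding upper_strips_def using upper_in_image strip_image by auto

end

lemma (in order_map) lower_strips_image: "lower_strips n (f ` S) = (`) f ` lower_strips n S"
proof
  have i: "f' ` f ` X = X" "f ` f' ` X = X" for X by (auto simp: image_image inverse)
  show "lower_strips n (f ` S) \<subseteq> (`) f ` lower_strips n S"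
  proof
    fix \<rho> assume "\<rho> \<in> lower_strips n (f ` S)"
    then have "f' ` \<rho> \<in> lower_strips n (f' ` f ` S)"
      using order_map.lower_strips_image_subset[OF inverse_map] by blast
    then have "f' ` \<rho> \<in> lower_strips n S" by (simp only: i)
    then have "f ` f' ` \<rho> \<in> (`) f ` lower_strips n S" by (rule imageI)
    then show "\<rho> \<in> (`) f ` lower_strips n S" by (simp only: i)
  qed
qed (rule lower_strips_image_subset)

lemma (in order_map) upper_strips_image: "upper_strips n (f ` S) = (`) f ` upper_strips n S"
proof
  have i: "f' ` f ` X = X" "f ` f' ` X = X" for X by (auto simp: image_image inverse)
  show "upper_strips n (f ` S) \<subseteq> (`) f ` upper_strips n S"
  proof
    fix \<rho> assume "\<rho> \<in> upper_strips n (f ` S)"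
    then have "f' ` \<rho> \<in> upper_strips n (f' ` f ` S)"
      using order_map.upper_strips_image_subset[OF inverse_map] by blast
    then have "f' ` \<rho> \<in> upper_strips n S" by (simp only: i)
    then have "f ` f' ` \<rho> \<in> (`) f ` upper_strips n S" by (rule imageI)
    then show "\<rho> \<in> (`) f ` upper_strips n S" by (simp only: i)
  qed
qed (rule upper_strips_image_subset)

lemma reflect_image: "reflect k S = (\<lambda>p. k - p) ` S"
  by (rule Set.set_eqI) (auto simp: mem_reflect image_iff intro: bexI[of _ "k - _"])

lemma transpose_boxes_image: "transpose_boxes S = transpose_box ` S"
  by (rule Set.set_eqI) (auto simp: mem_transpose_boxes image_iff intro: bexI[of _ "transpose_box _"])

interpretation transpose: order_map transpose_box transpose_box "- 1" 0
  by unfold_locales auto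

interpretation translation: order_map "\<lambda>p. p + t" "\<lambda>p. p - t" 1 "box_content t" for t
  by unfold_locales (auto simp: box_content_add box_le_add)

interpretation reflection: plane_map "\<lambda>p. k - p" "\<lambda>p. k - p" "- 1" "box_content k" for k
  by unfold_locales (auto simp: box_content_diff)

lemma convex_translate: "convex_boxes S \<Longrightarrow> convex_boxes (translate t S)"
  unfolding translate_def by (rule translation.convex_image)

lemma finite_translate: "finite S \<Longrightarrow> finite (translate t S)"
  by (simp add: translate_def)

lemma upper_in_reflect: "lower_in (reflect k S) \<rho> \<longleftrightarrow> upper_in S (reflect k \<rho>)"
proof
  assume l: "lower_in (reflect k S) \<rho>"
  show "upper_in S (reflect k \<rho>)"
    unfolding upper_in_def
  proof (intro conjI subsetI ballI impI)
    fix x assume "x \<in> reflect k \<rho>"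
    then show "x \<in> S" using lower_in_subset[OF l] by (auto simp: mem_reflect)
  next
    fix x y assume "x \<in> reflect k \<rho>" "y \<in> S" "box_le x y"
    then show "y \<in> reflect k \<rho>" using lower_inD[OF l, of "k - x" "k - y"] by (simp add: mem_reflect box_le_diff)
  qed
next
  assume u: "upper_in S (reflect k \<rho>)"
  show "lower_in (reflect k S) \<rho>"
    unfolding lower_in_def
  proof (intro conjI subsetI ballI impI)
    fix x assume "x \<in> \<rho>"
    then show "x \<in> reflect k S" using upper_in_subset[OF u] by (auto simp: mem_reflect)
  next
    fix x y assume "x \<in> \<rho>" "y \<in> reflect k S" "box_le y x"
    then show "y \<in> \<rho>" using upper_inD[OF u, of "k - x" "k - y"] by (simp add: mem_reflect box_le_diff)
  qed
qed

lemma upper_strips_reflect: "\<rho> \<in> lower_strips n (reflect k S) \<longleftrightarrow> reflect k \<rho> \<in> upper_strips n S"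
proof -
  have "strip n (reflect k \<rho>) \<longleftrightarrow> strip n \<rho>"
    using reflection.strip_image[of n \<rho> k] reflection.strip_image[of n "reflect k \<rho>" k]
    by (metis reflect_image reflect_reflect)
  then show ?thesis by (simp add: lower_strips_def upper_strips_def upper_in_reflect)
qed

text \<open>Keeps the geometric reason for equal skew Schur functions instead of the equality, so
  that symmetries of the plane can be applied to it.\<close>

definition exchangeable :: "box set \<Rightarrow> box set \<Rightarrow> bool" where
  "exchangeable A B \<longleftrightarrow> (\<exists>C n L U t t'. finite C \<and> convex_boxes C \<and> n > 0 \<and> lower_strips n C = {L} \<and>
     upper_strips n C = {U} \<and> A = translate t (C - U) \<and> B = translate t' (C - L))"

lemma exchangeable_schur_equiv: "exchangeable A B \<Longrightarrow> A \<sim>\<^sub>s B"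
  unfolding exchangeable_def schur_equiv_def
  using unique_strips_schur_equiv skew_schur_translate by metis

lemma transpose_translate: "transpose_boxes (translate t S) = translate (transpose_box t) (transpose_boxes S)"
  by (rule Set.set_eqI) (simp add: mem_transpose_boxes mem_translate transpose_box_diff)

text \<open>Transposition preserves the order of boxes and strips, hence also the uniqueness of
  removable strips. Semistandard fillings, in contrast, are not transposed into semistandard
  ones.\<close>

lemma exchangeable_transpose:
  assumes "exchangeable (transpose_boxes A) (transpose_boxes B)"
  shows "exchangeable A B"
proof -
  obtain C n L U t t' where *: "finite C" "convex_boxes C" "n > 0" "lower_strips n C = {L}"
     "upper_strips n C = {U}" "transpose_boxes A = translate t (C - U)" "transpose_boxes B = translate t' (C - L)"
    using assms[unfolded exchangeable_def] by (elim exE conjE) (rule that; assumption)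
  have "A = transpose_boxes (translate t (C - U))" "B = transpose_boxes (translate t' (C - L))"
    by (simp_all flip: *(6,7))
  then have AB: "A = translate (transpose_box t) (transpose_boxes (C - U))"
    "B = translate (transpose_box t') (transpose_boxes (C - L))"
    by (simp_all only: transpose_translate)
  show ?thesis
    unfolding exchangeable_def
    by (rule exI[of _ "transpose_box ` C"], rule exI[of _ n], rule exI[of _ "transpose_box ` L"],
        rule exI[of _ "transpose_box ` U"], rule exI[of _ "transpose_box t"], rule exI[of _ "transpose_box t'"])
      (simp add: * AB transpose.convex_image transpose.lower_strips_image transpose.upper_strips_image
        transpose_boxes_image transpose.image_Diff)
qed

text \<open>Outside \<open>lo..hi\<close> the continued paths leave no row between them, so a box
  between two boxes of \<open>S\<close> stays in this range; there its diagonal meets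
  \<open>S\<close> in the whole interval from one path to the other.\<close>

lemma convex_boxes_between_paths:
  assumes F: "lattice_path F" and G: "lattice_path G"
    and bounds: "\<And>p. p \<in> S \<Longrightarrow> F (box_content p) \<le> fst p \<and> fst p \<le> G (box_content p)"
    and interval: "\<And>p p' z. p \<in> S \<Longrightarrow> p' \<in> S \<Longrightarrow> box_content p' = box_content p \<Longrightarrow> box_content z = box_content p \<Longrightarrow>
      fst p \<le> fst z \<Longrightarrow> fst z \<le> fst p' \<Longrightarrow> z \<in> S"
    and inS: "\<And>x. lo \<le> x \<Longrightarrow> x \<le> hi \<Longrightarrow> path_box F x \<in> S \<and> path_box G x \<in> S"
    and before: "\<And>x. x \<le> lo \<Longrightarrow> F x = F lo + (lo - x) \<and> G x = G lo"
    and after: "\<And>x. hi \<le> x \<Longrightarrow> F x = F hi \<and> G x = G hi - (x - hi)"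
    and ends: "F lo = G lo" "F hi = G hi"
  shows "convex_boxes S"
proof (rule convex_boxesI)
  fix x y z assume x: "x \<in> S" and y: "y \<in> S" and xz: "box_le x z" and zy: "box_le z y"
  have F': "F (box_content z) \<le> fst z" using lattice_path_mono_le[OF F xz] bounds[OF x] by blast
  have "lattice_path (\<lambda>x. G x + 1)" using lattice_path_reflect[OF lattice_path_reflect[OF G, of 0 0], of 1 0] by (simp add: add.commute)
  from lattice_path_mono_le[OF this zy] have G': "fst z \<le> G (box_content z)" using bounds[OF y] by fastforce
  have "lo \<le> box_content z" using before[of "box_content z"] ends F' G' by (cases "lo \<le> box_content z") auto
  moreover have "box_content z \<le> hi" using after[of "box_content z"] ends F' G' by (cases "box_content z \<le> hi") auto
  ultimately have "path_box F (box_content z) \<in> S \<and> path_box G (box_content z) \<in> S" by (rule inS)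
  then show "z \<in> S" using interval[of "path_box F (box_content z)" "path_box G (box_content z)" z] F' G' by simp
qed

lemma finite_copies:
  assumes "finite Q"
  shows "finite (copies h g n w \<delta> Q)"
proof (rule finite_subset)
  show "copies h g n w \<delta> Q \<subseteq> (\<Union>(i, j)\<in>Q. \<Union>z\<in>{0..<n + w}.
      (\<lambda>r. (r, r + z + (j - i) * n)) ` {h z + (j - i) * \<delta> + i..<g z + (j - i) * \<delta> + i})"
  proof
    fix p assume "p \<in> copies h g n w \<delta> Q"
    then obtain i j where "(i, j) \<in> Q" and *: "0 \<le> box_content p - (j - i) * n" "box_content p - (j - i) * n < n + w"
      "h (box_content p - (j - i) * n) + (j - i) * \<delta> + i \<le> fst p"
      "fst p < g (box_content p - (j - i) * n) + (j - i) * \<delta> + i"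
      by (auto simp: copies_def)
    moreover have "p = (fst p, fst p + (box_content p - (j - i) * n) + (j - i) * n)"
      by (simp add: box_content_def)
    ultimately show "p \<in> (\<Union>(i, j)\<in>Q. \<Union>z\<in>{0..<n + w}.
      (\<lambda>r. (r, r + z + (j - i) * n)) ` {h z + (j - i) * \<delta> + i..<g z + (j - i) * \<delta> + i})"
      by (intro UN_I[of "(i, j)"]) (auto intro!: bexI[of _ "box_content p - (j - i) * n"] image_eqI[of _ _ "fst p"])
  qed
qed (use assms in auto)

text \<open>Rotation by 180 degrees turns the rows \<open>h..<g\<close> into
  \<open>1 - g..<1 - h\<close> and reverses the contents \<open>0..<n + w\<close>.\<close>

definition opposite :: "int \<Rightarrow> int \<Rightarrow> (int \<Rightarrow> int) \<Rightarrow> int \<Rightarrow> int" where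
  "opposite n w f x = 1 - f (n + w - 1 - x)"

text \<open>\<open>k\<close> is the sum of opposite corners of the array: reflection in its half
  exchanges the places of the copies \<open>(i, j)\<close> and \<open>(a - 1 - i, b - 1 - j)\<close>
  while rotating each copy.\<close>

lemma copies_opposite:
  assumes k: "fst k = (b - a) * \<delta> + a - 1" "box_content k = n + w - 1 + (b - a) * n"
  shows "reflect k (copies h g n w \<delta> Q) =
    copies (opposite n w g) (opposite n w h) n w \<delta> {(i, j). (a - 1 - i, b - 1 - j) \<in> Q}"
proof (rule Set.set_eqI)
  fix p
  have key: "(0 \<le> box_content (k - p) - (j - i) * n \<and> box_content (k - p) - (j - i) * n < n + w \<and>
      h (box_content (k - p) - (j - i) * n) + (j - i) * \<delta> + i \<le> fst (k - p) \<and>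
      fst (k - p) < g (box_content (k - p) - (j - i) * n) + (j - i) * \<delta> + i) \<longleftrightarrow>
     (0 \<le> box_content p - (j' - i') * n \<and> box_content p - (j' - i') * n < n + w \<and>
      opposite n w g (box_content p - (j' - i') * n) + (j' - i') * \<delta> + i' \<le> fst p \<and>
      fst p < opposite n w h (box_content p - (j' - i') * n) + (j' - i') * \<delta> + i')"
    if "i = a - 1 - i'" "j = b - 1 - j'" for i j i' j'
  proof -
    have q: "j - i = b - a - (j' - i')" using that by simp
    define x where "x = box_content p - (j' - i') * n"
    have "box_content (k - p) - (j - i) * n = n + w - 1 - x"
      unfolding q box_content_diff k x_def by (simp add: algebra_simps)
    moreover have "(j - i) * \<delta> = (b - a) * \<delta> - (j' - i') * \<delta>" unfolding q by (simp add: left_diff_distrib)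
    ultimately show ?thesis
      unfolding x_def[symmetric] opposite_def fst_diff k(1) using that by auto
  qed
  have "p \<in> reflect k (copies h g n w \<delta> Q) \<longleftrightarrow> (\<exists>i j. (i, j) \<in> Q \<and>
      0 \<le> box_content (k - p) - (j - i) * n \<and> box_content (k - p) - (j - i) * n < n + w \<and>
      h (box_content (k - p) - (j - i) * n) + (j - i) * \<delta> + i \<le> fst (k - p) \<and>
      fst (k - p) < g (box_content (k - p) - (j - i) * n) + (j - i) * \<delta> + i)"
    by (auto simp: mem_reflect copies_def)
  also have "\<dots> \<longleftrightarrow> (\<exists>i' j'. (a - 1 - i', b - 1 - j') \<in> Q \<and>
      0 \<le> box_content p - (j' - i') * n \<and> box_content p - (j' - i') * n < n + w \<and>
      opposite n w g (box_content p - (j' - i') * n) + (j' - i') * \<delta> + i' \<le> fst p \<and>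
      fst p < opposite n w h (box_content p - (j' - i') * n) + (j' - i') * \<delta> + i')" (is "?l \<longleftrightarrow> ?r")
  proof
    assume ?l
    then obtain i j where ij: "(i, j) \<in> Q" and c: "0 \<le> box_content (k - p) - (j - i) * n \<and> box_content (k - p) - (j - i) * n < n + w \<and>
      h (box_content (k - p) - (j - i) * n) + (j - i) * \<delta> + i \<le> fst (k - p) \<and>
      fst (k - p) < g (box_content (k - p) - (j - i) * n) + (j - i) * \<delta> + i" by blast
    have e: "i = a - 1 - (a - 1 - i)" "j = b - 1 - (b - 1 - j)" by simp_all
    have "(a - 1 - (a - 1 - i), b - 1 - (b - 1 - j)) \<in> Q" using ij by simp
    then show ?r using c[unfolded key[OF e]] by blast
  next
    assume ?r
    then obtain i' j' where ij: "(a - 1 - i', b - 1 - j') \<in> Q" and c: "0 \<le> box_content p - (j' - i') * n \<and> box_content p - (j' - i') * n < n + w \<and>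
      opposite n w g (box_content p - (j' - i') * n) + (j' - i') * \<delta> + i' \<le> fst p \<and>
      fst p < opposite n w h (box_content p - (j' - i') * n) + (j' - i') * \<delta> + i'" by blast
    show ?l using ij c[folded key[OF refl refl]] by blast
  qed
  also have "\<dots> \<longleftrightarrow> p \<in> copies (opposite n w g) (opposite n w h) n w \<delta> {(i, j). (a - 1 - i, b - 1 - j) \<in> Q}"
    by (auto simp: copies_def)
  finally show "p \<in> reflect k (copies h g n w \<delta> Q) \<longleftrightarrow>
    p \<in> copies (opposite n w g) (opposite n w h) n w \<delta> {(i, j). (a - 1 - i, b - 1 - j) \<in> Q}" .
qed

text \<open>The reflected array is the array of the opposite band, so its corner strip reflects to
  the only removable strip at the lower right. Its boundary path reflects to the lower path
  \<open>G\<close>, which completes the proof of convexity.\<close>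

lemma exchangeable_copies:
  assumes c: "corner_band h g n w t \<delta> a b"
    and c': "corner_band (opposite n w g) (opposite n w h) n w t' \<delta> a b"
  shows "exchangeable (copies h g n w \<delta> ({0..<a} \<times> {0..<b} - {(a - 1, b - 1)}))
      (copies h g n w \<delta> ({0..<a} \<times> {0..<b} - {(0, 0)}))"
proof -
  interpret c: corner_band h g n w t \<delta> a b by (rule c)
  interpret c': corner_band "opposite n w g" "opposite n w h" n w t' \<delta> a b by (rule c')
  define K where "K = n + w - 1 + (b - a) * n"
  define k where "k = ((b - a) * \<delta> + a - 1, (b - a) * \<delta> + a - 1 + K)"
  have k: "fst k = (b - a) * \<delta> + a - 1" "box_content k = n + w - 1 + (b - a) * n"
    by (simp_all add: k_def box_content_def K_def)
  let ?R = "{0..<a} \<times> {0..<b}"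
  have rect: "c.rect = ?R" "c'.rect = ?R" by (simp_all add: c.rect_def c'.rect_def)
  have R: "{(i, j). (a - 1 - i, b - 1 - j) \<in> ?R} = ?R" "{(i, j). (a - 1 - i, b - 1 - j) \<in> ?R - {(a - 1, b - 1)}} = ?R - {(0, 0)}"
    by auto
  have opp: "reflect k c.C = c'.C"
    "reflect k (copies h g n w \<delta> (?R - {(a - 1, b - 1)})) = copies (opposite n w g) (opposite n w h) n w \<delta> (?R - {(0, 0)})"
    by (simp_all only: copies_opposite[OF k] R rect)
  define G where "G x = fst k - c'.H (K - x)" for x
  have mem: "p \<in> c.C \<longleftrightarrow> k - p \<in> c'.C" for p by (simp add: mem_reflect flip: opp(1))
  have lohi: "c'.lo = c.lo" "c'.hi = c.hi" "K - c.lo = c.hi" "K - c.hi = c.lo"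
    by (simp_all add: c.lo_def c'.lo_def c.hi_def c'.hi_def K_def algebra_simps)
  have GC: "path_box G x \<in> c.C" if "c.lo \<le> x" "x \<le> c.hi" for x
  proof -
    have "k - path_box G x = path_box c'.H (K - x)"
      by (simp add: path_box_def G_def k_def)
    moreover have "path_box c'.H (K - x) \<in> c'.C" using that lohi by (intro c'.H_in_C) auto
    ultimately show ?thesis by (simp add: mem)
  qed
  have lohi_le: "c.lo \<le> c.hi"
  proof -
    have "(1 - a) * n \<le> 0" "0 \<le> (b - 1) * n" using c.ab c.n_pos by (simp_all add: mult_nonpos_nonneg)
    then show ?thesis using c.bounds unfolding c.lo_def c.hi_def by linarith
  qed
  have conv: "convex_boxes c.C"
  proof (rule convex_boxes_between_paths[OF c.lattice_path_H _ _ c.C_diagonal_interval])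
    show "lattice_path G" unfolding G_def by (rule lattice_path_reflect[OF c'.lattice_path_H])
    show "c.H (box_content p) \<le> fst p \<and> fst p \<le> G (box_content p)" if "p \<in> c.C" for p
      using c.H_le[OF that] c'.H_le[of "k - p"] that
      by (simp add: mem G_def box_content_diff k(2) K_def)
    show "path_box c.H x \<in> c.C \<and> path_box G x \<in> c.C" if "c.lo \<le> x" "x \<le> c.hi" for x
      using c.H_in_C[OF that] GC[OF that] by blast
    show "c.H x = c.H c.lo + (c.lo - x) \<and> G x = G c.lo" if "x \<le> c.lo" for x
    proof -
      have "c'.H (K - x) = c'.H c'.hi"
        by (rule c'.H_after) (use that lohi in linarith)
      moreover have "K - c.lo = c'.hi" using lohi by linarith
      ultimately show ?thesis using c.H_before[OF that] unfolding G_def by simp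
    qed
    show "c.H x = c.H c.hi \<and> G x = G c.hi - (x - c.hi)" if "c.hi \<le> x" for x
    proof -
      have "c'.H (K - x) = c'.H c'.lo + (c'.lo - (K - x))"
        by (rule c'.H_before) (use that lohi in linarith)
      moreover have "K - c.hi = c'.lo" using lohi by linarith
      ultimately show ?thesis using c.H_after[OF that] lohi unfolding G_def by simp
    qed
    show "c.H c.lo = G c.lo" using c.C_single_lo[OF GC[of c.lo]] lohi_le by simp
    show "c.H c.hi = G c.hi" using c.C_single_hi[OF GC[of c.hi]] lohi_le by simp
  qed
  define L where "L = path_strip h t n"
  define U where "U = reflect k (path_strip (opposite n w g) t' n)"
  have U: "upper_strips (nat n) c.C = {U}"
  proof -
    have "\<rho> \<in> upper_strips (nat n) c.C \<longleftrightarrow> reflect k \<rho> \<in> lower_strips (nat n) c'.C" for \<rho>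
      using upper_strips_reflect[of "reflect k \<rho>" "nat n" k c.C] by (simp add: opp(1))
    moreover have "reflect k \<rho> = path_strip (opposite n w g) t' n \<longleftrightarrow> \<rho> = U" for \<rho>
      unfolding U_def by (metis reflect_reflect)
    ultimately show ?thesis by (auto simp: c'.lower_strips_C)
  qed
  have "reflect k (c.C - U) = reflect k (copies h g n w \<delta> (?R - {(a - 1, b - 1)}))"
  proof -
    have "reflect k (c.C - U) = c'.C - path_strip (opposite n w g) t' n"
      unfolding opp(1)[symmetric] by (rule Set.set_eqI) (simp add: mem_reflect U_def)
    then show ?thesis using c'.copies_without_corner by (simp only: opp(2) rect)
  qed
  then have AU: "copies h g n w \<delta> (?R - {(a - 1, b - 1)}) = c.C - U" by (metis reflect_reflect)
  have BL: "copies h g n w \<delta> (?R - {(0, 0)}) = c.C - L"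
    using c.copies_without_corner by (simp add: rect L_def)
  show ?thesis
    unfolding exchangeable_def AU BL
    by (rule exI[of _ c.C], rule exI[of _ "nat n"], rule exI[of _ L], rule exI[of _ U], rule exI[of _ 0], rule exI[of _ 0])
      (use conv U c.lower_strips_C c.n_pos finite_copies[of c.rect h g n w \<delta>] in \<open>simp add: L_def c.rect_def\<close>)
qed

section \<open>WOW shapes as bands\<close>

text \<open>The form in which connectedness enters: there is no gap among the occupied
  diagonals.\<close>

definition contiguous :: "box set \<Rightarrow> bool" where
  "contiguous S \<longleftrightarrow> (\<forall>p\<in>S. \<forall>q\<in>S. \<forall>x. box_content p \<le> x \<longrightarrow> x \<le> box_content q \<longrightarrow> x \<in> box_content ` S)"

lemma contiguousD: "contiguous S \<Longrightarrow> p \<in> S \<Longrightarrow> q \<in> S \<Longrightarrow> box_content p \<le> x \<Longrightarrow> x \<le> box_content q \<Longrightarrow> x \<in> box_content ` S"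
  unfolding contiguous_def by blast

definition top_of :: "box set \<Rightarrow> int \<Rightarrow> int" where
  "top_of S x = Min (fst ` {p \<in> S. box_content p = x})"

lemma
  assumes "finite S"
  shows path_box_top_of: "x \<in> box_content ` S \<Longrightarrow> path_box (top_of S) x \<in> S"
    and top_of_le: "p \<in> S \<Longrightarrow> top_of S (box_content p) \<le> fst p"
proof -
  show "path_box (top_of S) x \<in> S" if x: "x \<in> box_content ` S"
  proof -
    have "fst ` {p \<in> S. box_content p = x} \<noteq> {}" using x by auto
    then have "top_of S x \<in> fst ` {p \<in> S. box_content p = x}"
      unfolding top_of_def using assms by (intro Min_in) auto
    then obtain p where p: "p \<in> S" "box_content p = x" "fst p = top_of S x" by auto
    then have "p = path_box (top_of S) x" by (simp add: path_box_eq_iff)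
    then show ?thesis using p(1) by simp
  qed
  show "top_of S (box_content p) \<le> fst p" if "p \<in> S"
    unfolding top_of_def using assms that by (intro Min_le) auto
qed

lemma top_of_eqI:
  assumes "finite S" "p \<in> S" "box_content p = x" "\<And>q. q \<in> S \<Longrightarrow> box_content q = x \<Longrightarrow> fst p \<le> fst q"
  shows "top_of S x = fst p"
proof (rule antisym)
  show "top_of S x \<le> fst p" using top_of_le[OF assms(1,2)] assms(3) by simp
  have "path_box (top_of S) x \<in> S" using assms(2,3) by (intro path_box_top_of[OF assms(1)]) auto
  then show "fst p \<le> top_of S x" using assms(4)[of "path_box (top_of S) x"] by simp
qed

text \<open>If the first rows of neighbouring diagonals differed otherwise, convexity would give one
  of the two diagonals a box above its first one.\<close>

lemma top_of_step:
  assumes fin: "finite S" and conv: "convex_boxes S" and x: "x - 1 \<in> box_content ` S" "x \<in> box_content ` S"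
  shows "top_of S x = top_of S (x - 1) \<or> top_of S x = top_of S (x - 1) - 1"
proof -
  let ?r = "top_of S (x - 1)" and ?r' = "top_of S x"
  have p: "(?r, ?r + x - 1) \<in> S" and p': "(?r', ?r' + x) \<in> S"
    using path_box_top_of[OF fin x(1)] path_box_top_of[OF fin x(2)] by (simp_all add: path_box_def algebra_simps)
  have "?r' \<le> ?r"
  proof (rule ccontr)
    assume "\<not> ?r' \<le> ?r"
    then have "(?r, ?r + x) \<in> S" by (intro convex_boxesD[OF conv p p']) (auto simp: box_le_def)
    then show False using top_of_le[OF fin, of "(?r, ?r + x)"] \<open>\<not> ?r' \<le> ?r\<close> by (simp add: box_content_def)
  qed
  moreover have "?r - 1 \<le> ?r'"
  proof (rule ccontr)
    assume "\<not> ?r - 1 \<le> ?r'"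
    then have "(?r - 1, ?r + x - 2) \<in> S" by (intro convex_boxesD[OF conv p' p]) (auto simp: box_le_def)
    then show False using top_of_le[OF fin, of "(?r - 1, ?r + x - 2)"] by (simp add: box_content_def)
  qed
  ultimately show ?thesis by linarith
qed

text \<open>The conditions of a \<open>Rightward\<close> shape in terms of order and contents. They
  survive rotation, which exchanges the two copies of \<open>W\<close>, and they hold for transposed
  \<open>Upward\<close> shapes, so everything below is done once.\<close>

definition core :: "box set \<Rightarrow> box set \<Rightarrow> box \<Rightarrow> bool" where
  "core \<gamma> W v \<longleftrightarrow> finite \<gamma> \<and> convex_boxes \<gamma> \<and> W \<subseteq> \<gamma> \<and> translate v W \<subseteq> \<gamma> \<and> convex_boxes W \<and>
     convex_boxes (\<gamma> - W) \<and> convex_boxes (\<gamma> - translate v W) \<and>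
     contiguous W \<and> contiguous (\<gamma> - W) \<and> contiguous (\<gamma> - translate v W) \<and>
     (\<exists>b\<in>W. southwesternmost \<gamma> b) \<and> (\<exists>b\<in>translate v W. northeasternmost \<gamma> b) \<and>
     (\<exists>d. (\<forall>b\<in>W. box_content b < d) \<and> (\<forall>b\<in>translate v W. d < box_content b)) \<and>
     (\<exists>r c. southwesternmost (O_part \<gamma> W v) (r, c) \<and> (r, c - 1) \<in> W) \<and>
     (\<exists>r c. northeasternmost (O_part \<gamma> W v) (r, c) \<and> (r, c + 1) \<in> translate v W)"

text \<open>The absence of loose ends, referred to \<gamma> itself. The top key ribbon begins just
  behind the last diagonal of the first \<open>O\<close>; moved back by \<open>v\<close>, a strip
  starting at \<open>s\<close> begins no earlier iff \<open>s + box_content v\<close> exceeds every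
  content of \<open>O\<close>.\<close>

definition tight :: "box set \<Rightarrow> box set \<Rightarrow> box \<Rightarrow> bool" where
  "tight \<gamma> W v \<longleftrightarrow> (\<forall>\<rho> s. lower_in \<gamma> \<rho> \<longrightarrow> bij_betw box_content \<rho> {s..<s + box_content v} \<longrightarrow>
     (\<forall>y\<in>O_part \<gamma> W v. box_content y < s + box_content v))"

text \<open>\<open>h\<close> and \<open>g\<close> are the first row of \<open>\<gamma>\<close> and the first row below \<open>\<gamma>\<close> on each of its \<open>len\<close> diagonals,
  prolonged along the boundary of a partition.\<close>

definition band_of :: "box set \<Rightarrow> int \<Rightarrow> int \<Rightarrow> (int \<Rightarrow> int) \<Rightarrow> (int \<Rightarrow> int) \<Rightarrow> bool" where
  "band_of \<gamma> x\<^sub>0 len h g \<longleftrightarrow> len > 0 \<and> lattice_path h \<and> lattice_path g \<and>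
     (\<forall>x\<le>0. h x = h 0 - x \<and> g x = g 0) \<and>
     (\<forall>x\<ge>len - 1. h x = h (len - 1) \<and> g x = g (len - 1) - (x - (len - 1))) \<and>
     (\<forall>x. 0 \<le> x \<longrightarrow> x < len \<longrightarrow> h x < g x) \<and> g 0 = h 0 + 1 \<and> g (len - 1) = h (len - 1) + 1 \<and>
     \<gamma> = {p. 0 \<le> box_content p - x\<^sub>0 \<and> box_content p - x\<^sub>0 < len \<and>
       h (box_content p - x\<^sub>0) \<le> fst p \<and> fst p < g (box_content p - x\<^sub>0)}"

lemma band_ofD:
  assumes "band_of \<gamma> x\<^sub>0 len h g"
  shows "len > 0" "lattice_path h" "lattice_path g"
    "\<And>x. x \<le> 0 \<Longrightarrow> h x = h 0 - x \<and> g x = g 0"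
    "\<And>x. len - 1 \<le> x \<Longrightarrow> h x = h (len - 1) \<and> g x = g (len - 1) - (x - (len - 1))"
    "\<And>x. 0 \<le> x \<Longrightarrow> x < len \<Longrightarrow> h x < g x" "g 0 = h 0 + 1" "g (len - 1) = h (len - 1) + 1"
    "\<And>p. p \<in> \<gamma> \<longleftrightarrow> 0 \<le> box_content p - x\<^sub>0 \<and> box_content p - x\<^sub>0 < len \<and>
       h (box_content p - x\<^sub>0) \<le> fst p \<and> fst p < g (box_content p - x\<^sub>0)"
proof -
  note * = assms[unfolded band_of_def]
  note c1 = conjunct1 and c2 = conjunct2
  show "len > 0" by (rule *[THEN c1])
  show "lattice_path h" by (rule *[THEN c2, THEN c1])
  show "lattice_path g" by (rule *[THEN c2, THEN c2, THEN c1])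
  show "h x = h 0 - x \<and> g x = g 0" if "x \<le> 0" for x
    by (rule *[THEN c2, THEN c2, THEN c2, THEN c1, rule_format, OF that])
  show "h x = h (len - 1) \<and> g x = g (len - 1) - (x - (len - 1))" if "len - 1 \<le> x" for x
    by (rule *[THEN c2, THEN c2, THEN c2, THEN c2, THEN c1, rule_format, OF that])
  show "h x < g x" if "0 \<le> x" "x < len" for x
    by (rule *[THEN c2, THEN c2, THEN c2, THEN c2, THEN c2, THEN c1, rule_format, OF that])
  show "g 0 = h 0 + 1" by (rule *[THEN c2, THEN c2, THEN c2, THEN c2, THEN c2, THEN c2, THEN c1])
  show "g (len - 1) = h (len - 1) + 1" by (rule *[THEN c2, THEN c2, THEN c2, THEN c2, THEN c2, THEN c2, THEN c2, THEN c1])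
  have "\<gamma> = {p. 0 \<le> box_content p - x\<^sub>0 \<and> box_content p - x\<^sub>0 < len \<and>
       h (box_content p - x\<^sub>0) \<le> fst p \<and> fst p < g (box_content p - x\<^sub>0)}"
    by (rule *[THEN c2, THEN c2, THEN c2, THEN c2, THEN c2, THEN c2, THEN c2, THEN c2])
  then show "p \<in> \<gamma> \<longleftrightarrow> 0 \<le> box_content p - x\<^sub>0 \<and> box_content p - x\<^sub>0 < len \<and>
       h (box_content p - x\<^sub>0) \<le> fst p \<and> fst p < g (box_content p - x\<^sub>0)" for p
    by (simp only: mem_Collect_eq)
qed

lemma band_of_rotate180:
  assumes "band_of \<gamma> x\<^sub>0 len h g"
  shows "band_of (rotate180 \<gamma>) (1 - x\<^sub>0 - len) len (\<lambda>x. 1 - g (len - 1 - x)) (\<lambda>x. 1 - h (len - 1 - x))"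
proof -
  note * = band_ofD(1-8)[OF assms] and \<gamma> = band_ofD(9)[OF assms]
  let ?h = "\<lambda>x. 1 - g (len - 1 - x)" and ?g = "\<lambda>x. 1 - h (len - 1 - x)"
  have 1: "?h x = ?h 0 - x \<and> ?g x = ?g 0" if "x \<le> 0" for x using *(5)[of "len - 1 - x"] that by auto
  have 2: "?h x = ?h (len - 1) \<and> ?g x = ?g (len - 1) - (x - (len - 1))" if "len - 1 \<le> x" for x
    using *(4)[of "len - 1 - x"] that by auto
  have 3: "?h x < ?g x" if "0 \<le> x" "x < len" for x using *(6)[of "len - 1 - x"] that by auto
  have 4: "rotate180 \<gamma> = {p. 0 \<le> box_content p - (1 - x\<^sub>0 - len) \<and> box_content p - (1 - x\<^sub>0 - len) < len \<and>
       ?h (box_content p - (1 - x\<^sub>0 - len)) \<le> fst p \<and> fst p < ?g (box_content p - (1 - x\<^sub>0 - len))}"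
  proof (rule Set.set_eqI)
    fix p
    have e: "len - 1 - (box_content p - (1 - x\<^sub>0 - len)) = box_content (- p) - x\<^sub>0" by simp
    show "p \<in> rotate180 \<gamma> \<longleftrightarrow> p \<in> {p. 0 \<le> box_content p - (1 - x\<^sub>0 - len) \<and> box_content p - (1 - x\<^sub>0 - len) < len \<and>
       ?h (box_content p - (1 - x\<^sub>0 - len)) \<le> fst p \<and> fst p < ?g (box_content p - (1 - x\<^sub>0 - len))}"
      unfolding mem_rotate180 mem_Collect_eq e \<gamma> by auto
  qed
  have 5: "?g 0 = ?h 0 + 1" "?g (len - 1) = ?h (len - 1) + 1" using *(7,8) by auto
  show ?thesis unfolding band_of_def
    by (intro conjI allI impI 4 5 *(1) lattice_path_reflect *(2,3) 3; (assumption | rule 1[THEN conjunct1] 1[THEN conjunct2] 2[THEN conjunct1] 2[THEN conjunct2])+)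
qed

locale core_shape =
  fixes \<gamma> W :: "box set" and v :: box
  assumes core: "core \<gamma> W v"
begin

abbreviation "W' \<equiv> translate v W"
abbreviation "V \<equiv> \<gamma> - W"
abbreviation "U \<equiv> \<gamma> - W'"

lemma
  shows fin: "finite \<gamma>" and conv: "convex_boxes \<gamma>" and sub: "W \<subseteq> \<gamma>" and sub': "W' \<subseteq> \<gamma>"
    and convW: "convex_boxes W" and convV: "convex_boxes V" and convU: "convex_boxes U"
    and contW: "contiguous W" and contV: "contiguous V" and contU: "contiguous U"
  using core by (simp_all add: core_def)

lemma finW: "finite W" and finW': "finite W'" and finV: "finite V" and finU: "finite U"
  using fin sub sub' finite_subset by auto

lemma convW': "convex_boxes W'" by (rule convex_translate[OF convW])

lemma O_eq: "O_part \<gamma> W v = U \<inter> V" unfolding O_part_def by blast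

definition sw :: box where "sw = (SOME b. b \<in> W \<and> southwesternmost \<gamma> b)"
definition ne :: box where "ne = (SOME b. b \<in> W' \<and> northeasternmost \<gamma> b)"

lemma sw: "sw \<in> W" "southwesternmost \<gamma> sw" and ne: "ne \<in> W'" "northeasternmost \<gamma> ne"
proof -
  have "\<exists>b. b \<in> W \<and> southwesternmost \<gamma> b" "\<exists>b. b \<in> W' \<and> northeasternmost \<gamma> b" using core by (auto simp: core_def)
  from someI_ex[OF this(1)] someI_ex[OF this(2)] show "sw \<in> W" "southwesternmost \<gamma> sw" "ne \<in> W'" "northeasternmost \<gamma> ne"
    by (simp_all add: sw_def ne_def)
qed

definition x\<^sub>0 :: int where "x\<^sub>0 = box_content sw"
definition n :: int where "n = box_content v"
text \<open>The upper copy, which contains \<open>ne\<close>, has the contents of \<open>W\<close>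
  raised by \<open>n\<close>; so this is the number of diagonals of \<open>W\<close>.\<close>

definition w :: int where "w = box_content ne - n - x\<^sub>0 + 1"

lemma ne_content: "box_content ne = x\<^sub>0 + n + w - 1" by (simp add: w_def)

lemma content_range: "p \<in> \<gamma> \<Longrightarrow> x\<^sub>0 \<le> box_content p \<and> box_content p \<le> x\<^sub>0 + n + w - 1"
proof -
  assume p: "p \<in> \<gamma>"
  have "fst p \<le> fst sw" "snd sw \<le> snd p" "fst ne \<le> fst p" "snd p \<le> snd ne"
    using sw(2) ne(2) p unfolding southwesternmost_def northeasternmost_def by blast+
  then have "box_content sw \<le> box_content p" "box_content p \<le> box_content ne"
    unfolding box_content_def by linarith+
  then show ?thesis by (simp add: ne_content x\<^sub>0_def)
qed

lemma mem_W': "p \<in> W' \<longleftrightarrow> p - v \<in> W" by (rule mem_translate)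

lemma ne_v: "ne - v \<in> W" "box_content (ne - v) = x\<^sub>0 + w - 1"
  using ne(1) ne_content by (simp_all add: mem_W' box_content_diff n_def)

lemma content_W: "p \<in> W \<Longrightarrow> x\<^sub>0 \<le> box_content p \<and> box_content p \<le> x\<^sub>0 + w - 1"
proof -
  assume p: "p \<in> W"
  then have "p + v \<in> \<gamma>" using sub' mem_W'[of "p + v"] by auto
  then show ?thesis using content_range[of p] content_range[of "p + v"] p sub by (auto simp: box_content_add n_def)
qed

lemma content_W': "p \<in> W' \<Longrightarrow> x\<^sub>0 + n \<le> box_content p \<and> box_content p \<le> x\<^sub>0 + n + w - 1"
  using content_W[of "p - v"] by (auto simp: mem_W' box_content_diff n_def)

lemma contents_W: "x\<^sub>0 \<le> x \<Longrightarrow> x \<le> x\<^sub>0 + w - 1 \<Longrightarrow> x \<in> box_content ` W"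
  using contiguousD[OF contW sw(1) ne_v(1)] ne_v(2) x\<^sub>0_def by simp

lemma contents_W': "x\<^sub>0 + n \<le> x \<Longrightarrow> x \<le> x\<^sub>0 + n + w - 1 \<Longrightarrow> x \<in> box_content ` W'"
proof -
  assume "x\<^sub>0 + n \<le> x" "x \<le> x\<^sub>0 + n + w - 1"
  then have "x - n \<in> box_content ` W" by (intro contents_W) auto
  then obtain p where "p \<in> W" "box_content p = x - n" by auto
  then show ?thesis by (intro image_eqI[of _ _ "p + v"]) (auto simp: mem_W' box_content_add n_def)
qed

lemma w_pos: "0 < w" using content_W[OF sw(1)] by linarith

lemma w_less_n: "w < n"
proof -
  obtain d where d: "\<And>b. b \<in> W \<Longrightarrow> box_content b < d" "\<And>b. b \<in> W' \<Longrightarrow> d < box_content b"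
    using core unfolding core_def by blast
  have "sw + v \<in> W'" using sw(1) by (simp add: mem_W')
  then show ?thesis using d(1)[OF ne_v(1)] d(2)[of "sw + v"] ne_v(2) by (simp add: box_content_add n_def x\<^sub>0_def)
qed

lemma disjoint: "W \<inter> W' = {}" using content_W content_W' w_less_n by fastforce

lemma sw_in_U: "sw \<in> U" and ne_in_V: "ne \<in> V" using sw(1) ne(1) disjoint sub sub' by auto

text \<open>The boxes at which \<open>O\<close> is attached. Their contents \<open>x\<^sub>1\<close>
  and \<open>x\<^sub>2\<close> are the first content of \<open>\<gamma> - W\<close> and the last one
  of \<open>\<gamma> - W'\<close> (\<open>content_V\<close>, \<open>content_U\<close>).\<close>

definition o\<^sub>1 :: box where "o\<^sub>1 = (SOME b. southwesternmost (O_part \<gamma> W v) b \<and> b - (0, 1) \<in> W)"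
definition o\<^sub>2 :: box where "o\<^sub>2 = (SOME b. northeasternmost (O_part \<gamma> W v) b \<and> b + (0, 1) \<in> W')"

lemma o1: "southwesternmost (O_part \<gamma> W v) o\<^sub>1" "o\<^sub>1 - (0, 1) \<in> W"
  and o2: "northeasternmost (O_part \<gamma> W v) o\<^sub>2" "o\<^sub>2 + (0, 1) \<in> W'"
proof -
  have "\<exists>b. southwesternmost (O_part \<gamma> W v) b \<and> b - (0, 1) \<in> W"
  proof -
    obtain r c where "southwesternmost (O_part \<gamma> W v) (r, c)" "(r, c - 1) \<in> W" using core unfolding core_def by blast
    then show ?thesis by (intro exI[of _ "(r, c)"]) simp
  qed
  from someI_ex[OF this] show "southwesternmost (O_part \<gamma> W v) o\<^sub>1" "o\<^sub>1 - (0, 1) \<in> W" by (simp_all add: o\<^sub>1_def)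
  have "\<exists>b. northeasternmost (O_part \<gamma> W v) b \<and> b + (0, 1) \<in> W'"
  proof -
    obtain r c where "northeasternmost (O_part \<gamma> W v) (r, c)" "(r, c + 1) \<in> W'" using core unfolding core_def by blast
    then show ?thesis by (intro exI[of _ "(r, c)"]) simp
  qed
  from someI_ex[OF this] show "northeasternmost (O_part \<gamma> W v) o\<^sub>2" "o\<^sub>2 + (0, 1) \<in> W'" by (simp_all add: o\<^sub>2_def)
qed

lemma o_mem: "o\<^sub>1 \<in> V" "o\<^sub>2 \<in> U" "o\<^sub>2 \<in> V"
  using o1(1) o2(1) unfolding O_eq southwesternmost_def northeasternmost_def by auto

definition x\<^sub>1 :: int where "x\<^sub>1 = box_content o\<^sub>1"
definition x\<^sub>2 :: int where "x\<^sub>2 = box_content o\<^sub>2"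

lemma x1_le: "x\<^sub>1 \<le> x\<^sub>0 + w" "x\<^sub>0 < x\<^sub>1"
  using content_W[OF o1(2)] by (simp_all add: x\<^sub>1_def box_content_def)

lemma x2_ge: "x\<^sub>0 + n \<le> x\<^sub>2 + 1" "x\<^sub>2 + 1 \<le> x\<^sub>0 + n + w - 1"
  using content_W'[OF o2(2)] by (simp_all add: x\<^sub>2_def box_content_def)

lemma content_V: "p \<in> V \<Longrightarrow> x\<^sub>1 \<le> box_content p"
proof -
  assume p: "p \<in> V"
  show ?thesis
  proof (cases "p \<in> W'")
    case True
    then show ?thesis using content_W'[OF True] x1_le w_less_n by linarith
  next
    case False
    then have "fst p \<le> fst o\<^sub>1 \<and> snd o\<^sub>1 \<le> snd p" using p o1(1) unfolding O_eq southwesternmost_def by blast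
    then show ?thesis by (simp add: x\<^sub>1_def box_content_def)
  qed
qed

lemma content_U: "p \<in> U \<Longrightarrow> box_content p \<le> x\<^sub>2"
proof -
  assume p: "p \<in> U"
  show ?thesis
  proof (cases "p \<in> W")
    case True
    then show ?thesis using content_W[OF True] x2_ge w_less_n by linarith
  next
    case False
    then have "fst o\<^sub>2 \<le> fst p \<and> snd p \<le> snd o\<^sub>2" using p o2(1) unfolding O_eq northeasternmost_def by blast
    then show ?thesis by (simp add: x\<^sub>2_def box_content_def)
  qed
qed

lemma V_at_x1: "p \<in> V \<Longrightarrow> box_content p = x\<^sub>1 \<Longrightarrow> p = o\<^sub>1"
proof -
  assume p: "p \<in> V" "box_content p = x\<^sub>1"
  then have "p \<notin> W'" using content_W'[of p] x1_le w_less_n by fastforce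
  then have "fst p \<le> fst o\<^sub>1 \<and> snd o\<^sub>1 \<le> snd p" using p(1) o1(1) unfolding O_eq southwesternmost_def by blast
  then show ?thesis using p(2) by (auto simp: x\<^sub>1_def box_content_def prod_eq_iff)
qed

lemma U_at_x2: "p \<in> U \<Longrightarrow> box_content p = x\<^sub>2 \<Longrightarrow> p = o\<^sub>2"
proof -
  assume p: "p \<in> U" "box_content p = x\<^sub>2"
  then have "p \<notin> W" using content_W[of p] x2_ge w_less_n by fastforce
  then have "fst o\<^sub>2 \<le> fst p \<and> snd p \<le> snd o\<^sub>2" using p(1) o2(1) unfolding O_eq northeasternmost_def by blast
  then show ?thesis using p(2) by (auto simp: x\<^sub>2_def box_content_def prod_eq_iff)
qed

lemma top_V_x1: "top_of V x\<^sub>1 = fst o\<^sub>1"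
proof (rule top_of_eqI[OF finV o_mem(1)])
  fix q assume "q \<in> V" "box_content q = x\<^sub>1"
  then have "q = o\<^sub>1" by (rule V_at_x1)
  then show "fst o\<^sub>1 \<le> fst q" by simp
qed (simp add: x\<^sub>1_def)

lemma top_U_x2: "top_of U x\<^sub>2 = fst o\<^sub>2"
proof (rule top_of_eqI[OF finU o_mem(2)])
  fix q assume "q \<in> U" "box_content q = x\<^sub>2"
  then have "q = o\<^sub>2" by (rule U_at_x2)
  then show "fst o\<^sub>2 \<le> fst q" by simp
qed (simp add: x\<^sub>2_def)

lemma contents_V: "x\<^sub>1 \<le> x \<Longrightarrow> x \<le> x\<^sub>0 + n + w - 1 \<Longrightarrow> x \<in> box_content ` V"
  using contiguousD[OF contV o_mem(1) ne_in_V] by (simp add: x\<^sub>1_def ne_content)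

lemma contents_U: "x\<^sub>0 \<le> x \<Longrightarrow> x \<le> x\<^sub>2 \<Longrightarrow> x \<in> box_content ` U"
  using contiguousD[OF contU sw_in_U o_mem(2)] by (simp add: x\<^sub>0_def x\<^sub>2_def)

lemma contents: "x\<^sub>0 \<le> x \<Longrightarrow> x \<le> x\<^sub>0 + n + w - 1 \<Longrightarrow> x \<in> box_content ` \<gamma>"
  using contents_U[of x] contents_V[of x] x1_le x2_ge w_less_n by (cases "x \<le> x\<^sub>2") auto

section \<open>First rows of \<gamma> and of the two copies of \<open>W\<close>\<close>

abbreviation "topp \<equiv> top_of \<gamma>"

lemma top_ne: "S \<inter> T = {} \<Longrightarrow> finite S \<Longrightarrow> finite T \<Longrightarrow> x \<in> box_content ` S \<Longrightarrow> x \<in> box_content ` T \<Longrightarrow> top_of S x \<noteq> top_of T x"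
  using path_box_top_of[of S x] path_box_top_of[of T x] unfolding path_box_def by (metis disjoint_iff)

text \<open>Two lattice paths cannot cross, so \<open>W\<close> stays northwest of the rest of \<open>\<gamma>\<close> on all common diagonals,
  since it does so on the first one.\<close>

lemma W_above_V: "x\<^sub>1 \<le> x \<Longrightarrow> x < x\<^sub>0 + w \<Longrightarrow> top_of W x < top_of V x"
proof (induction rule: int_ge_induct)
  case base
  have c: "x\<^sub>1 \<in> box_content ` W" "x\<^sub>1 - 1 \<in> box_content ` W" using base x1_le by (auto intro!: contents_W)
  have "top_of V x\<^sub>1 = fst o\<^sub>1" by (rule top_V_x1)
  moreover have "top_of W x\<^sub>1 \<le> top_of W (x\<^sub>1 - 1)" using top_of_step[OF finW convW c(2,1)] by linarith
  moreover have "top_of W (x\<^sub>1 - 1) \<le> fst o\<^sub>1"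
    using top_of_le[OF finW o1(2)] by (simp add: x\<^sub>1_def box_content_def algebra_simps)
  moreover have "top_of W x\<^sub>1 \<noteq> top_of V x\<^sub>1"
    by (rule top_ne) (use finW finV c x1_le w_less_n w_pos in \<open>auto intro!: contents_V\<close>)
  ultimately show ?case by linarith
next
  case (step x)
  have c: "x \<in> box_content ` W" "x + 1 \<in> box_content ` W" "x \<in> box_content ` V" "x + 1 \<in> box_content ` V"
    using step.hyps step.prems x1_le w_less_n w_pos by (auto intro!: contents_W contents_V)
  have "top_of W x < top_of V x" using step by auto
  moreover have "top_of W (x + 1) \<le> top_of W x" using top_of_step[OF finW convW, of "x + 1"] c by auto
  moreover have "top_of V x \<le> top_of V (x + 1) + 1" using top_of_step[OF finV convV, of "x + 1"] c by auto
  moreover have "top_of W (x + 1) \<noteq> top_of V (x + 1)" by (rule top_ne) (use finW finV c in auto)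
  ultimately show ?case by linarith
qed

lemma top_W: "x\<^sub>0 \<le> x \<Longrightarrow> x < x\<^sub>0 + w \<Longrightarrow> topp x = top_of W x"
proof -
  assume x: "x\<^sub>0 \<le> x" "x < x\<^sub>0 + w"
  then have W: "path_box (top_of W) x \<in> W" by (intro path_box_top_of[OF finW] contents_W) auto
  have "top_of W x \<le> fst q" if q: "q \<in> \<gamma>" "box_content q = x" for q
  proof (cases "q \<in> W")
    case True
    then show ?thesis using top_of_le[OF finW True] q(2) by simp
  next
    case False
    then have "q \<in> V" using q by blast
    then show ?thesis using top_of_le[OF finV, of q] content_V[of q] W_above_V[of x] x q(2) by simp
  qed
  then show ?thesis using top_of_eqI[OF fin, of "path_box (top_of W) x" x] W sub by auto
qed

text \<open>Otherwise \<open>o\<^sub>2\<close> would lie between this box and its own eastern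
  neighbour, both in the convex set \<open>W'\<close>.\<close>

lemma W'_below_o2: "q \<in> W' \<Longrightarrow> box_content q = x\<^sub>2 \<Longrightarrow> fst o\<^sub>2 < fst q"
proof (rule ccontr)
  assume q: "q \<in> W'" "box_content q = x\<^sub>2" and "\<not> fst o\<^sub>2 < fst q"
  then have "box_le q o\<^sub>2" by (auto simp: box_le_def x\<^sub>2_def box_content_def)
  moreover have "box_le o\<^sub>2 (o\<^sub>2 + (0, 1))" by (simp add: box_le_def)
  ultimately have "o\<^sub>2 \<in> W'" using convex_boxesD[OF convW' q(1) o2(2)] by blast
  then show False using o_mem by blast
qed

text \<open>The same non-crossing argument as for \<open>W_above_V\<close>, run backwards from the
  last common diagonal \<open>x\<^sub>2\<close>, where \<open>o\<^sub>2\<close> settles the relative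
  position.\<close>

lemma U_above_W': "x \<le> x\<^sub>2 \<Longrightarrow> x\<^sub>0 + n \<le> x \<Longrightarrow> top_of U x < top_of W' x"
proof (induction rule: int_le_induct)
  case base
  then have c: "x\<^sub>2 \<in> box_content ` W'" using x2_ge by (intro contents_W') auto
  have "top_of U x\<^sub>2 = fst o\<^sub>2" by (rule top_U_x2)
  moreover have "fst o\<^sub>2 < fst (path_box (top_of W') x\<^sub>2)"
    by (rule W'_below_o2[OF path_box_top_of[OF finW' c]]) simp
  ultimately show ?case by simp
next
  case (step x)
  have c: "x \<in> box_content ` W'" "x - 1 \<in> box_content ` W'" "x \<in> box_content ` U" "x - 1 \<in> box_content ` U"
    using step.hyps step.prems x2_ge w_less_n w_pos by (auto intro!: contents_W' contents_U)
  have "top_of U x < top_of W' x" using step by auto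
  moreover have "top_of U (x - 1) \<le> top_of U x + 1" using top_of_step[OF finU convU, of x] c by auto
  moreover have "top_of W' x \<le> top_of W' (x - 1)" using top_of_step[OF finW' convW', of x] c by auto
  moreover have "top_of U (x - 1) \<noteq> top_of W' (x - 1)" by (rule top_ne) (use finW' finU c in auto)
  ultimately show ?case by linarith
qed

lemma top_W'_shift: "x\<^sub>0 + n \<le> x \<Longrightarrow> x \<le> x\<^sub>0 + n + w - 1 \<Longrightarrow> top_of W' x = topp (x - n) + fst v"
proof -
  assume x: "x\<^sub>0 + n \<le> x" "x \<le> x\<^sub>0 + n + w - 1"
  let ?p = "path_box (top_of W) (x - n)"
  have p: "?p \<in> W" using x by (intro path_box_top_of[OF finW] contents_W) auto
  have "top_of W' x = fst (?p + v)"
  proof (rule top_of_eqI[OF finW'])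
    show "?p + v \<in> W'" using p by (simp add: mem_W')
    show "box_content (?p + v) = x" by (simp add: box_content_add n_def)
    fix q assume "q \<in> W'" "box_content q = x"
    then show "fst (?p + v) \<le> fst q"
      using top_of_le[OF finW, of "q - v"] by (simp add: mem_W' box_content_diff n_def)
  qed
  then show ?thesis using top_W[of "x - n"] x by simp
qed

lemma top_above: "x\<^sub>0 + n \<le> x \<Longrightarrow> x \<le> x\<^sub>2 \<Longrightarrow> topp x < topp (x - n) + fst v"
proof -
  assume x: "x\<^sub>0 + n \<le> x" "x \<le> x\<^sub>2"
  have "path_box (top_of U) x \<in> U" using x w_less_n w_pos by (intro path_box_top_of[OF finU] contents_U) auto
  then have "topp x \<le> top_of U x" using top_of_le[OF fin, of "path_box (top_of U) x"] by auto
  then show ?thesis using U_above_W'[OF x(2,1)] top_W'_shift[of x] x x2_ge by simp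
qed

lemma top_beyond: "x\<^sub>2 < x \<Longrightarrow> x \<le> x\<^sub>0 + n + w - 1 \<Longrightarrow> topp x = top_of W' x"
proof -
  assume x: "x\<^sub>2 < x" "x \<le> x\<^sub>0 + n + w - 1"
  have "{p \<in> \<gamma>. box_content p = x} = {p \<in> W'. box_content p = x}" using content_U[of _] x sub' by fastforce
  then show ?thesis by (simp add: top_of_def)
qed

lemma top_x2: "topp x\<^sub>2 = fst o\<^sub>2"
proof (rule top_of_eqI[OF fin])
  show "o\<^sub>2 \<in> \<gamma>" "box_content o\<^sub>2 = x\<^sub>2" using o_mem by (auto simp: x\<^sub>2_def)
  fix q assume q: "q \<in> \<gamma>" "box_content q = x\<^sub>2"
  show "fst o\<^sub>2 \<le> fst q"
  proof (cases "q \<in> W'")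
    case True
    then show ?thesis using W'_below_o2[OF True q(2)] by simp
  next
    case False
    then show ?thesis using U_at_x2[of q] q by simp
  qed
qed

text \<open>An upward step would put the northern neighbour of \<open>o\<^sub>2\<close> into
  \<open>W'\<close>; the eastern one is there already, so by convexity \<open>o\<^sub>2\<close>
  would be in \<open>W'\<close> as well.\<close>

lemma top_step_out: "topp (x\<^sub>2 + 1) = topp x\<^sub>2"
proof -
  have c: "x\<^sub>2 \<in> box_content ` \<gamma>" "x\<^sub>2 + 1 \<in> box_content ` \<gamma>" using x2_ge w_less_n w_pos by (auto intro!: contents)
  have c': "x\<^sub>2 + 1 \<in> box_content ` W'" using x2_ge by (intro contents_W') auto
  have e: "topp (x\<^sub>2 + 1) = top_of W' (x\<^sub>2 + 1)" using x2_ge by (intro top_beyond) auto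
  have "topp (x\<^sub>2 + 1) \<noteq> topp x\<^sub>2 - 1"
  proof
    assume "topp (x\<^sub>2 + 1) = topp x\<^sub>2 - 1"
    then have "top_of W' (x\<^sub>2 + 1) = fst o\<^sub>2 - 1" using e top_x2 by simp
    moreover have "path_box (top_of W') (x\<^sub>2 + 1) \<in> W'" by (rule path_box_top_of[OF finW' c'])
    ultimately have q: "o\<^sub>2 - (1, 0) \<in> W'" by (simp add: path_box_def x\<^sub>2_def box_content_def minus_prod_def)
    have "o\<^sub>2 \<in> W'" by (rule convex_boxesD[OF convW' q o2(2)]) (auto simp: box_le_def)
    then show False using o_mem by blast
  qed
  then show ?thesis using top_of_step[OF fin conv, of "x\<^sub>2 + 1"] c by auto
qed

text \<open>Behind the last diagonal of \<open>W\<close> the first row belongs to the rest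
  \<open>V\<close>. This either runs strictly below \<open>W\<close> before that point or begins
  there with \<open>o\<^sub>1\<close>, whose western neighbour is in \<open>W\<close>; neither
  allows an upward step.\<close>

lemma top_step_in: "topp (x\<^sub>0 + w) = topp (x\<^sub>0 + w - 1)"
proof -
  have c: "x\<^sub>0 + w - 1 \<in> box_content ` \<gamma>" "x\<^sub>0 + w \<in> box_content ` \<gamma>" using w_less_n w_pos by (auto intro!: contents)
  have step: "topp (x\<^sub>0 + w) \<le> topp (x\<^sub>0 + w - 1)" using top_of_step[OF fin conv c] by linarith
  have "{p \<in> \<gamma>. box_content p = x\<^sub>0 + w} = {p \<in> V. box_content p = x\<^sub>0 + w}" using content_W by fastforce
  then have e: "topp (x\<^sub>0 + w) = top_of V (x\<^sub>0 + w)" by (simp add: top_of_def)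
  have e': "topp (x\<^sub>0 + w - 1) = top_of W (x\<^sub>0 + w - 1)" using w_pos by (intro top_W) auto
  have "top_of W (x\<^sub>0 + w - 1) \<le> top_of V (x\<^sub>0 + w)"
  proof (cases "x\<^sub>1 = x\<^sub>0 + w")
    case True
    have "top_of V x\<^sub>1 = fst o\<^sub>1" by (rule top_V_x1)
    moreover have "top_of W (x\<^sub>1 - 1) \<le> fst o\<^sub>1"
      using top_of_le[OF finW o1(2)] by (simp add: x\<^sub>1_def box_content_def algebra_simps)
    ultimately show ?thesis using True by simp
  next
    case False
    then have x: "x\<^sub>1 \<le> x\<^sub>0 + w - 1" using x1_le by simp
    have "x\<^sub>0 + w - 1 \<in> box_content ` V" "x\<^sub>0 + w \<in> box_content ` V"
      using x w_less_n w_pos by (auto intro!: contents_V)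
    then have "top_of V (x\<^sub>0 + w - 1) - 1 \<le> top_of V (x\<^sub>0 + w)" using top_of_step[OF finV convV, of "x\<^sub>0 + w"] by linarith
    then show ?thesis using W_above_V[OF x] by simp
  qed
  then show ?thesis using step e e' by linarith
qed

lemma band_row:
  assumes "band_of \<gamma> y len h g"
  shows "y = x\<^sub>0" "len = n + w" "\<And>x. 0 \<le> x \<Longrightarrow> x < n + w \<Longrightarrow> h x = topp (x\<^sub>0 + x)"
proof -
  note l = band_ofD(1)[OF assms] and ne = band_ofD(6)[OF assms] and \<gamma> = band_ofD(9)[OF assms]
  have box: "(h x, h x + x + y) \<in> \<gamma>" if "0 \<le> x" "x < len" for x
    using that ne[OF that] by (simp add: \<gamma> box_content_def)
  have swc: "0 \<le> x\<^sub>0 - y" and nec: "x\<^sub>0 + n + w - 1 - y < len"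
    using \<gamma>[of sw] \<gamma>[of ne] sw(1) ne_in_V sub ne_content by (auto simp: x\<^sub>0_def)
  have "x\<^sub>0 \<le> y" using content_range[OF box[of 0]] l by (simp add: box_content_def)
  then show y: "y = x\<^sub>0" using swc by simp
  have "len - 1 + y \<le> x\<^sub>0 + n + w - 1" using content_range[OF box[of "len - 1"]] l by (simp add: box_content_def)
  then show l: "len = n + w" using nec y by simp
  show "h x = topp (x\<^sub>0 + x)" if "0 \<le> x" "x < n + w" for x
  proof -
    have "topp (x\<^sub>0 + x) = fst (h x, h x + x + y)"
      by (rule top_of_eqI[OF fin box]) (use that l y in \<open>auto simp: \<gamma> box_content_def\<close>)
    then show ?thesis by simp
  qed
qed

lemma band_is_corner_band:
  assumes band: "band_of \<gamma> y len h g" and tight: "tight \<gamma> W v" and ab: "2 \<le> a" "2 \<le> b"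
  shows "\<exists>t. corner_band h g n (len - n) t (fst v) a b"
proof -
  note y = band_row(1)[OF band] and l = band_row(2)[OF band] and row = band_row(3)[OF band]
  note * = band_ofD(2-8)[OF band] and \<gamma> = band_ofD(9)[OF band]
  \<comment> \<open>The number of diagonals of the upper \<open>W\<close> that \<open>O\<close> also
    meets.\<close>
  define t where "t = x\<^sub>2 + 1 - x\<^sub>0 - n"
  have t: "0 \<le> t" "t < w" "x\<^sub>0 + (n + t) = x\<^sub>2 + 1" "x\<^sub>0 + (n + t - 1) = x\<^sub>2" using x2_ge by (auto simp: t_def)
  have lw: "len - n = w" using l by simp
  have "corner_band h g n w t (fst v) a b"
  proof
    show "lattice_path h" "2 \<le> a" "2 \<le> b" "0 \<le> t" "t < w" "w < n" "g 0 = h 0 + 1" by (fact * ab t w_less_n)+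
    show "g (n + w - 1) = h (n + w - 1) + 1" using *(7) l by simp
    show "h x = h 0 - x" if "x \<le> 0" for x using *(3)[OF that] by blast
    show "h x = h (n + w - 1)" if "n + w - 1 \<le> x" for x using *(4)[of x] that l by simp
    show "h x < g x" if "0 \<le> x" "x < n + w" for x using *(5)[of x] that l by simp
    show "h x < h (x - n) + fst v" if x: "n \<le> x" "x < n + t" for x
    proof -
      have "topp (x\<^sub>0 + x) < topp (x\<^sub>0 + x - n) + fst v" using x t by (intro top_above) auto
      moreover have "topp (x\<^sub>0 + (x - n)) = topp (x\<^sub>0 + x - n)" by (simp add: add_diff_eq)
      moreover have "h x = topp (x\<^sub>0 + x)" "h (x - n) = topp (x\<^sub>0 + (x - n))"
        using x t w_less_n w_pos by (intro row; linarith)+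
      ultimately show ?thesis by linarith
    qed
    show "h x = h (x - n) + fst v" if x: "n + t \<le> x" "x < n + w" for x
    proof -
      have "topp (x\<^sub>0 + x) = top_of W' (x\<^sub>0 + x)" using x t by (intro top_beyond) auto
      also have "\<dots> = topp (x\<^sub>0 + x - n) + fst v" using x t by (intro top_W'_shift) auto
      moreover have "topp (x\<^sub>0 + (x - n)) = topp (x\<^sub>0 + x - n)" by (simp add: add_diff_eq)
      moreover have "h x = topp (x\<^sub>0 + x)" "h (x - n) = topp (x\<^sub>0 + (x - n))"
        using x t w_less_n w_pos by (intro row; linarith)+
      ultimately show ?thesis by linarith
    qed
    show "h (n + t) = h (n + t - 1)"
      using row[of "n + t"] row[of "n + t - 1"] t w_less_n w_pos top_step_out by simp
    show "h w = h (w - 1)"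
      using row[of w] row[of "w - 1"] w_less_n w_pos top_step_in by (simp add: algebra_simps)
    show "h x + fst v < g (x + n)" if x: "0 \<le> x" "x < w" for x
    proof -
      have "x\<^sub>0 + x \<in> box_content ` W" using x by (intro contents_W) auto
      then obtain p where p: "p \<in> W" "box_content p = x\<^sub>0 + x" by auto
      then have "p \<in> \<gamma>" "p + v \<in> \<gamma>" using sub sub' mem_W'[of "p + v"] by auto
      moreover have "x\<^sub>0 + x + n - x\<^sub>0 = x + n" by simp
      ultimately show ?thesis using p(2) unfolding \<gamma> by (simp add: y box_content_add n_def[symmetric])
    qed
    \<comment> \<open>The path strip from \<open>s\<close> could be taken out of \<gamma>, but for
      \<open>s < t\<close> it stops before the diagonal of \<open>o\<^sub>2\<close>, against
      \<open>tight\<close>.\<close>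
    show False if s: "0 \<le> s" "s < t" "h s = h (s - 1) - 1" "h (s + n) = h (s + n - 1)" for s
    proof -
      define f where "f x = h (x - x\<^sub>0)" for x
      let ?s = "x\<^sub>0 + s"
      have n0: "0 < n" using w_less_n w_pos by simp
      have f: "lattice_path f" unfolding f_def lattice_path_def
      proof
        fix x show "h (x + 1 - x\<^sub>0) = h (x - x\<^sub>0) \<or> h (x + 1 - x\<^sub>0) = h (x - x\<^sub>0) - 1"
          using lattice_path_step[OF *(1), of "x + 1 - x\<^sub>0"] by simp
      qed
      have fs: "f ?s = f (?s - 1) - 1" "f (?s + n) = f (?s + n - 1)" using s(3,4) by (simp_all add: f_def algebra_simps)
      have "path_strip f ?s n \<subseteq> \<gamma>"
        unfolding path_strip_subset_iff
      proof (intro allI impI)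
        fix x assume x: "?s \<le> x" "x < ?s + n"
        show "path_box f x \<in> \<gamma>" using x s t *(5)[of "x - x\<^sub>0"] l by (simp add: \<gamma> y f_def)
      qed
      then have "lower_in \<gamma> (path_strip f ?s n)"
        by (rule lower_in_path_strip[OF f n0 fs]) (simp add: \<gamma> y f_def)
      moreover have "o\<^sub>2 \<in> O_part \<gamma> W v" using o_mem by (simp add: O_eq)
      ultimately have "box_content o\<^sub>2 < ?s + n"
        using tight bij_betw_path_strip[of f ?s n] unfolding tight_def n_def[symmetric] by blast
      then show False using s t by (simp add: x\<^sub>2_def[symmetric])
    qed
  qed
  then show ?thesis using lw by auto
qed

end

section \<open>Key ribbons\<close>

lemma convex_rotate180: "convex_boxes S \<Longrightarrow> convex_boxes (rotate180 S)"
proof (rule convex_boxesI)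
  fix x y z assume "convex_boxes S" "x \<in> rotate180 S" "y \<in> rotate180 S" "box_le x z" "box_le z y"
  then show "z \<in> rotate180 S"
    using convex_boxesD[of S "- y" "- x" "- z"] by (simp add: mem_rotate180 box_le_uminus)
qed

lemma contiguous_rotate180: "contiguous S \<Longrightarrow> contiguous (rotate180 S)"
  unfolding contiguous_def
proof (intro ballI allI impI)
  fix p q x assume S: "\<forall>p\<in>S. \<forall>q\<in>S. \<forall>x. box_content p \<le> x \<longrightarrow> x \<le> box_content q \<longrightarrow> x \<in> box_content ` S"
    and pq: "p \<in> rotate180 S" "q \<in> rotate180 S" and x: "box_content p \<le> x" "x \<le> box_content q"
  have "- x \<in> box_content ` S"
    using S[rule_format, of "- q" "- p" "- x"] pq x by (simp add: mem_rotate180)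
  then obtain z where "z \<in> S" "box_content z = - x" by auto
  then show "x \<in> box_content ` rotate180 S"
    by (intro image_eqI[of _ _ "- z"]) (auto simp: mem_rotate180)
qed

lemma rotate180_Diff: "rotate180 (S - T) = rotate180 S - rotate180 T"
  by (rule Set.set_eqI) (simp add: mem_rotate180)

lemma rotate180_mono: "S \<subseteq> T \<Longrightarrow> rotate180 S \<subseteq> rotate180 T"
  by (auto simp: mem_rotate180)

lemma translate_rotate180_translate: "translate v (rotate180 (translate v W)) = rotate180 W"
  by (rule Set.set_eqI) (simp add: mem_translate mem_rotate180)

lemma O_part_rotate180: "O_part (rotate180 \<gamma>) (rotate180 (translate v W)) v = rotate180 (O_part \<gamma> W v)"
  unfolding O_part_def translate_rotate180_translate rotate180_Diff by blast

lemma southwesternmost_rotate180: "southwesternmost (rotate180 S) b \<longleftrightarrow> northeasternmost S (- b)"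
  and northeasternmost_rotate180: "northeasternmost (rotate180 S) b \<longleftrightarrow> southwesternmost S (- b)"
proof -
  have all: "(\<forall>x\<in>rotate180 S. P x) \<longleftrightarrow> (\<forall>x\<in>S. P (- x))" for P
    unfolding rotate180_def by blast
  show "southwesternmost (rotate180 S) b \<longleftrightarrow> northeasternmost S (- b)"
    "northeasternmost (rotate180 S) b \<longleftrightarrow> southwesternmost S (- b)"
    unfolding southwesternmost_def northeasternmost_def all by (auto simp: mem_rotate180)
qed

text \<open>The rotated upper copy becomes the lower one, so the displacement is again
  \<open>v\<close>, and the attachments in the west and in the east change places.\<close>

lemma core_rotate180:
  assumes "core \<gamma> W v"
  shows "core (rotate180 \<gamma>) (rotate180 (translate v W)) v"
proof -
  interpret core_shape \<gamma> W v by unfold_locales (rule assms)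
  have U: "rotate180 \<gamma> - rotate180 W' = rotate180 U" "rotate180 \<gamma> - rotate180 W = rotate180 V"
    by (simp_all add: rotate180_Diff)
  have 1: "\<exists>b\<in>rotate180 W'. southwesternmost (rotate180 \<gamma>) b"
    by (rule bexI[of _ "- ne"]) (use ne in \<open>simp_all add: southwesternmost_rotate180 mem_rotate180\<close>)
  have 2: "\<exists>b\<in>rotate180 W. northeasternmost (rotate180 \<gamma>) b"
    by (rule bexI[of _ "- sw"]) (use sw in \<open>simp_all add: northeasternmost_rotate180 mem_rotate180\<close>)
  obtain d where d: "\<forall>b\<in>W. box_content b < d" "\<forall>b\<in>W'. d < box_content b"
    using core unfolding core_def by blast
  have 3: "\<exists>d. (\<forall>b\<in>rotate180 W'. box_content b < d) \<and> (\<forall>b\<in>rotate180 W. d < box_content b)"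
  proof (intro exI[of _ "- d"] conjI ballI)
    fix b assume "b \<in> rotate180 W'"
    then show "box_content b < - d" using d(2)[rule_format, of "- b"] by (simp add: mem_rotate180)
  next
    fix b assume "b \<in> rotate180 W"
    then show "- d < box_content b" using d(1)[rule_format, of "- b"] by (simp add: mem_rotate180)
  qed
  have 4: "\<exists>r c. southwesternmost (rotate180 (O_part \<gamma> W v)) (r, c) \<and> (r, c - 1) \<in> rotate180 W'"
    by (rule exI[of _ "- fst o\<^sub>2"], rule exI[of _ "- snd o\<^sub>2"])
      (use o2 in \<open>simp add: southwesternmost_rotate180 mem_rotate180 plus_prod_def algebra_simps\<close>)
  have 5: "\<exists>r c. northeasternmost (rotate180 (O_part \<gamma> W v)) (r, c) \<and> (r, c + 1) \<in> rotate180 W"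
    by (rule exI[of _ "- fst o\<^sub>1"], rule exI[of _ "- snd o\<^sub>1"])
      (use o1 in \<open>simp add: northeasternmost_rotate180 mem_rotate180 minus_prod_def algebra_simps\<close>)
  have contW': "contiguous W'"
    unfolding contiguous_def
  proof (intro ballI allI impI)
    fix p q x assume "p \<in> W'" "q \<in> W'" "box_content p \<le> x" "x \<le> box_content q"
    then show "x \<in> box_content ` W'" using content_W'[of p] content_W'[of q] by (intro contents_W') auto
  qed
  show ?thesis
    unfolding core_def translate_rotate180_translate O_part_rotate180 U
    by (intro conjI 1 2 3 4 5 convex_rotate180 contiguous_rotate180 rotate180_mono sub sub' convW' conv convU convV
        contU contV contW')
      (use fin in simp)
qed

context core_shape
begin

text \<open>The last row on a diagonal, defined through the rotated shape so that the facts about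
  \<open>top_of\<close> apply.\<close>

definition bot :: "int \<Rightarrow> int" where "bot x = - top_of (rotate180 \<gamma>) (- x)"

lemma bot_ge: "p \<in> \<gamma> \<Longrightarrow> fst p \<le> bot (box_content p)"
  using top_of_le[of "rotate180 \<gamma>" "- p"] fin by (simp add: mem_rotate180 bot_def)

lemma path_box_bot: "x \<in> box_content ` \<gamma> \<Longrightarrow> path_box bot x \<in> \<gamma>"
proof -
  assume "x \<in> box_content ` \<gamma>"
  then obtain p where "p \<in> \<gamma>" "box_content p = x" by auto
  then have "- x \<in> box_content ` rotate180 \<gamma>"
    by (intro image_eqI[of _ _ "- p"]) (auto simp: mem_rotate180)
  then have "path_box (top_of (rotate180 \<gamma>)) (- x) \<in> rotate180 \<gamma>" using fin by (intro path_box_top_of) simp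
  then show ?thesis by (simp add: mem_rotate180 path_box_def bot_def)
qed

lemma bot_step: "x - 1 \<in> box_content ` \<gamma> \<Longrightarrow> x \<in> box_content ` \<gamma> \<Longrightarrow> bot x = bot (x - 1) \<or> bot x = bot (x - 1) - 1"
proof -
  assume x: "x - 1 \<in> box_content ` \<gamma>" "x \<in> box_content ` \<gamma>"
  have "- y \<in> box_content ` rotate180 \<gamma>" if y: "y \<in> box_content ` \<gamma>" for y
  proof -
    obtain p where "p \<in> \<gamma>" "box_content p = y" using y by auto
    then show ?thesis by (intro image_eqI[of _ _ "- p"]) (auto simp: mem_rotate180)
  qed
  then have "- (x - 1) - 1 \<in> box_content ` rotate180 \<gamma>" "- (x - 1) \<in> box_content ` rotate180 \<gamma>"
    using x by force+
  from top_of_step[OF _ convex_rotate180[OF conv] this] show ?thesis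
    using fin by (auto simp: bot_def)
qed

lemma top_bot_x0: "topp x\<^sub>0 = bot x\<^sub>0" and top_bot_end: "topp (x\<^sub>0 + n + w - 1) = bot (x\<^sub>0 + n + w - 1)"
proof -
  have sw1: "p = sw" if p: "p \<in> \<gamma>" "box_content p = x\<^sub>0" for p
  proof -
    have "fst p \<le> fst sw" "snd sw \<le> snd p" using p(1) sw(2) unfolding southwesternmost_def by blast+
    then show ?thesis using p(2) by (simp add: x\<^sub>0_def box_content_def prod_eq_iff)
  qed
  have ne1: "p = ne" if p: "p \<in> \<gamma>" "box_content p = x\<^sub>0 + n + w - 1" for p
  proof -
    have "fst ne \<le> fst p" "snd p \<le> snd ne" using p(1) ne(2) unfolding northeasternmost_def by blast+
    then show ?thesis using p(2) unfolding ne_content[symmetric] by (simp add: box_content_def prod_eq_iff)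
  qed
  have c: "x\<^sub>0 \<in> box_content ` \<gamma>" "x\<^sub>0 + n + w - 1 \<in> box_content ` \<gamma>" using w_pos w_less_n by (auto intro!: contents)
  have "path_box topp x\<^sub>0 = path_box bot x\<^sub>0"
    using sw1[OF path_box_top_of[OF fin c(1)]] sw1[OF path_box_bot[OF c(1)]] by simp
  then show "topp x\<^sub>0 = bot x\<^sub>0" by (simp add: path_box_def)
  have "path_box topp (x\<^sub>0 + n + w - 1) = path_box bot (x\<^sub>0 + n + w - 1)"
    using ne1[OF path_box_top_of[OF fin c(2)]] ne1[OF path_box_bot[OF c(2)]] by simp
  then show "topp (x\<^sub>0 + n + w - 1) = bot (x\<^sub>0 + n + w - 1)" by (simp add: path_box_def)
qed

lemma band_exists: "\<exists>h g. band_of \<gamma> x\<^sub>0 (n + w) h g"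
proof -
  \<comment> \<open>\<open>clip\<close> freezes the argument at the first and last diagonal. The
    correction terms in \<open>h\<close> and \<open>g\<close> make the upper path vertical on the
    left and the lower one vertical on the right, so the continued paths enclose nothing.\<close>
  define clip where "clip x = max 0 (min (n + w - 1) x)" for x
  define h where "h x = topp (x\<^sub>0 + clip x) + (clip x - min (n + w - 1) x)" for x
  define g where "g x = bot (x\<^sub>0 + clip x) + 1 - (max 0 x - clip x)" for x
  have l: "0 < n + w" using w_pos w_less_n by simp
  have clip: "x\<^sub>0 + clip x \<in> box_content ` \<gamma>" for x using l by (intro contents) (auto simp: clip_def)
  have mid: "clip x = x" if "0 \<le> x" "x < n + w" for x using that by (simp add: clip_def)
  have inner: "h x = topp (x\<^sub>0 + x)" "g x = bot (x\<^sub>0 + x) + 1" if "0 \<le> x" "x < n + w" for x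
    using that mid[OF that] by (simp_all add: h_def g_def)
  have steps: "(h (x + 1) = h x \<or> h (x + 1) = h x - 1) \<and> (g (x + 1) = g x \<or> g (x + 1) = g x - 1)" for x
  proof -
    consider "x + 1 \<le> 0" | "n + w \<le> x + 1" | "0 \<le> x" "x + 1 < n + w" by linarith
    then show ?thesis
    proof cases
      case 1
      then have "clip (x + 1) = 0" "clip x = 0" by (auto simp: clip_def)
      then show ?thesis using 1 l by (auto simp: h_def g_def)
    next
      case 2
      then have "clip (x + 1) = n + w - 1" "clip x = n + w - 1" using l by (auto simp: clip_def)
      then show ?thesis using 2 l by (auto simp: h_def g_def)
    next
      case 3
      have c: "x\<^sub>0 + x \<in> box_content ` \<gamma>" "x\<^sub>0 + (x + 1) \<in> box_content ` \<gamma>" using clip[of x] clip[of "x + 1"] mid 3 by auto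
      have e: "x\<^sub>0 + (x + 1) - 1 = x\<^sub>0 + x" by simp
      show ?thesis
        using top_of_step[OF fin conv, of "x\<^sub>0 + (x + 1)", unfolded e, OF c] bot_step[of "x\<^sub>0 + (x + 1)", unfolded e, OF c]
          inner[of x] inner[of "x + 1"] 3 by auto
    qed
  qed
  have \<gamma>: "p \<in> \<gamma> \<longleftrightarrow> 0 \<le> box_content p - x\<^sub>0 \<and> box_content p - x\<^sub>0 < n + w \<and>
       h (box_content p - x\<^sub>0) \<le> fst p \<and> fst p < g (box_content p - x\<^sub>0)" for p
  proof
    assume p: "p \<in> \<gamma>"
    have r: "0 \<le> box_content p - x\<^sub>0" "box_content p - x\<^sub>0 < n + w" using content_range[OF p] by auto
    then show "0 \<le> box_content p - x\<^sub>0 \<and> box_content p - x\<^sub>0 < n + w \<and>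
       h (box_content p - x\<^sub>0) \<le> fst p \<and> fst p < g (box_content p - x\<^sub>0)"
      using top_of_le[OF fin p] bot_ge[OF p] inner[OF r] by simp
  next
    assume a: "0 \<le> box_content p - x\<^sub>0 \<and> box_content p - x\<^sub>0 < n + w \<and>
       h (box_content p - x\<^sub>0) \<le> fst p \<and> fst p < g (box_content p - x\<^sub>0)"
    then have r: "topp (box_content p) \<le> fst p" "fst p \<le> bot (box_content p)" using inner[of "box_content p - x\<^sub>0"] by auto
    have c: "box_content p \<in> box_content ` \<gamma>" using a by (intro contents) auto
    show "p \<in> \<gamma>"
      by (rule convex_boxesD[OF conv path_box_top_of[OF fin c] path_box_bot[OF c]])
        (use r in \<open>auto simp: box_le_def path_box_def box_content_def\<close>)
  qed
  have ne: "h x < g x" if x: "0 \<le> x" "x < n + w" for x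
  proof -
    have "x\<^sub>0 + x \<in> box_content ` \<gamma>" using clip[of x] mid[OF x] by simp
    from bot_ge[OF path_box_top_of[OF fin this]] show ?thesis using inner[OF x] by simp
  qed
  have "band_of \<gamma> x\<^sub>0 (n + w) h g"
    unfolding band_of_def
  proof (intro conjI allI impI)
    show "lattice_path h" "lattice_path g" using steps by (simp_all add: lattice_path_def)
    show "h x = h 0 - x" "g x = g 0" if "x \<le> 0" for x
      using that l by (simp_all add: h_def g_def clip_def)
    show "h x = h (n + w - 1)" "g x = g (n + w - 1) - (x - (n + w - 1))" if "n + w - 1 \<le> x" for x
      using that l by (simp_all add: h_def g_def clip_def)
    show "g 0 = h 0 + 1" using inner[of 0] l top_bot_x0 by simp
    show "g (n + w - 1) = h (n + w - 1) + 1" using inner[of "n + w - 1"] l top_bot_end by (simp add: algebra_simps)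
    show "\<gamma> = {p. 0 \<le> box_content p - x\<^sub>0 \<and> box_content p - x\<^sub>0 < n + w \<and>
       h (box_content p - x\<^sub>0) \<le> fst p \<and> fst p < g (box_content p - x\<^sub>0)}"
      by (rule Set.set_eqI) (simp only: \<gamma> mem_Collect_eq)
  qed (use l ne in auto)
  then show ?thesis by blast
qed

section \<open>The key ribbon in the amalgamation of two copies\<close>

abbreviation "top_ribbon \<equiv> upper_left_ribbon (amalg \<gamma> v)"

lemma mem_amalg: "p \<in> amalg \<gamma> v \<longleftrightarrow> p \<in> \<gamma> \<or> p - v \<in> \<gamma>"
  by (simp add: amalg_def amalg_shift_def mem_translate)

lemma mem_top_ribbon: "p \<in> top_ribbon \<longleftrightarrow> (p \<in> \<gamma> \<or> p - v \<in> \<gamma>) \<and> p - (1, 1) \<notin> \<gamma> \<and> p - (1, 1) - v \<notin> \<gamma>"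
proof -
  have e: "p + (- 1, - 1) = p - (1, 1)" by (simp add: prod_eq_iff)
  show ?thesis unfolding upper_left_ribbon_def mem_Collect_eq mem_amalg e by blast
qed

lemma amalg_beyond: "p \<in> \<gamma> \<Longrightarrow> x\<^sub>2 < box_content p \<Longrightarrow> p - v \<in> \<gamma>"
proof -
  assume p: "p \<in> \<gamma>" "x\<^sub>2 < box_content p"
  then have "p \<in> W'" using content_U[of p] by fastforce
  then show ?thesis using sub by (auto simp: mem_W')
qed

lemma content_11: "box_content (p - (1, 1)) = box_content p"
  by (simp add: box_content_def)

text \<open>Behind \<open>x\<^sub>2\<close> the first copy consists only of its upper
  \<open>W\<close>, which also belongs to the second copy. The upper left ribbon is therefore the
  first row of the second copy there.\<close>

lemma top_ribbon_at:
  assumes p: "x\<^sub>2 < box_content p" "box_content p \<le> x\<^sub>2 + n"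
  shows "p \<in> top_ribbon \<longleftrightarrow> p - v = path_box topp (box_content p - n)"
proof
  have c: "box_content p - n \<in> box_content ` \<gamma>" using p x2_ge w_pos w_less_n by (intro contents) auto
  show "p \<in> top_ribbon" if eq: "p - v = path_box topp (box_content p - n)"
  proof -
    have "p - v \<in> \<gamma>" unfolding eq by (rule path_box_top_of[OF fin c])
    moreover have nv: "p - (1, 1) - v \<notin> \<gamma>"
    proof
      assume a: "p - (1, 1) - v \<in> \<gamma>"
      have "box_content (p - (1, 1) - v) = box_content p - n" by (simp add: box_content_def n_def)
      then have "topp (box_content p - n) \<le> fst (p - (1, 1) - v)" using top_of_le[OF fin a] by simp
      moreover have "fst (p - v) = topp (box_content p - n)" using eq by simp
      ultimately show False by simp
    qed
    moreover have "p - (1, 1) \<notin> \<gamma>" using amalg_beyond[of "p - (1, 1)"] nv p(1) content_11[of p] by auto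
    ultimately show ?thesis by (simp add: mem_top_ribbon)
  qed
  assume "p \<in> top_ribbon"
  then have pv: "p - v \<in> \<gamma>" and n: "p - (1, 1) - v \<notin> \<gamma>" using amalg_beyond[of p] p(1) by (auto simp: mem_top_ribbon)
  have ce: "box_content (p - v) = box_content p - n" by (simp add: box_content_diff n_def)
  have "\<not> topp (box_content p - n) < fst (p - v)"
  proof
    assume a: "topp (box_content p - n) < fst (p - v)"
    have "p - (1, 1) - v \<in> \<gamma>"
      by (rule convex_boxesD[OF conv path_box_top_of[OF fin c] pv])
        (use a ce in \<open>auto simp: box_le_def path_box_def box_content_def\<close>)
    then show False using n by simp
  qed
  moreover have "topp (box_content p - n) \<le> fst (p - v)" using top_of_le[OF fin pv] ce by simp
  ultimately show "p - v = path_box topp (box_content p - n)" by (simp add: path_box_eq_iff ce)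
qed

lemma o2_top_ribbon: "o\<^sub>2 \<in> top_ribbon"
proof -
  have g: "o\<^sub>2 \<in> \<gamma>" using o_mem by blast
  have "o\<^sub>2 - (1, 1) \<notin> \<gamma>"
    using top_of_le[OF fin, of "o\<^sub>2 - (1, 1)"] top_x2 content_11[of "o\<^sub>2"] by (auto simp: x\<^sub>2_def)
  moreover have "o\<^sub>2 - (1, 1) - v \<notin> \<gamma>"
  proof
    assume a: "o\<^sub>2 - (1, 1) - v \<in> \<gamma>"
    have ce: "box_content (o\<^sub>2 - (1, 1) - v) = x\<^sub>2 - n" by (simp add: box_content_def n_def x\<^sub>2_def)
    then have x: "x\<^sub>0 + n \<le> x\<^sub>2" "x\<^sub>2 \<le> x\<^sub>0 + n + w - 1" using content_range[OF a] x2_ge by auto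
    have "topp (x\<^sub>2 - n) \<le> fst o\<^sub>2 - 1 - fst v" using top_of_le[OF fin a] ce by simp
    then have "top_of W' x\<^sub>2 < fst o\<^sub>2" using top_W'_shift[OF x] by simp
    moreover have "fst o\<^sub>2 < fst (path_box (top_of W') x\<^sub>2)"
      by (rule W'_below_o2[OF path_box_top_of[OF finW' contents_W'[OF x]]]) simp
    ultimately show False by simp
  qed
  ultimately show ?thesis using g by (simp add: mem_top_ribbon)
qed

lemma content_O: "p \<in> O_part \<gamma> W v \<Longrightarrow> box_content p \<le> x\<^sub>2"
  using content_U[of p] by (simp add: O_eq)

lemma o2_O: "o\<^sub>2 \<in> O_part \<gamma> W v" using o_mem by (simp add: O_eq)

text \<open>The ribbon begins behind \<open>o\<^sub>2\<close> and ends at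
  \<open>o\<^sub>2 + v\<close> with one box on each diagonal, so its size is the content of
  \<open>v\<close>. This identifies the key ribbon size with the period of the boundary.\<close>

lemma card_key_ribbon: "card (from_after_first_O top_ribbon \<gamma> W v) = nat n"
proof -
  let ?O = "O_part \<gamma> W v"
  have prec: "precedes x u \<longleftrightarrow> box_content x < box_content u" for x u
    by (simp add: precedes_def diag_def box_content_def) linarith
  have o2v: "o\<^sub>2 + v \<in> top_ribbon \<inter> translate v ?O" "box_content (o\<^sub>2 + v) = x\<^sub>2 + n"
  proof -
    show c: "box_content (o\<^sub>2 + v) = x\<^sub>2 + n" by (simp add: box_content_add x\<^sub>2_def n_def)
    have "o\<^sub>2 = path_box topp x\<^sub>2" using top_x2 by (simp add: path_box_eq_iff x\<^sub>2_def)
    then have "o\<^sub>2 + v \<in> top_ribbon" using top_ribbon_at[of "o\<^sub>2 + v"] c w_pos w_less_n by simp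
    then show "o\<^sub>2 + v \<in> top_ribbon \<inter> translate v ?O" using o2_O by (simp add: mem_translate)
  qed
  have "from_after_first_O top_ribbon \<gamma> W v = {u \<in> top_ribbon. x\<^sub>2 < box_content u \<and> box_content u \<le> x\<^sub>2 + n}"
  proof (intro equalityI subsetI)
    fix u assume u: "u \<in> from_after_first_O top_ribbon \<gamma> W v"
    then have "u \<in> top_ribbon" "precedes o\<^sub>2 u" using o2_top_ribbon o2_O by (auto simp: from_after_first_O_def)
    moreover obtain x where "x \<in> translate v ?O" "u = x \<or> precedes u x"
      using u by (auto simp: from_after_first_O_def amalg_shift_def)
    moreover from this have "box_content x \<le> x\<^sub>2 + n" using content_O[of "x - v"] by (simp add: mem_translate box_content_diff n_def)
    ultimately show "u \<in> {u \<in> top_ribbon. x\<^sub>2 < box_content u \<and> box_content u \<le> x\<^sub>2 + n}"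
      by (auto simp: prec x\<^sub>2_def)
  next
    fix u assume "u \<in> {u \<in> top_ribbon. x\<^sub>2 < box_content u \<and> box_content u \<le> x\<^sub>2 + n}"
    then have u: "u \<in> top_ribbon" "x\<^sub>2 < box_content u" "box_content u \<le> x\<^sub>2 + n" by auto
    have "\<forall>x\<in>top_ribbon \<inter> ?O. precedes x u" using content_O u(2) by (force simp: prec)
    moreover have "u = o\<^sub>2 + v \<or> precedes u (o\<^sub>2 + v)"
    proof (cases "box_content u = x\<^sub>2 + n")
      case True
      then have "u - v = path_box topp x\<^sub>2" using top_ribbon_at[of u] u by simp
      moreover have "o\<^sub>2 = path_box topp x\<^sub>2" using top_x2 by (simp add: path_box_eq_iff x\<^sub>2_def)
      ultimately have "u - v = o\<^sub>2" by simp
      then show ?thesis by (simp add: algebra_simps)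
    next
      case False
      then show ?thesis using u(3) o2v(2) by (simp add: prec)
    qed
    ultimately show "u \<in> from_after_first_O top_ribbon \<gamma> W v"
      unfolding from_after_first_O_def amalg_shift_def using u(1) o2v(1) by blast
  qed
  moreover have "bij_betw box_content {u \<in> top_ribbon. x\<^sub>2 < box_content u \<and> box_content u \<le> x\<^sub>2 + n} {x\<^sub>2<..x\<^sub>2 + n}"
  proof (rule bij_betw_byWitness[where f' = "\<lambda>x. path_box topp (x - n) + v"])
    have c: "box_content (path_box topp (x - n) + v) = x" for x by (simp add: box_content_add n_def)
    have "path_box topp (x - n) + v \<in> top_ribbon" if "x\<^sub>2 < x" "x \<le> x\<^sub>2 + n" for x
      using top_ribbon_at[of "path_box topp (x - n) + v"] that c by simp
    then show "(\<lambda>x. path_box topp (x - n) + v) ` {x\<^sub>2<..x\<^sub>2 + n} \<subseteq> {u \<in> top_ribbon. x\<^sub>2 < box_content u \<and> box_content u \<le> x\<^sub>2 + n}"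
      using c by auto
    show "\<forall>x\<in>{x\<^sub>2<..x\<^sub>2 + n}. box_content (path_box topp (x - n) + v) = x" using c by simp
    show "\<forall>u\<in>{u \<in> top_ribbon. x\<^sub>2 < box_content u \<and> box_content u \<le> x\<^sub>2 + n}. path_box topp (box_content u - n) + v = u"
    proof
      fix u assume "u \<in> {u \<in> top_ribbon. x\<^sub>2 < box_content u \<and> box_content u \<le> x\<^sub>2 + n}"
      then have "u - v = path_box topp (box_content u - n)" using top_ribbon_at[of u] by simp
      then show "path_box topp (box_content u - n) + v = u" by (simp flip: \<open>u - v = _\<close>)
    qed
  qed auto
  ultimately show ?thesis by (simp add: bij_betw_same_card)
qed

lemma n_pos: "0 < n" using w_pos w_less_n by simp

end

lemma core_last_O_box:
  assumes "core \<gamma> W v"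
  shows "\<exists>x \<in> upper_left_ribbon (amalg \<gamma> v) \<inter> O_part \<gamma> W v. \<forall>y\<in>O_part \<gamma> W v. box_content y \<le> box_content x"
proof -
  interpret core_shape \<gamma> W v by unfold_locales (rule assms)
  show ?thesis using o2_top_ribbon o2_O content_O by (intro bexI[of _ "o\<^sub>2"]) (auto simp: x\<^sub>2_def)
qed

lemma core_content_pos: "core \<gamma> W v \<Longrightarrow> 0 < box_content v"
  using core_shape.n_pos[of \<gamma> W v] core_shape.n_def[of \<gamma> W v] by (simp add: core_shape_def)

lemma core_card_key_ribbon:
  "core \<gamma> W v \<Longrightarrow> card (from_after_first_O (upper_left_ribbon (amalg \<gamma> v)) \<gamma> W v) = nat (box_content v)"
  using core_shape.card_key_ribbon[of \<gamma> W v] core_shape.n_def[of \<gamma> W v] by (simp add: core_shape_def)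

lemma core_exchangeable:
  assumes core: "core \<gamma> W v" and t: "tight \<gamma> W v" and t': "tight (rotate180 \<gamma>) (rotate180 (translate v W)) v"
    and ab: "2 \<le> a" "2 \<le> b"
  shows "\<exists>x\<^sub>0 len h g. band_of \<gamma> x\<^sub>0 len h g \<and>
    exchangeable (copies h g (box_content v) (len - box_content v) (fst v) ({0..<a} \<times> {0..<b} - {(a - 1, b - 1)}))
      (copies h g (box_content v) (len - box_content v) (fst v) ({0..<a} \<times> {0..<b} - {(0, 0)}))"
proof -
  interpret core_shape \<gamma> W v by unfold_locales (rule core)
  interpret r: core_shape "rotate180 \<gamma>" "rotate180 W'" v by unfold_locales (rule core_rotate180[OF core])
  obtain h g where band: "band_of \<gamma> x\<^sub>0 (n + w) h g" using band_exists by blast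
  note rband = band_of_rotate180[OF band]
  obtain t1 where 1: "corner_band h g n w t1 (fst v) a b"
    using band_is_corner_band[OF band t ab] by auto
  obtain t2 where 2: "corner_band (\<lambda>x. 1 - g (n + w - 1 - x)) (\<lambda>x. 1 - h (n + w - 1 - x)) n w t2 (fst v) a b"
    using r.band_is_corner_band[OF rband t' ab] by (auto simp: n_def r.n_def)
  have "opposite n w f = (\<lambda>x. 1 - f (n + w - 1 - x))" for f by (simp add: opposite_def fun_eq_iff)
  then have "exchangeable (copies h g n w (fst v) ({0..<a} \<times> {0..<b} - {(a - 1, b - 1)}))
      (copies h g n w (fst v) ({0..<a} \<times> {0..<b} - {(0, 0)}))"
    using exchangeable_copies[OF 1, of t2] 2 by simp
  then show ?thesis using band by (intro exI[of _ x\<^sub>0] exI[of _ "n + w"] exI[of _ h] exI[of _ g]) (simp add: n_def)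
qed

section \<open>Loose end ribbons\<close>

lemma adjacent_content: "adjacent p q \<Longrightarrow> box_content q = box_content p + 1 \<or> box_content q = box_content p - 1"
  unfolding adjacent_def box_content_def by arith

lemma adjacent_sym: "adjacent p q \<Longrightarrow> adjacent q p"
  unfolding adjacent_def by linarith

text \<open>Adjacent boxes have contents that differ by one, so a walk cannot skip a
  diagonal.\<close>

lemma connected_contiguous:
  assumes "connected_boxes S"
  shows "contiguous S"
proof -
  have along: "\<forall>x. min (box_content p) (box_content q) \<le> x \<and> x \<le> max (box_content p) (box_content q) \<longrightarrow> x \<in> box_content ` S"
    if "(p, q) \<in> {(p, q). p \<in> S \<and> q \<in> S \<and> adjacent p q}\<^sup>*" and p: "p \<in> S" for p q
    using that(1)
  proof (induction rule: rtrancl_induct)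
    case base
    then show ?case using p by auto
  next
    case (step y z)
    have z: "z \<in> S" "adjacent y z" using step.hyps(2) by auto
    show ?case
    proof (intro allI impI)
      fix x assume x: "min (box_content p) (box_content z) \<le> x \<and> x \<le> max (box_content p) (box_content z)"
      show "x \<in> box_content ` S"
      proof (cases "x = box_content z")
        case True
        then show ?thesis using z(1) by simp
      next
        case False
        then have "min (box_content p) (box_content y) \<le> x \<and> x \<le> max (box_content p) (box_content y)"
          using x adjacent_content[OF z(2)] by auto
        then show ?thesis using step.IH by blast
      qed
    qed
  qed
  have conn: "(p, q) \<in> {(p, q). p \<in> S \<and> q \<in> S \<and> adjacent p q}\<^sup>*" if "p \<in> S" "q \<in> S" for p q
    using assms that unfolding connected_boxes_def by blast
  show ?thesis
    unfolding contiguous_def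
  proof (intro ballI allI impI)
    fix p q x assume "p \<in> S" "q \<in> S" "box_content p \<le> x" "x \<le> box_content q"
    then show "x \<in> box_content ` S"
      using along[OF conn[of p q], rule_format, of x] by simp
  qed
qed

text \<open>In a convex set the first boxes of consecutive diagonals are adjacent, which connects
  the strip; a two by two square would put two boxes on one diagonal.\<close>

lemma strip_is_ribbon:
  assumes fin: "finite \<rho>" and conv: "convex_boxes \<rho>" and bij: "bij_betw box_content \<rho> {s..<s + m}" and m: "m > 0"
  shows "is_ribbon \<rho>"
proof -
  let ?R = "{(p, q). p \<in> \<rho> \<and> q \<in> \<rho> \<and> adjacent p q}"
  have cont: "x \<in> box_content ` \<rho> \<longleftrightarrow> s \<le> x \<and> x < s + m" for x
    using bij_betw_imp_surj_on[OF bij] by auto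
  have unique: "p = q" if "p \<in> \<rho>" "q \<in> \<rho>" "box_content p = box_content q" for p q
    using inj_onD[OF bij_betw_imp_inj_on[OF bij] that(3,1,2)] .
  define \<beta> where "\<beta> = path_box (top_of \<rho>)"
  have \<beta>: "\<beta> x \<in> \<rho>" if "s \<le> x" "x < s + m" for x
    unfolding \<beta>_def using that cont by (intro path_box_top_of[OF fin]) auto
  have all: "p = \<beta> (box_content p)" if "p \<in> \<rho>" for p
  proof -
    have "s \<le> box_content p" "box_content p < s + m" using cont[of "box_content p"] that by auto
    from unique[OF that \<beta>[OF this]] show ?thesis by (simp add: \<beta>_def)
  qed
  have adj: "adjacent (\<beta> (x - 1)) (\<beta> x)" if "s \<le> x - 1" "x < s + m" for x
  proof -
    have "x - 1 \<in> box_content ` \<rho>" "x \<in> box_content ` \<rho>" using that cont by auto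
    from top_of_step[OF fin conv this] show ?thesis by (auto simp: \<beta>_def path_box_def adjacent_def)
  qed
  have reach: "(\<beta> s, \<beta> x) \<in> ?R\<^sup>*" if "s \<le> x" "x < s + m" for x
    using that
  proof (induction rule: int_ge_induct)
    case (step x)
    then have "(\<beta> s, \<beta> x) \<in> ?R\<^sup>*" by simp
    moreover have "(\<beta> x, \<beta> (x + 1)) \<in> ?R" using step adj[of "x + 1"] \<beta> by simp
    ultimately show ?case by (rule rtrancl_into_rtrancl)
  qed simp
  have "sym ?R" by (auto simp: sym_def intro: adjacent_sym)
  then have sym: "sym (?R\<^sup>*)" by (rule sym_rtrancl)
  have "(p, q) \<in> ?R\<^sup>*" if "p \<in> \<rho>" "q \<in> \<rho>" for p q
  proof -
    have "s \<le> box_content p" "box_content p < s + m" "s \<le> box_content q" "box_content q < s + m"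
      using cont[of "box_content p"] cont[of "box_content q"] that by auto
    then have "(\<beta> s, p) \<in> ?R\<^sup>*" "(\<beta> s, q) \<in> ?R\<^sup>*"
      using reach[of "box_content p"] reach[of "box_content q"] all[OF that(1)] all[OF that(2)] by simp_all
    then show ?thesis using sym by (meson symD rtrancl_trans)
  qed
  moreover have "\<rho> \<noteq> {}" using \<beta>[of s] m by auto
  ultimately have "connected_boxes \<rho>" by (simp add: connected_boxes_def)
  moreover have "is_shape \<rho>" using fin conv by (rule is_shape_convex)
  moreover have "\<not> (\<exists>r c. {(r, c), (r, c + 1), (r + 1, c), (r + 1, c + 1)} \<subseteq> \<rho>)"
  proof
    assume "\<exists>r c. {(r, c), (r, c + 1), (r + 1, c), (r + 1, c + 1)} \<subseteq> \<rho>"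
    then obtain r c where "(r, c) \<in> \<rho>" "(r + 1, c + 1) \<in> \<rho>" by blast
    then have "(r, c) = (r + 1, c + 1)" by (rule unique) (simp add: box_content_def)
    then show False by simp
  qed
  ultimately show ?thesis by (simp add: is_ribbon_def)
qed

section \<open>Both kinds of WOW shapes as \<open>core\<close>\<close>

lemma diag_eq: "diag b = - box_content b"
  by (simp add: diag_def box_content_def)

lemma precedes_iff: "precedes x y \<longleftrightarrow> box_content x < box_content y"
  by (simp add: precedes_def diag_eq)

lemma wow_Rightward_core:
  assumes "wow Rightward \<gamma> W v"
  shows "core \<gamma> W v"
proof -
  have w: "is_shape \<gamma>" "W_at_both_ends \<gamma> W v"
    "\<exists>d. (\<forall>b\<in>W. d < diag b) \<and> (\<forall>b\<in>translate v W. diag b < d)" "wow_attached Rightward \<gamma> W v"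
    using assms by (auto simp: wow_def)
  obtain d where d: "\<forall>b\<in>W. d < diag b" "\<forall>b\<in>translate v W. diag b < d" using w(3) by blast
  have d': "\<exists>d. (\<forall>b\<in>W. box_content b < d) \<and> (\<forall>b\<in>translate v W. d < box_content b)"
    by (rule exI[of _ "- d"]) (use d in \<open>auto simp: diag_eq\<close>)
  show ?thesis
    using w(1,2,4) d' connected_contiguous
    unfolding core_def W_at_both_ends_def lies_in_bottom_def lies_in_top_def wow_attached_def shape_iff_convex
    by auto
qed

lemma transpose_Diff: "transpose_boxes (S - T) = transpose_boxes S - transpose_boxes T"
  by (rule Set.set_eqI) (simp add: mem_transpose_boxes)

lemma translate_uminus_transpose:
  "translate (- transpose_box v) (transpose_boxes (translate v W)) = transpose_boxes W"
  by (rule Set.set_eqI) (simp add: mem_translate mem_transpose_boxes transpose_box_add)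

lemma O_part_transpose:
  "O_part (transpose_boxes \<gamma>) (transpose_boxes (translate v W)) (- transpose_box v) = transpose_boxes (O_part \<gamma> W v)"
  unfolding O_part_def translate_uminus_transpose transpose_Diff by blast

lemma convex_transpose: "convex_boxes S \<Longrightarrow> convex_boxes (transpose_boxes S)"
  unfolding convex_boxes_def
proof (intro ballI allI impI)
  fix x y z assume S: "\<forall>x\<in>S. \<forall>y\<in>S. \<forall>z. box_le x z \<longrightarrow> box_le z y \<longrightarrow> z \<in> S"
    and "x \<in> transpose_boxes S" "y \<in> transpose_boxes S" "box_le x z" "box_le z y"
  then show "z \<in> transpose_boxes S"
    using S[rule_format, of "transpose_box x" "transpose_box y" "transpose_box z"] by (simp add: mem_transpose_boxes)
qed

lemma contiguous_transpose: "contiguous S \<Longrightarrow> contiguous (transpose_boxes S)"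
  unfolding contiguous_def
proof (intro ballI allI impI)
  fix p q x assume S: "\<forall>p\<in>S. \<forall>q\<in>S. \<forall>x. box_content p \<le> x \<longrightarrow> x \<le> box_content q \<longrightarrow> x \<in> box_content ` S"
    and pq: "p \<in> transpose_boxes S" "q \<in> transpose_boxes S" and x: "box_content p \<le> x" "x \<le> box_content q"
  have "- x \<in> box_content ` S"
    using S[rule_format, of "transpose_box q" "transpose_box p" "- x"] pq x by (simp add: mem_transpose_boxes)
  then obtain z where "z \<in> S" "box_content z = - x" by auto
  then show "x \<in> box_content ` transpose_boxes S"
    by (intro image_eqI[of _ _ "transpose_box z"]) (auto simp: mem_transpose_boxes)
qed

lemma southwesternmost_transpose: "southwesternmost (transpose_boxes S) b \<longleftrightarrow> northeasternmost S (transpose_box b)"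
  and northeasternmost_transpose: "northeasternmost (transpose_boxes S) b \<longleftrightarrow> southwesternmost S (transpose_box b)"
proof -
  have all: "(\<forall>x\<in>transpose_boxes S. P x) \<longleftrightarrow> (\<forall>x\<in>S. P (transpose_box x))" for P
    unfolding transpose_boxes_image by blast
  show "southwesternmost (transpose_boxes S) b \<longleftrightarrow> northeasternmost S (transpose_box b)"
    "northeasternmost (transpose_boxes S) b \<longleftrightarrow> southwesternmost S (transpose_box b)"
    unfolding southwesternmost_def northeasternmost_def all by (auto simp: mem_transpose_boxes)
qed

lemma finite_transpose: "finite S \<Longrightarrow> finite (transpose_boxes S)"
  by (simp add: transpose_boxes_image)

lemma transpose_mono: "S \<subseteq> T \<Longrightarrow> transpose_boxes S \<subseteq> transpose_boxes T"
  by (auto simp: mem_transpose_boxes)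

text \<open>Transposition reverses the direction from southwest to northeast. The transposed upper
  copy takes the role of the lower one, and the displacement to the other copy is
  \<open>- transpose_box v\<close>, of the same content as \<open>v\<close>.\<close>

lemma wow_Upward_core:
  assumes "wow Upward \<gamma> W v"
  shows "core (transpose_boxes \<gamma>) (transpose_boxes (translate v W)) (- transpose_box v)"
proof -
  have w: "is_shape \<gamma>" "W_at_both_ends \<gamma> W v"
    "\<exists>d. (\<forall>b\<in>W. d < diag b) \<and> (\<forall>b\<in>translate v W. diag b < d)" "wow_attached Upward \<gamma> W v"
    using assms by (auto simp: wow_def)
  obtain d where d: "\<forall>b\<in>W. d < diag b" "\<forall>b\<in>translate v W. diag b < d" using w(3) by blast
  have 1: "\<exists>d. (\<forall>b\<in>transpose_boxes (translate v W). box_content b < d) \<and> (\<forall>b\<in>transpose_boxes W. d < box_content b)"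
  proof (intro exI[of _ d] conjI ballI)
    fix b assume "b \<in> transpose_boxes (translate v W)"
    then show "box_content b < d" using d(2)[rule_format, of "transpose_box b"] by (simp add: mem_transpose_boxes diag_eq)
  next
    fix b assume "b \<in> transpose_boxes W"
    then show "d < box_content b" using d(1)[rule_format, of "transpose_box b"] by (simp add: mem_transpose_boxes diag_eq)
  qed
  have s: "finite \<gamma>" "convex_boxes \<gamma>" "convex_boxes W" "convex_boxes (translate v W)" "convex_boxes (\<gamma> - W)"
    "convex_boxes (\<gamma> - translate v W)" "contiguous W" "contiguous (translate v W)" "contiguous (\<gamma> - W)"
    "contiguous (\<gamma> - translate v W)" "W \<subseteq> \<gamma>" "translate v W \<subseteq> \<gamma>"
    using w(1,2) unfolding W_at_both_ends_def lies_in_bottom_def lies_in_top_def shape_iff_convex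
    by (auto intro: connected_contiguous)
  obtain b where b: "b \<in> W" "southwesternmost \<gamma> b" using w(2) unfolding W_at_both_ends_def lies_in_bottom_def by blast
  obtain b' where b': "b' \<in> translate v W" "northeasternmost \<gamma> b'" using w(2) unfolding W_at_both_ends_def lies_in_top_def by blast
  have 2: "\<exists>b\<in>transpose_boxes (translate v W). southwesternmost (transpose_boxes \<gamma>) b"
    by (rule bexI[of _ "transpose_box b'"]) (use b' in \<open>simp_all add: southwesternmost_transpose mem_transpose_boxes\<close>)
  have 3: "\<exists>b\<in>transpose_boxes W. northeasternmost (transpose_boxes \<gamma>) b"
    by (rule bexI[of _ "transpose_box b"]) (use b in \<open>simp_all add: northeasternmost_transpose mem_transpose_boxes\<close>)
  obtain r c where o: "southwesternmost (O_part \<gamma> W v) (r, c)" "(r + 1, c) \<in> W" using w(4) by (auto simp: wow_attached_def)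
  obtain r' c' where o': "northeasternmost (O_part \<gamma> W v) (r', c')" "(r' - 1, c') \<in> translate v W"
    using w(4) by (auto simp: wow_attached_def)
  have 4: "\<exists>r c. southwesternmost (transpose_boxes (O_part \<gamma> W v)) (r, c) \<and> (r, c - 1) \<in> transpose_boxes (translate v W)"
    by (rule exI[of _ c'], rule exI[of _ r']) (use o' in \<open>simp add: southwesternmost_transpose mem_transpose_boxes\<close>)
  have 5: "\<exists>r c. northeasternmost (transpose_boxes (O_part \<gamma> W v)) (r, c) \<and> (r, c + 1) \<in> transpose_boxes W"
    by (rule exI[of _ c], rule exI[of _ r]) (use o in \<open>simp add: northeasternmost_transpose mem_transpose_boxes\<close>)
  show ?thesis
    unfolding core_def translate_uminus_transpose O_part_transpose transpose_Diff[symmetric]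
    by (intro conjI 1 2 3 4 5 finite_transpose transpose_mono convex_transpose contiguous_transpose s)
qed

section \<open>From loose end ribbons to \<open>tight\<close>\<close>

lemma mem_upper_left_ribbon: "p \<in> upper_left_ribbon S \<longleftrightarrow> p \<in> S \<and> p - (1, 1) \<notin> S"
  and mem_bottom_right_ribbon: "p \<in> bottom_right_ribbon S \<longleftrightarrow> p \<in> S \<and> p + (1, 1) \<notin> S"
  by (simp_all add: upper_left_ribbon_def bottom_right_ribbon_def minus_prod_def plus_prod_def)

lemma mem_amalg: "p \<in> amalg \<gamma> v \<longleftrightarrow> p \<in> \<gamma> \<or> p - v \<in> \<gamma>"
  by (simp add: amalg_def amalg_shift_def mem_translate)

lemma bij_strip_card: "bij_betw box_content \<rho> {s..<s + m} \<Longrightarrow> card \<rho> = nat m"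
  by (simp add: bij_betw_same_card)

lemma bij_strip_first:
  assumes "bij_betw box_content \<rho> {s..<s + m}" "m > 0"
  shows "\<exists>x\<in>\<rho>. box_content x = s"
  using bij_betw_imp_surj_on[OF assms(1)] assms(2) by (metis atLeastLessThan_iff imageE less_add_same_cancel1 order_refl)

lemma bij_strip_finite: "bij_betw box_content \<rho> {s..<s + m} \<Longrightarrow> finite \<rho>"
  using bij_betw_finite by blast

lemma wow_convex: "wow k \<gamma> W v \<Longrightarrow> finite \<gamma> \<and> convex_boxes \<gamma>"
  by (simp add: wow_def shape_iff_convex)

lemma is_ribbon_translate_strip:
  assumes "convex_boxes \<rho>" "bij_betw box_content \<rho> {s..<s + m}" "m > 0"
  shows "is_ribbon (translate t \<rho>)" "card (translate t \<rho>) = nat m"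
proof -
  have bij: "bij_betw box_content (translate t \<rho>) {s + box_content t..<s + box_content t + m}"
  proof (rule bij_betw_byWitness[where f' = "\<lambda>x. inv_into \<rho> box_content (x - box_content t) + t"])
    show "\<forall>p\<in>translate t \<rho>. inv_into \<rho> box_content (box_content p - box_content t) + t = p"
      using bij_betw_inv_into_left[OF assms(2)] by (auto simp: translate_def box_content_add)
    show "\<forall>x\<in>{s + box_content t..<s + box_content t + m}. box_content (inv_into \<rho> box_content (x - box_content t) + t) = x"
      using bij_betw_inv_into_right[OF assms(2)] by (auto simp: box_content_add)
    show "box_content ` translate t \<rho> \<subseteq> {s + box_content t..<s + box_content t + m}"
      using bij_betw_imp_surj_on[OF assms(2)] by (auto simp: translate_def box_content_add)
    show "(\<lambda>x. inv_into \<rho> box_content (x - box_content t) + t) ` {s + box_content t..<s + box_content t + m} \<subseteq> translate t \<rho>"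
      using bij_betw_apply[OF bij_betw_inv_into[OF assms(2)]] by (auto simp: translate_def)
  qed
  show "is_ribbon (translate t \<rho>)"
    using strip_is_ribbon[OF bij_strip_finite[OF bij] convex_translate[OF assms(1)] bij assms(3)] .
  show "card (translate t \<rho>) = nat m" using bij_strip_card[OF bij] .
qed

lemma lower_in_translate: "lower_in S \<rho> \<Longrightarrow> lower_in (translate t S) (translate t \<rho>)"
  and upper_in_translate: "upper_in S \<rho> \<Longrightarrow> upper_in (translate t S) (translate t \<rho>)"
  unfolding lower_in_def upper_in_def translate_def by (auto simp: box_le_add)

lemma translate_first:
  assumes "bij_betw box_content \<rho> {s..<s + m}" "m > 0"
  shows "\<exists>x\<in>translate t \<rho>. box_content x = s + box_content t"
proof -
  obtain x where "x \<in> \<rho>" "box_content x = s" using bij_strip_first[OF assms] by blast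
  then show ?thesis by (intro bexI[of _ "x + t"]) (auto simp: box_content_add mem_translate)
qed

text \<open>All of the top key ribbon comes after the last box of \<open>O\<close> on the upper left
  ribbon. A strip against \<open>tight\<close>, moved by \<open>v\<close> into the second copy,
  starts at or before that box and would be a loose end ribbon. The rotated claim leads in the same
  way to the bottom key ribbon.\<close>

lemma tight_Rightward:
  assumes wow: "wow Rightward \<gamma> W v" and loose: "no_loose_end_ribbons Rightward \<gamma> W v"
  shows "tight \<gamma> W v" and "tight (rotate180 \<gamma>) (rotate180 (translate v W)) v"
proof -
  let ?n = "box_content v"
  note core = wow_Rightward_core[OF wow] and fc = wow_convex[OF wow]
  have n: "0 < ?n" by (rule core_content_pos[OF core])
  have size: "key_ribbon_size Rightward \<gamma> W v = nat ?n"
    using core_card_key_ribbon[OF core] by (simp add: key_ribbon_size_def top_key_ribbon_def)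
  have no1: "\<not> (is_ribbon \<rho> \<and> card \<rho> = nat ?n \<and> begins_left_of \<rho> (top_key_ribbon Rightward \<gamma> W v) \<and>
      taken_out_left (translate v \<gamma>) \<rho>)"
    and no2: "\<not> (is_ribbon \<rho> \<and> card \<rho> = nat ?n \<and> ends_right_of \<rho> (bottom_key_ribbon Rightward \<gamma> W v) \<and>
      taken_out_right \<gamma> \<rho>)" for \<rho>
    using loose unfolding no_loose_end_ribbons_def Let_def size amalg_shift_def by auto
  show "tight \<gamma> W v"
    unfolding tight_def
  proof (intro allI impI ballI, rule ccontr)
    fix \<rho> s y assume \<rho>: "lower_in \<gamma> \<rho>" and bij: "bij_betw box_content \<rho> {s..<s + ?n}" and y: "y \<in> O_part \<gamma> W v"
      and ge: "\<not> box_content y < s + ?n"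
    obtain z where z: "z \<in> upper_left_ribbon (amalg \<gamma> v)" "z \<in> O_part \<gamma> W v" "box_content y \<le> box_content z"
      using core_last_O_box[OF core] y by blast
    obtain x where x: "x \<in> translate v \<rho>" "box_content x = s + ?n" using translate_first[OF bij n] by blast
    have "begins_left_of (translate v \<rho>) (top_key_ribbon Rightward \<gamma> W v)"
      unfolding begins_left_of_def
    proof (intro bexI[OF _ x(1)] ballI)
      fix u assume "u \<in> top_key_ribbon Rightward \<gamma> W v"
      then have "precedes z u" using z by (simp add: top_key_ribbon_def from_after_first_O_def)
      then show "precedes x u" using z(3) ge x(2) by (simp add: precedes_iff)
    qed
    moreover have "taken_out_left (translate v \<gamma>) (translate v \<rho>)"
      using fc \<rho> by (intro taken_out_left_lower_in finite_translate convex_translate lower_in_translate) auto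
    ultimately show False
      using no1 is_ribbon_translate_strip[OF convex_lower_in(1)[OF _ \<rho>] bij n] fc by blast
  qed
  let ?\<gamma> = "rotate180 \<gamma>" and ?W = "rotate180 (translate v W)"
  note core' = core_rotate180[OF core]
  show "tight ?\<gamma> ?W v"
    unfolding tight_def
  proof (intro allI impI ballI, rule ccontr)
    fix \<sigma> s y assume \<sigma>: "lower_in ?\<gamma> \<sigma>" and bij: "bij_betw box_content \<sigma> {s..<s + ?n}" and y: "y \<in> O_part ?\<gamma> ?W v"
      and ge: "\<not> box_content y < s + ?n"
    obtain z where z: "z \<in> upper_left_ribbon (amalg ?\<gamma> v)" "z \<in> O_part ?\<gamma> ?W v" "box_content y \<le> box_content z"
      using core_last_O_box[OF core'] y by blast
    define \<rho> where "\<rho> = rotate180 \<sigma>"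
    have \<rho>: "upper_in \<gamma> \<rho>" using \<sigma> lower_in_rotate180[of \<gamma> \<rho>] by (simp add: \<rho>_def)
    have bij': "bij_betw box_content \<rho> {1 - s - ?n..<1 - s - ?n + ?n}"
      unfolding \<rho>_def by (rule bij_betw_box_content_rotate180[OF bij])
    obtain x where x: "x \<in> \<sigma>" "box_content x = s" using bij_strip_first[OF bij n] by blast
    have x': "- x \<in> \<rho>" using x(1) by (simp add: \<rho>_def mem_rotate180)
    have "ends_right_of \<rho> (bottom_key_ribbon Rightward \<gamma> W v)"
      unfolding ends_right_of_def
    proof (intro bexI[OF _ x'] ballI)
      fix u assume u: "u \<in> bottom_key_ribbon Rightward \<gamma> W v"
      have e: "- (v - z + (1, 1)) = z - (1, 1) - v" "- (v - z + (1, 1) - v) = z - (1, 1)" "v - z - v = - z" "- (v - z) = z - v"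
        by (simp_all add: prod_eq_iff)
      \<comment> \<open>The point reflection \<open>p \<mapsto> v - p\<close> takes the amalgamation
        of the rotated shape to that of \<gamma>; it carries the first \<open>O\<close> to the
        second one and the upper left ribbon to the lower right one.\<close>
      have "v - z \<in> bottom_right_ribbon (amalg \<gamma> v)"
        using z(1) unfolding mem_bottom_right_ribbon mem_upper_left_ribbon mem_amalg mem_rotate180
        by (auto simp: algebra_simps)
      moreover have "v - z \<in> translate v (O_part \<gamma> W v)"
        using z(2) unfolding O_part_rotate180 mem_translate mem_rotate180 by simp
      ultimately have "precedes u (v - z)"
        using u by (simp add: bottom_key_ribbon_def from_first_O_def amalg_shift_def)
      then show "precedes u (- x)" using z(3) ge x(2) by (simp add: precedes_iff box_content_diff)
    qed
    moreover have "taken_out_right \<gamma> \<rho>" using fc \<rho> by (intro taken_out_right_upper_in) auto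
    ultimately show False
      using no2[of \<rho>] is_ribbon_translate_strip[OF convex_upper_in(1)[OF _ \<rho>] bij' n, of 0] fc by simp
  qed
qed

lemma bij_betw_box_content_transpose:
  assumes "bij_betw box_content \<rho> {s..<s + n}"
  shows "bij_betw box_content (transpose_boxes \<rho>) {1 - s - n..<1 - s - n + n}"
proof -
  have "bij_betw transpose_box (transpose_boxes \<rho>) \<rho>"
    by (rule bij_betw_byWitness[where f' = transpose_box]) (auto simp: mem_transpose_boxes)
  moreover have "bij_betw uminus {s..<s + n} {1 - s - n..<1 - s - n + n}"
    by (rule bij_betw_byWitness[where f' = uminus]) auto
  ultimately have "bij_betw (uminus \<circ> (box_content \<circ> transpose_box)) (transpose_boxes \<rho>) {1 - s - n..<1 - s - n + n}"
    using assms by (intro bij_betw_trans)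
  moreover have "uminus \<circ> (box_content \<circ> transpose_box) = box_content" by (auto simp: fun_eq_iff)
  ultimately show ?thesis by simp
qed

lemma lower_in_transpose: "lower_in S \<rho> \<Longrightarrow> lower_in (transpose_boxes S) (transpose_boxes \<rho>)"
  and upper_in_transpose: "upper_in S \<rho> \<Longrightarrow> upper_in (transpose_boxes S) (transpose_boxes \<rho>)"
  unfolding lower_in_def upper_in_def transpose_boxes_image by auto

lemma key_ribbon_size_Upward:
  assumes wow: "wow Upward \<gamma> W v"
  shows "key_ribbon_size Upward \<gamma> W v = nat (box_content v)"
proof -
  let ?\<gamma> = "transpose_boxes \<gamma>" and ?W = "transpose_boxes (translate v W)" and ?v = "- transpose_box v"
  let ?R = "upper_left_ribbon (amalg \<gamma> v)" and ?R' = "upper_left_ribbon (amalg ?\<gamma> ?v)"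
  let ?O = "O_part \<gamma> W v" and ?O' = "O_part ?\<gamma> ?W ?v"
  \<comment> \<open>\<theta> sends the first copy of \<gamma> to the second copy of the transposed
    shape and the second to the first. As it also reverses \<open>precedes\<close>,
    \<open>from_first_O\<close> turns into \<open>from_after_first_O\<close>.\<close>
  define \<theta> where "\<theta> u = transpose_box (u - v)" for u
  define \<theta>' where "\<theta>' u = transpose_box u + v" for u
  have inv: "\<theta>' (\<theta> u) = u" "\<theta> (\<theta>' u) = u" for u by (simp_all add: \<theta>_def \<theta>'_def)
  have R: "\<theta> u \<in> ?R' \<longleftrightarrow> u \<in> ?R" for u
  proof -
    have e: "transpose_box (transpose_box (u - v) - (1, 1)) = u - (1, 1) - v"
      "transpose_box (transpose_box (u - v) - (1, 1) - - transpose_box v) = u - (1, 1)"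
      "transpose_box (transpose_box (u - v) - - transpose_box v) = u"
      by (simp_all add: transpose_box_def prod_eq_iff)
    show ?thesis
      unfolding mem_upper_left_ribbon mem_amalg \<theta>_def mem_transpose_boxes e transpose_box_simps(1) by blast
  qed
  have O1: "\<theta> u \<in> translate ?v ?O' \<longleftrightarrow> u \<in> ?O" for u
  proof -
    have e: "transpose_box (transpose_box (u - v) - - transpose_box v) = u"
      by (simp add: transpose_box_def prod_eq_iff)
    show ?thesis unfolding O_part_transpose mem_translate mem_transpose_boxes \<theta>_def e ..
  qed
  have O2: "\<theta> u \<in> ?O' \<longleftrightarrow> u \<in> translate v ?O" for u
    unfolding O_part_transpose mem_translate mem_transpose_boxes \<theta>_def transpose_box_simps(1) ..
  have prec: "precedes (\<theta> u) (\<theta> x) \<longleftrightarrow> precedes x u" for u x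
    by (simp add: precedes_iff \<theta>_def box_content_diff)
  have ball: "(\<forall>x\<in>?R' \<inter> ?O'. P x) \<longleftrightarrow> (\<forall>x\<in>?R \<inter> translate v ?O. P (\<theta> x))" for P
    by (metis (no_types, lifting) Int_iff O2 R inv(2))
  have bex: "(\<exists>x\<in>?R' \<inter> translate ?v ?O'. P x) \<longleftrightarrow> (\<exists>x\<in>?R \<inter> ?O. P (\<theta> x))" for P
    by (metis (no_types, lifting) Int_iff O1 R inv(2))
  have eq: "\<theta> u = \<theta> x \<longleftrightarrow> u = x" for u x using inv by metis
  have mem: "\<theta> u \<in> from_after_first_O ?R' ?\<gamma> ?W ?v \<longleftrightarrow> u \<in> from_first_O ?R \<gamma> W v" for u
    unfolding from_after_first_O_def from_first_O_def mem_Collect_eq amalg_shift_def ball bex R prec eq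
    by (auto simp: eq_commute)
  have "bij_betw \<theta> (from_first_O ?R \<gamma> W v) (from_after_first_O ?R' ?\<gamma> ?W ?v)"
    by (rule bij_betw_byWitness[where f' = \<theta>']) (use mem inv in \<open>auto simp flip: mem\<close>)
  then show ?thesis
    using core_card_key_ribbon[OF wow_Upward_core[OF wow]]
    by (simp add: key_ribbon_size_def top_key_ribbon_def bij_betw_same_card)
qed

lemma tight_Upward:
  assumes wow: "wow Upward \<gamma> W v" and loose: "no_loose_end_ribbons Upward \<gamma> W v"
  defines "\<gamma>' \<equiv> transpose_boxes \<gamma>" and "W' \<equiv> transpose_boxes (translate v W)" and "v' \<equiv> - transpose_box v"
  shows "tight \<gamma>' W' v'" and "tight (rotate180 \<gamma>') (rotate180 (translate v' W')) v'"
proof -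
  let ?n = "box_content v"
  have core: "core \<gamma>' W' v'" unfolding \<gamma>'_def W'_def v'_def by (rule wow_Upward_core[OF wow])
  note fc = wow_convex[OF wow]
  have n': "box_content v' = ?n" by (simp add: v'_def)
  have n: "0 < ?n" using core_content_pos[OF core] n' by simp
  note size = key_ribbon_size_Upward[OF wow]
  have no1: "\<not> (is_ribbon \<rho> \<and> card \<rho> = nat ?n \<and> ends_right_of \<rho> (top_key_ribbon Upward \<gamma> W v) \<and>
      taken_out_left \<gamma> \<rho>)"
    and no2: "\<not> (is_ribbon \<rho> \<and> card \<rho> = nat ?n \<and> begins_left_of \<rho> (bottom_key_ribbon Upward \<gamma> W v) \<and>
      taken_out_right (translate v \<gamma>) \<rho>)" for \<rho>
    using loose unfolding no_loose_end_ribbons_def Let_def size amalg_shift_def by auto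
  show "tight \<gamma>' W' v'"
    unfolding tight_def n'
  proof (intro allI impI ballI, rule ccontr)
    fix \<sigma> s y assume \<sigma>: "lower_in \<gamma>' \<sigma>" and bij: "bij_betw box_content \<sigma> {s..<s + ?n}" and y: "y \<in> O_part \<gamma>' W' v'"
      and ge: "\<not> box_content y < s + ?n"
    obtain z where z: "z \<in> upper_left_ribbon (amalg \<gamma>' v')" "z \<in> O_part \<gamma>' W' v'" "box_content y \<le> box_content z"
      using core_last_O_box[OF core] y by blast
    define \<rho> where "\<rho> = transpose_boxes \<sigma>"
    have \<rho>: "lower_in \<gamma> \<rho>" using lower_in_transpose[OF \<sigma>] by (simp add: \<rho>_def \<gamma>'_def)
    have bij': "bij_betw box_content \<rho> {1 - s - ?n..<1 - s - ?n + ?n}"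
      unfolding \<rho>_def by (rule bij_betw_box_content_transpose[OF bij])
    obtain x where x: "x \<in> \<sigma>" "box_content x = s" using bij_strip_first[OF bij n] by blast
    have x': "transpose_box x \<in> \<rho>" using x(1) by (simp add: \<rho>_def mem_transpose_boxes)
    \<comment> \<open>The preimage of \<open>z\<close> under the map \<theta> used for
      \<open>key_ribbon_size_Upward\<close>. It lies in the \<open>O\<close> of the second copy,
      before which the top key ribbon stops.\<close>
    let ?z = "transpose_box z + v"
    have "ends_right_of \<rho> (top_key_ribbon Upward \<gamma> W v)"
      unfolding ends_right_of_def
    proof (intro bexI[OF _ x'] ballI)
      fix u assume u: "u \<in> top_key_ribbon Upward \<gamma> W v"
      have e: "transpose_box (z - v') = ?z" "transpose_box (z - (1, 1)) = ?z - (1, 1) - v"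
        "transpose_box (z - (1, 1) - v') = ?z - (1, 1)" "?z - v = transpose_box z"
        by (simp_all add: transpose_box_def prod_eq_iff v'_def)
      have "?z \<in> upper_left_ribbon (amalg \<gamma> v)"
        using z(1) unfolding mem_upper_left_ribbon mem_amalg \<gamma>'_def mem_transpose_boxes e by blast
      moreover have "?z \<in> translate v (O_part \<gamma> W v)"
        using z(2) unfolding \<gamma>'_def W'_def v'_def O_part_transpose mem_translate mem_transpose_boxes by simp
      ultimately have "precedes u ?z"
        using u by (simp add: top_key_ribbon_def from_first_O_def amalg_shift_def)
      then show "precedes u (transpose_box x)" using z(3) ge x(2) by (simp add: precedes_iff box_content_add)
    qed
    moreover have "taken_out_left \<gamma> \<rho>" using fc \<rho> by (intro taken_out_left_lower_in) auto
    ultimately show False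
      using no1[of \<rho>] is_ribbon_translate_strip[OF convex_lower_in(1)[OF _ \<rho>] bij' n, of 0] fc by simp
  qed
  let ?\<gamma> = "rotate180 \<gamma>'" and ?W = "rotate180 (translate v' W')"
  have O: "O_part ?\<gamma> ?W v' = rotate180 (transpose_boxes (O_part \<gamma> W v))"
    unfolding O_part_rotate180 unfolding \<gamma>'_def W'_def v'_def O_part_transpose ..
  show "tight ?\<gamma> ?W v'"
    unfolding tight_def n'
  proof (intro allI impI ballI, rule ccontr)
    fix \<sigma> s y assume \<sigma>: "lower_in ?\<gamma> \<sigma>" and bij: "bij_betw box_content \<sigma> {s..<s + ?n}" and y: "y \<in> O_part ?\<gamma> ?W v'"
      and ge: "\<not> box_content y < s + ?n"
    obtain z where z: "z \<in> upper_left_ribbon (amalg ?\<gamma> v')" "z \<in> O_part ?\<gamma> ?W v'" "box_content y \<le> box_content z"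
      using core_last_O_box[OF core_rotate180[OF core]] y by blast
    define \<rho> where "\<rho> = transpose_boxes (rotate180 \<sigma>)"
    have "upper_in \<gamma>' (rotate180 \<sigma>)" using \<sigma> lower_in_rotate180[of \<gamma>' "rotate180 \<sigma>"] by simp
    then have \<rho>: "upper_in \<gamma> \<rho>" using upper_in_transpose by (fastforce simp: \<rho>_def \<gamma>'_def)
    have bij': "bij_betw box_content \<rho> {s..<s + ?n}"
      using bij_betw_box_content_transpose[OF bij_betw_box_content_rotate180[OF bij]] by (simp add: \<rho>_def)
    obtain x where x: "x \<in> translate v \<rho>" "box_content x = s + ?n" using translate_first[OF bij' n] by blast
    \<comment> \<open>Rotation and transposition together send \<open>(r, c)\<close> to
      \<open>(- c, - r)\<close> and keep the content. The order along ribbons is preserved, so here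
      the start of the strip is compared with the start of the key ribbon.\<close>
    let ?z = "- transpose_box z"
    have "begins_left_of (translate v \<rho>) (bottom_key_ribbon Upward \<gamma> W v)"
      unfolding begins_left_of_def
    proof (intro bexI[OF _ x(1)] ballI)
      fix u assume u: "u \<in> bottom_key_ribbon Upward \<gamma> W v"
      have e: "transpose_box (- z) = ?z" "transpose_box (- (z - v')) = ?z - v"
        "transpose_box (- (z - (1, 1))) = ?z + (1, 1)" "transpose_box (- (z - (1, 1) - v')) = ?z + (1, 1) - v"
        by (simp_all add: transpose_box_def prod_eq_iff v'_def)
      have "?z \<in> bottom_right_ribbon (amalg \<gamma> v)"
        using z(1) unfolding mem_upper_left_ribbon mem_bottom_right_ribbon mem_amalg \<gamma>'_def mem_rotate180 mem_transpose_boxes e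
        by blast
      moreover have "?z \<in> O_part \<gamma> W v"
        using z(2) unfolding O mem_rotate180 mem_transpose_boxes e .
      ultimately have "precedes ?z u"
        using u by (simp add: bottom_key_ribbon_def from_after_first_O_def)
      then show "precedes x u" using z(3) ge x(2) by (simp add: precedes_iff)
    qed
    moreover have "taken_out_right (translate v \<gamma>) (translate v \<rho>)"
      using fc \<rho> by (intro taken_out_right_upper_in finite_translate convex_translate upper_in_translate) auto
    ultimately show False
      using no2[of "translate v \<rho>"] is_ribbon_translate_strip[OF convex_upper_in(1)[OF _ \<rho>] bij' n, of v] fc by simp
  qed
qed

section \<open>Compositions\<close>

definition scale :: "int \<Rightarrow> box \<Rightarrow> box" where
  "scale k e = (k * fst e, k * snd e)"

text \<open>The positions forced by \<open>is_composition\<close>, relative to the copy at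
  \<open>(0, 0)\<close>. Rows are counted downwards while \<open>N\<close> points north, hence the
  minus sign.\<close>

definition lattice_copies :: "box set \<Rightarrow> box \<Rightarrow> box \<Rightarrow> (int \<times> int) set \<Rightarrow> box set" where
  "lattice_copies \<gamma> E N Q = {p. \<exists>(i, j)\<in>Q. p - (scale j E - scale i N) \<in> \<gamma>}"

lemma mem_lattice_copies: "p \<in> lattice_copies \<gamma> E N Q \<longleftrightarrow> (\<exists>i j. (i, j) \<in> Q \<and> p - (scale j E - scale i N) \<in> \<gamma>)"
  unfolding lattice_copies_def by blast

text \<open>Compares index sets that differ by a shift or by a half turn of the rectangle; the
  latter also reverses \<open>E\<close> and \<open>N\<close>.\<close>

lemma lattice_copies_reindex:
  assumes Q: "\<And>i j. (i, j) \<in> Q \<Longrightarrow> f (i, j) \<in> Q'" "\<And>i j. (i, j) \<in> Q' \<Longrightarrow> f' (i, j) \<in> Q \<and> f (f' (i, j)) = (i, j)"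
    and shift: "\<And>i j. (i, j) \<in> Q \<Longrightarrow> scale (snd (f (i, j))) E - scale (fst (f (i, j))) N = scale j E' - scale i N' + d"
  shows "lattice_copies \<gamma> E N Q' = translate d (lattice_copies \<gamma> E' N' Q)"
proof (rule Set.set_eqI)
  fix p
  show "p \<in> lattice_copies \<gamma> E N Q' \<longleftrightarrow> p \<in> translate d (lattice_copies \<gamma> E' N' Q)"
  proof
    assume "p \<in> lattice_copies \<gamma> E N Q'"
    then obtain i' j' where ij': "(i', j') \<in> Q'" "p - (scale j' E - scale i' N) \<in> \<gamma>" unfolding mem_lattice_copies by blast
    obtain i j where ij: "f' (i', j') = (i, j)" by (cases "f' (i', j')")
    then have Qij: "(i, j) \<in> Q" and f: "f (i, j) = (i', j')" using Q(2)[OF ij'(1)] by auto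
    have "p - d - (scale j E' - scale i N') = p - (scale j' E - scale i' N)"
      using shift[OF Qij] by (simp add: f algebra_simps)
    then show "p \<in> translate d (lattice_copies \<gamma> E' N' Q)"
      using ij'(2) Qij unfolding mem_translate mem_lattice_copies by metis
  next
    assume "p \<in> translate d (lattice_copies \<gamma> E' N' Q)"
    then obtain i j where Qij: "(i, j) \<in> Q" "p - d - (scale j E' - scale i N') \<in> \<gamma>"
      unfolding mem_translate mem_lattice_copies by blast
    obtain i' j' where f: "f (i, j) = (i', j')" by (cases "f (i, j)")
    have "p - d - (scale j E' - scale i N') = p - (scale j' E - scale i' N)"
      using shift[OF Qij(1)] by (simp add: f algebra_simps)
    then show "p \<in> lattice_copies \<gamma> E N Q'"
      using Q(1)[OF Qij(1)] Qij(2) f unfolding mem_lattice_copies by metis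
  qed
qed

text \<open>South is the direction \<open>- (v - (1, 1))\<close>, whose \<open>(1, 1)\<close>
  becomes the extra \<open>i\<close> in the rows of \<open>copies\<close>. The translation by
  \<open>(0, x\<^sub>0)\<close> lets the contents of the band start at 0.\<close>

lemma lattice_copies_band:
  assumes band: "band_of \<gamma> x\<^sub>0 len h g"
  shows "lattice_copies \<gamma> v (v - (1, 1)) Q =
    translate (0, x\<^sub>0) (copies h g (box_content v) (len - box_content v) (fst v) Q)"
proof (rule Set.set_eqI)
  fix p
  have "p - (scale j v - scale i (v - (1, 1))) \<in> \<gamma> \<longleftrightarrow>
      0 \<le> box_content (p - (0, x\<^sub>0)) - (j - i) * box_content v \<and>
      box_content (p - (0, x\<^sub>0)) - (j - i) * box_content v < box_content v + (len - box_content v) \<and>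
      h (box_content (p - (0, x\<^sub>0)) - (j - i) * box_content v) + (j - i) * fst v + i \<le> fst (p - (0, x\<^sub>0)) \<and>
      fst (p - (0, x\<^sub>0)) < g (box_content (p - (0, x\<^sub>0)) - (j - i) * box_content v) + (j - i) * fst v + i" for i j
  proof -
    have c: "box_content (p - (scale j v - scale i (v - (1, 1)))) - x\<^sub>0 = box_content (p - (0, x\<^sub>0)) - (j - i) * box_content v"
      by (simp add: box_content_def scale_def algebra_simps)
    have f: "fst (p - (scale j v - scale i (v - (1, 1)))) = fst (p - (0, x\<^sub>0)) - (j - i) * fst v - i"
      by (simp add: scale_def algebra_simps)
    show ?thesis unfolding band_ofD(9)[OF band] c f by auto
  qed
  then show "p \<in> lattice_copies \<gamma> v (v - (1, 1)) Q \<longleftrightarrow>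
      p \<in> translate (0, x\<^sub>0) (copies h g (box_content v) (len - box_content v) (fst v) Q)"
    unfolding mem_translate mem_lattice_copies copies_def by blast
qed

text \<open>The position is followed along row 0 to column \<open>j\<close> and down that column;
  \<open>down\<close> keeps this walk inside \<open>D\<close>.\<close>

lemma composition_positions:
  fixes p :: "box \<Rightarrow> box"
  assumes east: "\<And>r c. (r, c) \<in> D \<Longrightarrow> (r, c + 1) \<in> D \<Longrightarrow> p (r, c + 1) = p (r, c) + E"
    and north: "\<And>r c. (r + 1, c) \<in> D \<Longrightarrow> (r, c) \<in> D \<Longrightarrow> p (r, c) = p (r + 1, c) + N"
    and down: "\<And>i j i' j'. (i, j) \<in> D \<Longrightarrow> 0 \<le> i' \<Longrightarrow> i' \<le> i \<Longrightarrow> 0 \<le> j' \<Longrightarrow> j' \<le> j \<Longrightarrow> (i', j') \<in> D"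
    and nonneg: "\<And>i j. (i, j) \<in> D \<Longrightarrow> 0 \<le> i \<and> 0 \<le> j"
    and D: "(i, j) \<in> D"
  shows "p (i, j) = p (0, 0) + (scale j E - scale i N)"
proof -
  have ij: "0 \<le> i" "0 \<le> j" using nonneg[OF D] by auto
  have row: "p (0, j') = p (0, 0) + scale j' E" if "0 \<le> j'" "j' \<le> j" for j'
    using that
  proof (induction rule: int_ge_induct)
    case base
    show ?case by (simp add: scale_def prod_eq_iff)
  next
    case (step k)
    have "(0, k) \<in> D" "(0, k + 1) \<in> D" using down[OF D, of 0 k] down[OF D, of 0 "k + 1"] step ij by auto
    then have "p (0, k + 1) = p (0, k) + E" by (rule east)
    then show ?case using step by (simp add: scale_def prod_eq_iff algebra_simps)
  qed
  have "p (i', j) = p (0, 0) + (scale j E - scale i' N)" if "0 \<le> i'" "i' \<le> i" for i'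
    using that
  proof (induction rule: int_ge_induct)
    case base
    show ?case using row[of j] ij by (simp add: scale_def prod_eq_iff)
  next
    case (step k)
    have "(k, j) \<in> D" "(k + 1, j) \<in> D" using down[OF D, of k j] down[OF D, of "k + 1" j] step ij by auto
    then have "p (k, j) = p (k + 1, j) + N" by (intro north)
    then show ?case using step by (simp add: scale_def prod_eq_iff algebra_simps)
  qed
  then show ?thesis using ij by simp
qed

section \<open>Rectangles without a corner as index sets\<close>

definition box_rect :: "nat \<Rightarrow> nat \<Rightarrow> (int \<times> int) set" where
  "box_rect a b = {0..<int a} \<times> {0..<int b}"

lemma rectangle_minus_corner_eq: "rectangle_minus_corner a b = box_rect a b - {(int a - 1, int b - 1)}"
  by (simp add: rectangle_minus_corner_def box_rect_def)

lemma mem_rectangle_minus_corner: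
  "(i, j) \<in> rectangle_minus_corner a b \<longleftrightarrow>
    0 \<le> i \<and> i < int a \<and> 0 \<le> j \<and> j < int b \<and> \<not> (i = int a - 1 \<and> j = int b - 1)"
  by (auto simp: rectangle_minus_corner_def)

lemma rectangle_minus_corner_down:
  "(i, j) \<in> rectangle_minus_corner a b \<Longrightarrow> 0 \<le> i' \<Longrightarrow> i' \<le> i \<Longrightarrow> 0 \<le> j' \<Longrightarrow> j' \<le> j \<Longrightarrow>
    (i', j') \<in> rectangle_minus_corner a b"
  unfolding mem_rectangle_minus_corner by linarith

lemma composition_rectangle:
  assumes "is_composition k (rectangle_minus_corner a b) \<gamma> v A"
  shows "\<exists>t. A = translate t (lattice_copies \<gamma> (east_shift k v) (north_shift k v) (rectangle_minus_corner a b))"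
proof -
  let ?D = "rectangle_minus_corner a b" and ?E = "east_shift k v" and ?N = "north_shift k v"
  obtain p where p: "\<And>r c. (r, c) \<in> ?D \<Longrightarrow> (r, c + 1) \<in> ?D \<Longrightarrow> p (r, c + 1) = p (r, c) + ?E"
    "\<And>r c. (r + 1, c) \<in> ?D \<Longrightarrow> (r, c) \<in> ?D \<Longrightarrow> p (r, c) = p (r + 1, c) + ?N"
    and A: "A = (\<Union>b\<in>?D. translate (p b) \<gamma>)"
    using assms unfolding is_composition_def by blast
  have pos: "p (i, j) = p (0, 0) + (scale j ?E - scale i ?N)" if "(i, j) \<in> ?D" for i j
    by (rule composition_positions[OF p rectangle_minus_corner_down _ that])
      (auto simp: mem_rectangle_minus_corner)
  have "A = translate (p (0, 0)) (lattice_copies \<gamma> ?E ?N ?D)"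
  proof (rule Set.set_eqI)
    fix x
    have "x \<in> A \<longleftrightarrow> (\<exists>i j. (i, j) \<in> ?D \<and> x - p (i, j) \<in> \<gamma>)" unfolding A by (auto simp: mem_translate)
    also have "\<dots> \<longleftrightarrow> (\<exists>i j. (i, j) \<in> ?D \<and> x - p (0, 0) - (scale j ?E - scale i ?N) \<in> \<gamma>)"
      using pos by (metis diff_diff_eq)
    finally show "x \<in> A \<longleftrightarrow> x \<in> translate (p (0, 0)) (lattice_copies \<gamma> ?E ?N ?D)"
      unfolding mem_translate mem_lattice_copies .
  qed
  then show ?thesis by blast
qed

text \<open>The rotated index set lacks its northwestern corner, from which
  \<open>composition_positions\<close> starts. Negating the boxes restores the missing corner to the
  southeast and reverses both shifts; a half turn of the rectangle then restores the shifts and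
  moves the gap to \<open>(0, 0)\<close>.\<close>

lemma composition_rotated_rectangle:
  assumes "is_composition k (rotate180 (rectangle_minus_corner a b)) \<gamma> v B" and ab: "0 < a" "0 < b"
  shows "\<exists>t. B = translate t (lattice_copies \<gamma> (east_shift k v) (north_shift k v) (box_rect a b - {(0, 0)}))"
proof -
  let ?D = "rectangle_minus_corner a b" and ?E = "east_shift k v" and ?N = "north_shift k v"
  obtain p where p: "\<And>r c. (r, c) \<in> rotate180 ?D \<Longrightarrow> (r, c + 1) \<in> rotate180 ?D \<Longrightarrow> p (r, c + 1) = p (r, c) + ?E"
    "\<And>r c. (r + 1, c) \<in> rotate180 ?D \<Longrightarrow> (r, c) \<in> rotate180 ?D \<Longrightarrow> p (r, c) = p (r + 1, c) + ?N"
    and B: "B = (\<Union>b\<in>rotate180 ?D. translate (p b) \<gamma>)"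
    using assms(1) unfolding is_composition_def by blast
  define p' where "p' b = p (- b)" for b
  have east: "p' (r, c + 1) = p' (r, c) + - ?E" if "(r, c) \<in> ?D" "(r, c + 1) \<in> ?D" for r c
    using p(1)[of "- r" "- c - 1"] that by (simp add: p'_def mem_rotate180 add.commute[of 1])
  have north: "p' (r, c) = p' (r + 1, c) + - ?N" if "(r + 1, c) \<in> ?D" "(r, c) \<in> ?D" for r c
    using p(2)[of "- r - 1" "- c"] that by (simp add: p'_def mem_rotate180 add.commute[of 1])
  have pos: "p' (i, j) = p' (0, 0) + (scale j (- ?E) - scale i (- ?N))" if "(i, j) \<in> ?D" for i j
    by (rule composition_positions[OF east north rectangle_minus_corner_down _ that])
      (auto simp: mem_rectangle_minus_corner)
  have "B = translate (p' (0, 0)) (lattice_copies \<gamma> (- ?E) (- ?N) ?D)"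
  proof (rule Set.set_eqI)
    fix x
    have "x \<in> B \<longleftrightarrow> (\<exists>b. b \<in> rotate180 ?D \<and> x - p b \<in> \<gamma>)" unfolding B by (simp add: mem_translate Bex_def)
    also have "\<dots> \<longleftrightarrow> (\<exists>b. b \<in> ?D \<and> x - p' b \<in> \<gamma>)" unfolding p'_def mem_rotate180 by (metis minus_minus)
    also have "\<dots> \<longleftrightarrow> (\<exists>i j. (i, j) \<in> ?D \<and> x - p' (i, j) \<in> \<gamma>)" by auto
    also have "\<dots> \<longleftrightarrow> (\<exists>i j. (i, j) \<in> ?D \<and> x - p' (0, 0) - (scale j (- ?E) - scale i (- ?N)) \<in> \<gamma>)"
      using pos by (metis diff_diff_eq)
    finally show "x \<in> B \<longleftrightarrow> x \<in> translate (p' (0, 0)) (lattice_copies \<gamma> (- ?E) (- ?N) ?D)"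
      unfolding mem_translate mem_lattice_copies .
  qed
  moreover have "lattice_copies \<gamma> (- ?E) (- ?N) ?D =
      translate (scale (int a - 1) ?N - scale (int b - 1) ?E) (lattice_copies \<gamma> ?E ?N (box_rect a b - {(0, 0)}))"
  proof (rule lattice_copies_reindex[where f = "\<lambda>(i, j). (int a - 1 - i, int b - 1 - j)" and f' = "\<lambda>(i, j). (int a - 1 - i, int b - 1 - j)"])
  qed (auto simp: mem_rectangle_minus_corner box_rect_def scale_def prod_eq_iff algebra_simps)
  ultimately show ?thesis by (metis translate_translate)
qed

lemma exchangeable_translate: "exchangeable A B \<Longrightarrow> exchangeable (translate s A) (translate s' B)"
  unfolding exchangeable_def using translate_translate by metis

text \<open>\<open>v + (1, 1)\<close> and \<open>v\<close> are the east and north shifts of an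
  \<open>Upward\<close> shape. Transposition exchanges the two directions and reverses them, which
  gives the shifts of a \<open>Rightward\<close> shape with displacement
  \<open>- transpose_box v\<close>.\<close>

lemma transpose_lattice_copies:
  "transpose_boxes (lattice_copies \<gamma> (v + (1, 1)) v Q) =
    lattice_copies (transpose_boxes \<gamma>) (- transpose_box v) (- transpose_box v - (1, 1)) (prod.swap ` Q)"
proof (rule Set.set_eqI)
  fix p
  have "transpose_box p - (scale j (v + (1, 1)) - scale i v) =
      transpose_box (p - (scale i (- transpose_box v) - scale j (- transpose_box v - (1, 1))))" for i j
    by (simp add: transpose_box_def scale_def prod_eq_iff algebra_simps)
  then show "p \<in> transpose_boxes (lattice_copies \<gamma> (v + (1, 1)) v Q) \<longleftrightarrow>
      p \<in> lattice_copies (transpose_boxes \<gamma>) (- transpose_box v) (- transpose_box v - (1, 1)) (prod.swap ` Q)"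
    by (auto simp: mem_transpose_boxes mem_lattice_copies)
qed

text \<open>A single row or column without its last place and without its first place differ by one
  step, so the arrangements are translates of each other.\<close>

lemma lattice_copies_single_row:
  assumes "a = 1 \<or> b = 1"
  shows "\<exists>t. lattice_copies \<gamma> E N (box_rect a b - {(0, 0)}) = translate t (lattice_copies \<gamma> E N (rectangle_minus_corner a b))"
proof (cases "a = 1")
  case True
  have "lattice_copies \<gamma> E N (box_rect a b - {(0, 0)}) = translate E (lattice_copies \<gamma> E N (rectangle_minus_corner a b))"
    by (rule lattice_copies_reindex[where f = "\<lambda>(i, j). (i, j + 1)" and f' = "\<lambda>(i, j). (i, j - 1)"])
      (use True in \<open>auto simp: mem_rectangle_minus_corner box_rect_def scale_def prod_eq_iff algebra_simps\<close>)
  then show ?thesis by blast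
next
  case False
  have "lattice_copies \<gamma> E N (box_rect a b - {(0, 0)}) = translate (- N) (lattice_copies \<gamma> E N (rectangle_minus_corner a b))"
    by (rule lattice_copies_reindex[where f = "\<lambda>(i, j). (i + 1, j)" and f' = "\<lambda>(i, j). (i - 1, j)"])
      (use assms False in \<open>auto simp: mem_rectangle_minus_corner box_rect_def scale_def prod_eq_iff algebra_simps\<close>)
  then show ?thesis by blast
qed

lemma core_lattice_copies_exchangeable:
  assumes "core \<gamma> W v" "tight \<gamma> W v" "tight (rotate180 \<gamma>) (rotate180 (translate v W)) v"
    and ab: "2 \<le> a" "2 \<le> b"
  shows "exchangeable (lattice_copies \<gamma> v (v - (1, 1)) (rectangle_minus_corner a b))
      (lattice_copies \<gamma> v (v - (1, 1)) (box_rect a b - {(0, 0)}))"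
proof -
  have "2 \<le> int a" "2 \<le> int b" using ab by auto
  from core_exchangeable[OF assms(1-3) this] obtain x\<^sub>0 len h g where band: "band_of \<gamma> x\<^sub>0 len h g"
    and ex: "exchangeable
      (copies h g (box_content v) (len - box_content v) (fst v) ({0..<int a} \<times> {0..<int b} - {(int a - 1, int b - 1)}))
      (copies h g (box_content v) (len - box_content v) (fst v) ({0..<int a} \<times> {0..<int b} - {(0, 0)}))"
    by blast
  show ?thesis
    unfolding lattice_copies_band[OF band] rectangle_minus_corner_eq box_rect_def
    by (rule exchangeable_translate[OF ex])
qed

theorem theorem4p12:
  fixes a b :: nat and k :: wow_kind and \<beta> \<gamma> W A B :: "box set" and v :: box
  assumes "0 < a" and "0 < b"
    and "\<beta> = rectangle_minus_corner a b"
    and "wow k \<gamma> W v"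
    and "no_loose_end_ribbons k \<gamma> W v"
    and "is_composition k \<beta> \<gamma> v A"
    and "is_composition k (rotate180 \<beta>) \<gamma> v B"
  shows "A \<sim>\<^sub>s B"
proof -
  let ?E = "east_shift k v" and ?N = "north_shift k v"
  let ?A = "lattice_copies \<gamma> ?E ?N (rectangle_minus_corner a b)"
  let ?B = "lattice_copies \<gamma> ?E ?N (box_rect a b - {(0, 0)})"
  obtain t where A: "A = translate t ?A"
    using composition_rectangle assms(3,6) by blast
  obtain t' where B: "B = translate t' ?B"
    using composition_rotated_rectangle assms(1-3,7) by blast
  show ?thesis
  \<comment> \<open>The corner argument covers the corner copy by the copies \<open>(0, 1)\<close>,
    \<open>(1, 0)\<close> and \<open>(1, 1)\<close>, which are not all present in a single row or
    column.\<close>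
  proof (cases "a = 1 \<or> b = 1")
    case True
    then obtain s where "?B = translate s ?A" using lattice_copies_single_row by blast
    then show ?thesis by (simp add: A B schur_equiv_def skew_schur_translate)
  next
    case False
    then have ab: "2 \<le> a" "2 \<le> b" using assms(1,2) by auto
    have "exchangeable ?A ?B"
    proof (cases k)
      case Rightward
      have sh: "?E = v" "?N = v - (1, 1)"
        by (simp_all add: Rightward east_shift_def north_shift_def amalg_shift_def dot_shift_def prod_eq_iff)
      show ?thesis
        unfolding sh using core_lattice_copies_exchangeable[OF wow_Rightward_core tight_Rightward ab] assms(4,5)
        unfolding Rightward by blast
    next
      case Upward
      have sh: "?E = v + (1, 1)" "?N = v"
        by (simp_all add: Upward east_shift_def north_shift_def amalg_shift_def dot_shift_def)
      have swap: "prod.swap ` rectangle_minus_corner a b = rectangle_minus_corner b a"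
        "prod.swap ` (box_rect a b - {(0, 0)}) = box_rect b a - {(0, 0)}"
        by (force simp: rectangle_minus_corner_def box_rect_def image_iff)+
      note u = assms(4,5)[unfolded Upward]
      have "exchangeable (transpose_boxes ?A) (transpose_boxes ?B)"
        unfolding sh transpose_lattice_copies swap
        by (rule core_lattice_copies_exchangeable[OF wow_Upward_core[OF u(1)] tight_Upward[OF u] ab(2,1)])
      then show ?thesis by (rule exchangeable_transpose)
    qed
    then show ?thesis unfolding A B by (intro exchangeable_schur_equiv exchangeable_translate)
  qed
qed

end
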